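(* Let $X_1,\ldots,X_n$ be the truncated heavy-tailed sample described in the context, with tail index $\alpha>0$, truncation thresholds $(M_n)$ and parameters $\beta,\gamma\in(0,1)$. Suppose that (i) $\max(1-1/\alpha,0)<\beta<1$; (ii) all moments of $L$ are finite; (iii) $\lim_{n\to\infty}nP(H>M_n)=\infty$ and $\lim_{n\to\infty}nP(H>M_n)^{2-\beta}(\log M_n)^2=0$; (iv) the tail of $H$ is second order regularly varying (as defined in the context) with second order parameter $\rho<0$ satisfying $$\rho<-\frac{1-\beta}{\beta}.$$ Then, as $n\to\infty$, $$\sqrt{\hat k_n}\left\{h(\hat k_n,n)-\frac1\alpha\right\}\Longrightarrow N\left(0,\frac1{\alpha^2}\right),$$ where $\Longrightarrow$ denotes convergence in distribution, $h(\cdot,\cdot)$ is the Hill statistic of $X_1,\ldots,X_n$ and $\hat k_n$ is the sample-based choice of $k$, both defined in the context.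
   Context: Model. Let $H,H_1,H_2,\ldots$ be i.i.d. positive random variables such that $x\mapsto P(H>x)$ is regularly varying at infinity with index $-\alpha$, where $\alpha>0$. Let $L,L_1,L_2,\ldots$ be i.i.d. positive random variables, independent of $(H,H_1,H_2,\ldots)$. Let $(M_n)$ be a sequence of positive numbers with $M_n\to\infty$. For each $n$ the observed sample is $X_1,\ldots,X_n$ (a row of a triangular array; the dependence on $n$ is suppressed), where $$X_j:=H_j\mathbf 1(H_j\le M_n)+(M_n+L_j)\mathbf 1(H_j>M_n),\quad 1\le j\le n.$$ Let $X_{(1)}\ge\cdots\ge X_{(n)}$ be the order statistics of $X_1,\ldots,X_n$. The Hill statistic is, for $1\le k\le n$, $$h(k,n):=\frac1k\sum_{i=1}^k\log\frac{X_{(i)}}{X_{(k)}}.$$ Fix $\beta,\gamma\in(0,1)$ and, with $[\cdot]$ the integer part, set $$\hat k_n:=\left[n\left(\frac1n\sum_{j=1}^n\mathbf 1(X_j>\gamma X_{(1)})\right)^\beta\right].$$ Second order regular variation: the tail of $H$ is second order regularly varying with second order parameter $\rho<0$ if there is a function $A:(0,\infty)\to(0,\infty)$, regularly varying at infinity with index $\rho\alpha$, such that for all $x>0$ $$\lim_{t\to\infty}\frac{\frac{P(H>tx)}{P(H>t)}-x^{-\alpha}}{A(t)}=x^{-\alpha}\,\frac{x^{\rho\alpha}-1}{\rho/\alpha}.$$ *)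

theory Defs
  imports "HOL-Probability.Probability"
begin

text \<open>As usual, a regularly varying function is only required to be positive and measurable on
  some neighbourhood of infinity.\<close>

definition regularly_varying :: "(real \<Rightarrow> real) \<Rightarrow> real \<Rightarrow> bool" where
  "regularly_varying f \<alpha> \<longleftrightarrow>
     (\<exists>x0. (\<forall>t\<ge>x0. f t > 0) \<and> f \<in> borel_measurable (restrict_space borel {x0..})) \<and>
     (\<forall>x>0. ((\<lambda>t. f (t * x) / f t) \<longlongrightarrow> x powr \<alpha>) at_top)"

text \<open>Here \<open>F\<close> is a tail function \<open>x \<mapsto> P(H > x)\<close> with tail index \<open>\<alpha>\<close>, i.e. regularly varying with
  index \<open>-\<alpha>\<close>. The auxiliary function \<open>A\<close> lives on the positive half-line; its values elsewhere
  play no role.\<close>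

definition second_order_regularly_varying :: "(real \<Rightarrow> real) \<Rightarrow> real \<Rightarrow> real \<Rightarrow> bool" where
  "second_order_regularly_varying F \<alpha> \<rho> \<longleftrightarrow> \<rho> < 0 \<and>
     (\<exists>A. (\<forall>t>0. A t > 0) \<and> regularly_varying A (\<rho> * \<alpha>) \<and>
        (\<forall>x>0. ((\<lambda>t. (F (t * x) / F t - x powr (-\<alpha>)) / A t)
           \<longlongrightarrow> x powr (-\<alpha>) * ((x powr (\<rho> * \<alpha>) - 1) / (\<rho> / \<alpha>))) at_top))"

definition truncated_sample ::
    "real \<Rightarrow> (nat \<Rightarrow> 'a \<Rightarrow> real) \<Rightarrow> (nat \<Rightarrow> 'a \<Rightarrow> real) \<Rightarrow> 'a \<Rightarrow> nat \<Rightarrow> real" where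
  "truncated_sample m H L \<omega> j =
     H j \<omega> * of_bool (H j \<omega> \<le> m) + (m + L j \<omega>) * of_bool (H j \<omega> > m)"

text \<open>The \<open>i\<close>-th largest of \<open>x 1, \<dots>, x n\<close>, for \<open>1 \<le> i \<le> n\<close>; unspecified for other \<open>i\<close>.\<close>

definition order_stat :: "nat \<Rightarrow> (nat \<Rightarrow> real) \<Rightarrow> nat \<Rightarrow> real" where
  "order_stat n x i = rev (sort (map x [1..<Suc n])) ! (i - 1)"

definition hill :: "nat \<Rightarrow> (nat \<Rightarrow> real) \<Rightarrow> nat \<Rightarrow> real" where
  "hill n x k = 1 / real k * (\<Sum>i=1..k. ln (order_stat n x i / order_stat n x k))"

definition k_hat :: "real \<Rightarrow> real \<Rightarrow> nat \<Rightarrow> (nat \<Rightarrow> real) \<Rightarrow> nat" where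
  "k_hat \<beta> \<gamma> n x =
     nat \<lfloor>real n * (1 / real n * (\<Sum>j=1..n. of_bool (x j > \<gamma> * order_stat n x 1))) powr \<beta>\<rfloor>"

end

theory Submission
  imports Defs
begin

text \<open>
The argument lives on the scale \<open>V = \<alpha> ln H - ln c\<close>. Second order regular variation forces the
tail of \<open>H\<close> to be a pure power up to a power-law relative error, so that
\<open>P(V > s) = exp (-s) (1 + O(exp (- \<tau> s)))\<close> for any \<open>\<tau> < - \<rho>\<close>
(\<open>second_order_tail_expansion\<close>); the bound on \<open>\<rho>\<close> leaves room for \<open>\<tau> \<ge> (1 - \<beta>) / \<beta>\<close>.

Let \<open>N(s)\<close> count the \<open>V\<^sub>j\<close> above \<open>s\<close> and let \<open>W(s)\<close> be the sum of the excesses \<open>(V\<^sub>j - s)\<^sup>+\<close>. If \<open>S\<close> is the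
level of the \<open>k\<close>-th largest observation, then \<open>\<alpha> k h(k) = W(S)\<close> apart from the truncated observations,
and \<open>k\<close> is squeezed between \<open>N(S)\<close> and the left limit of \<open>N\<close> at \<open>S\<close>. Hence \<open>\<alpha> k h(k) - k\<close> is nearly the score \<open>W(S) - N(S)\<close>.
For exponential variables the score is centred at every level, and at a deterministic level \<open>\<sigma>\<close> with
\<open>\<kappa> = n exp (- \<sigma>)\<close> the Lyapunov condition gives asymptotic normality after division by \<open>\<surd>\<kappa>\<close>
(\<open>score_clt\<close>), provided the bias \<open>\<surd>\<kappa> exp (- \<tau> \<sigma>)\<close> vanishes.

The random level \<open>S\<close> is replaced by \<open>\<sigma>\<close> by means of a uniform estimate. Since \<open>W(s) - n exp (-s)\<close> has derivative
\<open>- (N(s) - n exp (-s))\<close>, the change of the score between two levels is controlled by the oscillation of the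
fluctuation \<open>N(s) - n exp (-s)\<close>. Over \<open>[\<sigma> - \<delta>, \<sigma> + \<delta>]\<close> this oscillation is of order \<open>\<surd>(\<delta> \<kappa>)\<close>, because
\<open>N(s) / P(V > s)\<close> is a martingale in \<open>s\<close> and obeys Kolmogorov's maximal inequality
(\<open>empirical_tail_maximal_inequality\<close>, \<open>fluctuation_window\<close>). The estimate holds for all levels of the
window at once, so the choice of \<open>k\<close> may depend on the sample in any way as long as
\<open>k / \<kappa> \<rightarrow> 1\<close> in probability (\<open>random_level_clt\<close>).

For the data-driven \<open>k_hat\<close> the last property holds with \<open>\<sigma> = \<beta> (v + \<alpha> ln \<gamma>)\<close>, where \<open>v\<close> is the logarithmic image of
the truncation point: the maximum of the sample is \<open>M\<^sub>n (1 + o(1))\<close>, as many observations are truncated but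
not enough of them for an overshoot comparable to \<open>M\<^sub>n\<close> to occur, so the count inside \<open>k_hat\<close> is asymptotically
\<open>n P(H > \<gamma> M\<^sub>n)\<close> (\<open>k_lim\<close>). Truncation alters \<open>\<alpha> k h(k)\<close> only by \<open>O(n P(H > M\<^sub>n))\<close> in
mean, which is \<open>o(\<surd>\<kappa>)\<close> because \<open>n P(H > M\<^sub>n)\<close> squared over \<open>\<kappa>\<close> is of order
\<open>n P(H > M\<^sub>n) powr (2 - \<beta>)\<close> (\<open>R_lim\<close>). The same quantity dominates \<open>\<kappa> exp (- 2 \<tau> \<sigma>)\<close>,
the square of the bias, by the choice of \<open>\<tau>\<close>.
\<close>

section \<open>Tails with a second order expansion\<close>

lemma tendsto_exp_decay:
  fixes f :: "'b \<Rightarrow> real"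
  assumes "\<tau> > 0" and "filterlim f at_top G"
  shows "((\<lambda>n. C * exp (- \<tau> * f n)) \<longlongrightarrow> 0) G"
proof -
  have "filterlim (\<lambda>n. - \<tau> * f n) at_bot G"
    using assms by (intro filterlim_tendsto_neg_mult_at_bot[OF tendsto_const]) auto
  then show ?thesis by (rule tendsto_mult_right_zero[OF filterlim_compose[OF exp_at_bot]])
qed

text \<open>The integer translates of \<open>y\<close> form a Cauchy sequence with geometric increments, so \<open>f\<close> has a limit along
\<open>y, y + 1, y + 2, \<dots>\<close>; the shift condition makes these limits agree for all \<open>y\<close>.\<close>

lemma exponentially_near_constant:
  fixes f :: "real \<Rightarrow> real"
  assumes eta: "\<eta> > 0"
    and step: "\<And>y. y \<ge> y0 \<Longrightarrow> \<bar>f (y + 1) - f y\<bar> \<le> C * exp (- \<eta> * y)"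
    and shift: "\<And>r. ((\<lambda>y. f (y + r) - f y) \<longlongrightarrow> 0) at_top"
  shows "\<exists>l. \<forall>y\<ge>y0. \<bar>f y - l\<bar> \<le> C / (1 - exp (- \<eta>)) * exp (- \<eta> * y)"
proof -
  define L where "L y = f y + (\<Sum>m. f (y + real m + 1) - f (y + real m))" for y
  have lt1: "norm (exp (-\<eta>)) < 1" using eta by simp
  have bd: "\<bar>f (y + real m + 1) - f (y + real m)\<bar> \<le> C * exp (- \<eta> * y) * exp (- \<eta>) ^ m" if "y \<ge> y0" for y m
    using step[of "y + real m"] that
    by (simp add: exp_of_nat_mult[symmetric] exp_add[symmetric] algebra_simps)
  have sumg: "summable (\<lambda>m. C * exp (- \<eta> * y) * exp (- \<eta>) ^ m)" for y
    by (intro summable_mult summable_geometric lt1)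
  have sm: "summable (\<lambda>m. f (y + real m + 1) - f (y + real m))" if "y \<ge> y0" for y
    by (rule summable_comparison_test'[OF sumg[of y], of 0]) (use bd[OF that] in simp)
  have lim: "(\<lambda>m. f (y + real m)) \<longlonglongrightarrow> L y" if "y \<ge> y0" for y
  proof -
    have tele: "f y + (\<Sum>i<m. f (y + real i + 1) - f (y + real i)) = f (y + real m)" for m
      by (induction m) (simp_all add: algebra_simps)
    show ?thesis
      using tendsto_add[OF tendsto_const summable_LIMSEQ[OF sm[OF that]], of "f y"]
      unfolding L_def by (simp add: tele)
  qed
  have const: "L y = L y0" if "y \<ge> y0" for y
  proof -
    have "filterlim (\<lambda>m. y0 + real m) at_top sequentially"
      by (rule filterlim_tendsto_add_at_top[OF tendsto_const filterlim_real_sequentially])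
    from filterlim_compose[OF shift[of "y - y0"] this]
    have "(\<lambda>m. f (y + real m) - f (y0 + real m)) \<longlonglongrightarrow> 0"
      by (simp add: algebra_simps)
    moreover have "(\<lambda>m. f (y + real m) - f (y0 + real m)) \<longlonglongrightarrow> L y - L y0"
      by (intro tendsto_diff lim that) simp
    ultimately show ?thesis using LIMSEQ_unique by fastforce
  qed
  show ?thesis
  proof (intro exI allI impI)
    fix y assume y: "y \<ge> y0"
    have "\<bar>L y - f y\<bar> \<le> (\<Sum>m. C * exp (- \<eta> * y) * exp (- \<eta>) ^ m)"
      unfolding L_def using norm_suminf_le[OF _ sumg[of y], of "\<lambda>m. f (y + real m + 1) - f (y + real m)"] bd[OF y]
      by simp
    also have "\<dots> = C / (1 - exp (- \<eta>)) * exp (- \<eta> * y)"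
      by (subst suminf_mult[OF summable_geometric[OF lt1]]) (simp add: suminf_geometric[OF lt1])
    finally show "\<bar>f y - L y0\<bar> \<le> C / (1 - exp (- \<eta>)) * exp (- \<eta> * y)"
      using const[OF y] by (simp add: abs_minus_commute)
  qed
qed

text \<open>Going back from \<open>y\<close> in unit steps reaches the first unit interval after the starting point, where \<open>B\<close> applies.\<close>

lemma exponential_decay_from_unit_steps:
  fixes a :: "real \<Rightarrow> real"
  assumes eta: "\<eta> \<ge> 0" and B: "\<And>y. y \<ge> y0 \<Longrightarrow> a y \<le> B" "B \<ge> 0"
    and step: "\<And>y. y \<ge> y0 \<Longrightarrow> a (y + 1) \<le> exp (- \<eta>) * a y"
    and y: "y \<ge> y0"
  shows "a y \<le> B * exp (\<eta> * (y0 + 1)) * exp (- \<eta> * y)"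
proof -
  have it: "a (z + real m) \<le> exp (- \<eta>) ^ m * B" if "z \<ge> y0" for z m
  proof (induction m)
    case 0 then show ?case using B that by simp
  next
    case (Suc m)
    have "a (z + real m + 1) \<le> exp (- \<eta>) * a (z + real m)" using step that by simp
    also have "\<dots> \<le> exp (- \<eta>) * (exp (- \<eta>) ^ m * B)" using Suc by simp
    finally show ?case by (simp add: algebra_simps)
  qed
  define m where "m = nat \<lfloor>y - y0\<rfloor>"
  have m: "real m \<le> y - y0" "y - y0 < real m + 1" unfolding m_def using y by linarith+
  have "a y \<le> exp (- \<eta>) ^ m * B" using it[of "y - real m" m] m by simp
  also have "exp (- \<eta>) ^ m = exp (- \<eta> * real m)" by (simp add: exp_of_nat_mult[symmetric] mult.commute)
  also have "\<dots> * B \<le> exp (\<eta> * (y0 + 1) - \<eta> * y) * B"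
  proof (intro mult_right_mono B)
    have "\<eta> * (y - (y0 + 1)) \<le> \<eta> * real m" using m eta by (intro mult_left_mono) auto
    then show "exp (- \<eta> * real m) \<le> exp (\<eta> * (y0 + 1) - \<eta> * y)" by (simp add: algebra_simps)
  qed
  finally show ?thesis by (simp add: exp_diff exp_minus field_simps)
qed

lemma abs_exp_minus_one_le:
  fixes x :: real
  assumes "\<bar>x\<bar> \<le> 1/2"
  shows "\<bar>exp x - 1\<bar> \<le> 2 * \<bar>x\<bar>"
proof (cases "x \<ge> 0")
  case True then show ?thesis using real_exp_bound_lemma[of x] assms by simp
next
  case False
  then have "exp x \<le> 1" "x < 0" by auto
  then show ?thesis using exp_ge_add_one_self[of x] by linarith
qed

text \<open>On the logarithmic scale the unit steps of \<open>ln F + \<alpha> y\<close> are comparable with the auxiliary function \<open>A\<close>, and \<open>A\<close>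
decays geometrically along unit steps because it is regularly varying with negative index. The constant \<open>c\<close>
is the exponential of the resulting limit. An exponent \<open>\<tau>\<close> strictly below \<open>- \<rho>\<close> absorbs the slowly varying
part of \<open>A\<close>.\<close>

lemma second_order_tail_expansion:
  fixes F :: "real \<Rightarrow> real"
  assumes mono: "antimono F" and rv: "regularly_varying F (- \<alpha>)" and \<alpha>: "\<alpha> > 0"
    and so: "second_order_regularly_varying F \<alpha> \<rho>" and \<tau>: "0 < \<tau>" "\<tau> < - \<rho>"
  obtains c K y0 where "c > 0" "\<And>y. y \<ge> y0 \<Longrightarrow> \<bar>F (exp y) * exp (\<alpha> * y) / c - 1\<bar> \<le> K * exp (- (\<tau> * \<alpha>) * y)"
proof -
  from so obtain A where \<rho>: "\<rho> < 0" and A: "\<And>t. t > 0 \<Longrightarrow> A t > 0" "regularly_varying A (\<rho> * \<alpha>)"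
    and lim: "\<And>x. x > 0 \<Longrightarrow> ((\<lambda>t. (F (t * x) / F t - x powr (-\<alpha>)) / A t)
           \<longlongrightarrow> x powr (-\<alpha>) * ((x powr (\<rho> * \<alpha>) - 1) / (\<rho> / \<alpha>))) at_top"
    unfolding second_order_regularly_varying_def by blast
  obtain x0 where x0: "\<And>t. t \<ge> x0 \<Longrightarrow> F t > 0" using rv unfolding regularly_varying_def by blast
  have Fpos: "F t > 0" for t
    using x0[of "max t x0"] antimonoD[OF mono, of t "max t x0"] by simp
  define r where "r y = F (exp y * exp 1) / F (exp y) * exp \<alpha>" for y
  define a where "a y = A (exp y)" for y
  have apos: "a y > 0" for y unfolding a_def by (rule A) simp
  define c1 where "c1 = (exp (\<rho> * \<alpha>) - 1) / (\<rho> / \<alpha>)"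
  have c1: "c1 > 0" unfolding c1_def using \<rho> \<alpha> by (simp add: divide_neg_neg mult_neg_pos)
  have "((\<lambda>y. exp \<alpha> * ((F (exp y * exp 1) / F (exp y) - exp 1 powr (-\<alpha>)) / A (exp y)))
        \<longlongrightarrow> exp \<alpha> * (exp 1 powr (-\<alpha>) * ((exp 1 powr (\<rho> * \<alpha>) - 1) / (\<rho> / \<alpha>)))) at_top"
    by (intro tendsto_mult tendsto_const filterlim_compose[OF lim exp_at_top]) simp
  also have "exp \<alpha> * (exp 1 powr (-\<alpha>) * ((exp 1 powr (\<rho> * \<alpha>) - 1) / (\<rho> / \<alpha>))) = c1"
    by (simp add: powr_def c1_def exp_minus)
  also have "(\<lambda>y. exp \<alpha> * ((F (exp y * exp 1) / F (exp y) - exp 1 powr (-\<alpha>)) / A (exp y))) = (\<lambda>y. (r y - 1) / a y)"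
  proof
    fix y
    have "exp \<alpha> * ((X - exp 1 powr (-\<alpha>)) / Y) = (X * exp \<alpha> - 1) / Y" for X Y :: real
      by (simp add: powr_def exp_minus right_diff_distrib)
    then show "exp \<alpha> * ((F (exp y * exp 1) / F (exp y) - exp 1 powr (-\<alpha>)) / A (exp y)) = (r y - 1) / a y"
      unfolding r_def a_def .
  qed
  finally have rlim: "((\<lambda>y. (r y - 1) / a y) \<longlongrightarrow> c1) at_top" .
  have "((\<lambda>y. A (exp y * exp 1) / A (exp y)) \<longlongrightarrow> exp 1 powr (\<rho> * \<alpha>)) at_top"
    using A(2) unfolding regularly_varying_def by (auto intro: filterlim_compose[OF _ exp_at_top])
  then have alim: "((\<lambda>y. a (y + 1) / a y) \<longlongrightarrow> exp (\<rho> * \<alpha>)) at_top"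
    by (simp add: a_def exp_add powr_def)
  have "exp (\<rho> * \<alpha>) < exp (- (\<tau> * \<alpha>))"
    using mult_strict_right_mono[OF \<tau>(2) \<alpha>] by simp
  then have "\<forall>\<^sub>F y in at_top. a (y + 1) / a y < exp (- (\<tau> * \<alpha>))"
    by (rule order_tendstoD(2)[OF alim])
  moreover have "\<forall>\<^sub>F y in at_top. c1 / 2 < (r y - 1) / a y" "\<forall>\<^sub>F y in at_top. (r y - 1) / a y < 2 * c1"
    using c1 by (intro order_tendstoD[OF rlim]; simp)+
  ultimately have "\<forall>\<^sub>F y in at_top. a (y + 1) \<le> exp (- (\<tau> * \<alpha>)) * a y \<and> c1 / 2 * a y \<le> r y - 1 \<and> r y - 1 \<le> 2 * c1 * a y"
  proof eventually_elim
    case (elim y)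
    then show ?case using apos[of y] by (simp add: field_simps)
  qed
  then obtain y0 where y0: "\<And>y. y \<ge> y0 \<Longrightarrow> a (y + 1) \<le> exp (- (\<tau> * \<alpha>)) * a y"
      "\<And>y. y \<ge> y0 \<Longrightarrow> c1 / 2 * a y \<le> r y - 1"  "\<And>y. y \<ge> y0 \<Longrightarrow> r y - 1 \<le> 2 * c1 * a y"
    unfolding eventually_at_top_linorder by blast
  define B where "B = 2 * exp \<alpha> / c1"
  have rle: "r y \<le> exp \<alpha>" for y
  proof -
    have "F (exp y * exp 1) \<le> F (exp y)" by (rule antimonoD[OF mono]) simp
    then have "F (exp y * exp 1) / F (exp y) \<le> 1" using Fpos[of "exp y"] by simp
    then show ?thesis unfolding r_def by (metis exp_ge_zero mult_1 mult_right_mono)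
  qed
  \<comment> \<open>Since \<open>r\<close> is bounded, so is \<open>a\<close>: this is the bound from which the decay along unit steps starts.\<close>
  have aB: "a y \<le> B" if "y \<ge> y0" for y
    using y0(2)[OF that] rle[of y] c1 unfolding B_def by (simp add: field_simps)
  define C where "C = 2 * c1 * (B * exp (\<tau> * \<alpha> * (y0 + 1)))"
  have a_decay: "a y \<le> B * exp (\<tau> * \<alpha> * (y0 + 1)) * exp (- (\<tau> * \<alpha>) * y)" if "y \<ge> y0" for y
    by (rule exponential_decay_from_unit_steps[where a = a and \<eta> = "\<tau> * \<alpha>" and ?y0.0 = y0 and B = B])
      (use \<tau> \<alpha> c1 aB y0(1) that in \<open>auto simp: B_def\<close>)
  define f where "f y = ln (F (exp y)) + \<alpha> * y" for y
  have f_diff: "f (y + h) - f y = ln (F (exp y * exp h) / F (exp y)) + \<alpha> * h" for y h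
    unfolding f_def using Fpos[of "exp y"] Fpos[of "exp y * exp h"] by (simp add: ln_div exp_add algebra_simps)
  have f_step: "\<bar>f (y + 1) - f y\<bar> \<le> C * exp (- (\<tau> * \<alpha>) * y)" if y: "y \<ge> y0" for y
  proof -
    have rp: "1 \<le> r y" using y0(2)[OF y] apos[of y] c1 by (smt (verit) divide_pos_pos mult_pos_pos)
    have "f (y + 1) - f y = ln (r y)"
      unfolding f_diff r_def using Fpos[of "exp y"] Fpos[of "exp y * exp 1"] by (subst ln_mult) auto
    then have "\<bar>f (y + 1) - f y\<bar> \<le> r y - 1" using rp ln_le_minus_one[of "r y"] by simp
    also have "\<dots> \<le> 2 * c1 * a y" by (rule y0(3)[OF y])
    also have "\<dots> \<le> 2 * c1 * (B * exp (\<tau> * \<alpha> * (y0 + 1)) * exp (- (\<tau> * \<alpha>) * y))"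
      using a_decay[OF y] c1 by (intro mult_left_mono) auto
    finally show ?thesis by (simp add: C_def mult.assoc)
  qed
  have f_shift: "((\<lambda>y. f (y + h) - f y) \<longlongrightarrow> 0) at_top" for h
  proof -
    have "((\<lambda>y. F (exp y * exp h) / F (exp y)) \<longlongrightarrow> exp h powr (- \<alpha>)) at_top"
      using rv unfolding regularly_varying_def by (auto intro: filterlim_compose[OF _ exp_at_top])
    then have "((\<lambda>y. ln (F (exp y * exp h) / F (exp y)) + \<alpha> * h) \<longlongrightarrow> ln (exp h powr (- \<alpha>)) + \<alpha> * h) at_top"
      by (intro tendsto_intros) auto
    then show ?thesis unfolding f_diff by (simp add: powr_def)
  qed
  have \<tau>\<alpha>: "\<tau> * \<alpha> > 0" using \<tau> \<alpha> by simp
  obtain l where l: "\<And>y. y \<ge> y0 \<Longrightarrow> \<bar>f y - l\<bar> \<le> C / (1 - exp (- (\<tau> * \<alpha>))) * exp (- (\<tau> * \<alpha>) * y)"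
    using exponentially_near_constant[of "\<tau> * \<alpha>" y0 f C, OF \<tau>\<alpha> f_step f_shift] by blast
  define D where "D = C / (1 - exp (- (\<tau> * \<alpha>)))"
  have "((\<lambda>y. D * exp (- (\<tau> * \<alpha>) * y)) \<longlongrightarrow> 0) at_top"
    by (rule tendsto_exp_decay[OF \<tau>\<alpha> filterlim_ident])
  then have "\<forall>\<^sub>F y in at_top. D * exp (- (\<tau> * \<alpha>) * y) < 1/2"
    by (rule order_tendstoD) simp
  then obtain y1 where y1: "\<And>y. y \<ge> y1 \<Longrightarrow> D * exp (- (\<tau> * \<alpha>) * y) < 1/2"
    unfolding eventually_at_top_linorder by blast
  show ?thesis
  proof
    show "exp l > 0" by simp
    fix y assume y: "y \<ge> max y0 y1"
    have "F (exp y) * exp (\<alpha> * y) / exp l = exp (f y - l)"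
      unfolding f_def using Fpos by (simp add: exp_diff exp_add)
    also have "\<bar>exp (f y - l) - 1\<bar> \<le> 2 * \<bar>f y - l\<bar>"
    proof (rule abs_exp_minus_one_le)
      have "\<bar>f y - l\<bar> \<le> D * exp (- (\<tau> * \<alpha>) * y)" unfolding D_def using l[of y] y by simp
      moreover have "D * exp (- (\<tau> * \<alpha>) * y) < 1/2" using y1[of y] y by simp
      ultimately show "\<bar>f y - l\<bar> \<le> 1/2" by linarith
    qed
    also have "\<dots> \<le> (2 * D) * exp (- (\<tau> * \<alpha>) * y)" using l[of y] y by (simp add: D_def)
    finally show "\<bar>F (exp y) * exp (\<alpha> * y) / exp l - 1\<bar> \<le> (2 * D) * exp (- (\<tau> * \<alpha>) * y)" .
  qed
qed

section \<open>Order statistics, the Hill statistic and the random sample fraction\<close>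

lemma order_stat_antimono:
  assumes "1 \<le> i" "i \<le> k" "k \<le> n"
  shows "order_stat n x k \<le> order_stat n x i"
proof -
  define l where "l = sort (map x [1..<Suc n])"
  have "length l = n" "sorted l" unfolding l_def by simp_all
  then show ?thesis unfolding order_stat_def l_def[symmetric] using assms
    by (simp add: rev_nth sorted_nth_mono)
qed

lemma sum_order_stat:
  fixes f :: "real \<Rightarrow> 'b::comm_monoid_add"
  shows "(\<Sum>i=1..n. f (order_stat n x i)) = (\<Sum>j=1..n. f (x j))"
proof -
  define l where "l = rev (sort (map x [1..<Suc n]))"
  have len: "length l = n" unfolding l_def by simp
  have "(\<Sum>i=1..n. f (order_stat n x i)) = (\<Sum>i<n. f (l ! i))"
    unfolding order_stat_def l_def[symmetric]
    by (rule sum.reindex_bij_witness[of _ Suc "\<lambda>i. i - 1"]) auto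
  also have "\<dots> = sum_list (map f l)"
    by (subst sum_list_sum_nth) (simp add: len atLeast0LessThan)
  also have "\<dots> = sum_list (map f (map x [1..<Suc n]))"
    unfolding sum_mset_sum_list[symmetric] l_def by (simp add: multiset.map_comp del: upt_Suc)
  also have "\<dots> = (\<Sum>j=1..n. f (x j))"
    by (simp add: sum_list_distinct_conv_sum_set atLeastLessThanSuc_atLeastAtMost comp_def del: upt_Suc)
  finally show ?thesis .
qed

text \<open>The order statistics are used only through this duality with the tail counts.\<close>

lemma order_stat_greater_iff:
  assumes "1 \<le> i" "i \<le> n"
  shows "order_stat n x i > t \<longleftrightarrow> real i \<le> (\<Sum>j=1..n. of_bool (x j > t))"
proof -
  have eq: "(\<Sum>j=1..n. of_bool (x j > t)) = real (card {l\<in>{1..n}. order_stat n x l > t})"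
    by (subst sum_order_stat[of "\<lambda>y. of_bool (y > t)", symmetric]) (simp add: of_bool_def sum.If_cases Int_def)
  show ?thesis
  proof
    assume "order_stat n x i > t"
    then have "{1..i} \<subseteq> {l\<in>{1..n}. order_stat n x l > t}"
      using order_stat_antimono[of _ i n x] assms by (fastforce simp: less_le_trans)
    then have "card {1..i} \<le> card {l\<in>{1..n}. order_stat n x l > t}" by (intro card_mono) auto
    then show "real i \<le> (\<Sum>j=1..n. of_bool (x j > t))" unfolding eq by simp
  next
    assume le: "real i \<le> (\<Sum>j=1..n. of_bool (x j > t))"
    show "order_stat n x i > t"
    proof (rule ccontr)
      assume "\<not> order_stat n x i > t"
      then have os_le: "order_stat n x l \<le> t" if "i \<le> l" "l \<le> n" for l
        using order_stat_antimono[of i l n x] assms(1) that by simp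
      have "{l\<in>{1..n}. order_stat n x l > t} \<subseteq> {1..<i}"
      proof
        fix l assume l: "l \<in> {l\<in>{1..n}. order_stat n x l > t}"
        then have "\<not> i \<le> l" using os_le[of l] by auto
        then show "l \<in> {1..<i}" using l by simp
      qed
      then have "card {l\<in>{1..n}. order_stat n x l > t} \<le> card {1..<i}" by (intro card_mono) auto
      then show False using le assms unfolding eq by simp
    qed
  qed
qed

lemma order_stat_first_ge:
  assumes "j \<in> {1..n}" shows "x j \<le> order_stat n x 1"
proof (rule ccontr)
  assume "\<not> ?thesis"
  then have "(1::real) \<le> (\<Sum>j=1..n. of_bool (x j > order_stat n x 1))"
    using sum_mono2[of "{1..n}" "{j}" "\<lambda>j. of_bool (x j > order_stat n x 1) :: real"] assms by simp
  then show False using order_stat_greater_iff[of 1 n "order_stat n x 1" x] assms by simp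
qed

lemma order_stat_first_le:
  assumes "n \<ge> 1" "\<And>j. j \<in> {1..n} \<Longrightarrow> x j \<le> B" shows "order_stat n x 1 \<le> B"
proof (rule ccontr)
  assume "\<not> ?thesis"
  then have "(1::real) \<le> (\<Sum>j=1..n. of_bool (x j > B))"
    using order_stat_greater_iff[of 1 n B x] assms(1) by simp
  moreover have "(\<Sum>j=1..n. of_bool (x j > B)) = (0::real)"
    using assms(2) by (intro sum.neutral) (auto simp: not_less)
  ultimately show False by simp
qed

text \<open>Observations tied with the \<open>k\<close>-th largest one contribute zero on both sides, so ties are harmless.\<close>

lemma hill_eq_log_excess:
  assumes "1 \<le> k" "k \<le> n" "order_stat n x k = s" "s > 0"
  shows "real k * hill n x k = (\<Sum>j=1..n. max 0 (ln (x j) - ln s) * of_bool (x j > s))"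
proof -
  let ?f = "\<lambda>y. max 0 (ln y - ln s) * of_bool (y > s)"
  have "real k * hill n x k = (\<Sum>i=1..k. ln (order_stat n x i / s))"
    unfolding hill_def using assms by simp
  also have "\<dots> = (\<Sum>i=1..k. ?f (order_stat n x i))"
  proof (rule sum.cong[OF refl])
    fix i assume i: "i \<in> {1..k}"
    have "s \<le> order_stat n x i" using order_stat_antimono[of i k n x] i assms by simp
    then show "ln (order_stat n x i / s) = ?f (order_stat n x i)"
      using assms(4) by (cases "order_stat n x i = s") (auto simp: ln_div)
  qed
  also have "\<dots> = (\<Sum>i=1..n. ?f (order_stat n x i))"
  proof (rule sum.mono_neutral_left)
    show "\<forall>i\<in>{1..n} - {1..k}. ?f (order_stat n x i) = 0"
      using order_stat_antimono[of k _ n x] assms by (auto simp: not_less)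
  qed (use assms in auto)
  also have "\<dots> = (\<Sum>j=1..n. ?f (x j))" by (rule sum_order_stat)
  finally show ?thesis .
qed

lemma borel_measurable_order_stat:
  assumes [measurable]: "\<And>j. (\<lambda>\<omega>. x \<omega> j) \<in> borel_measurable N" and "1 \<le> i" "i \<le> n"
  shows "(\<lambda>\<omega>. order_stat n (x \<omega>) i) \<in> borel_measurable N"
  unfolding borel_measurable_iff_greater order_stat_greater_iff[OF assms(2,3)] by measurable

lemma k_hat_le:
  assumes "0 \<le> \<beta>" shows "k_hat \<beta> \<gamma> n x \<le> n"
proof (cases "n = 0")
  case False
  have "(\<Sum>j=1..n. of_bool (x j > \<gamma> * order_stat n x 1)) \<le> (\<Sum>j=1..n. (1::real))"
    by (intro sum_mono) simp
  then have le: "1 / real n * (\<Sum>j=1..n. of_bool (x j > \<gamma> * order_stat n x 1)) \<le> (1::real)"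
    using False by (simp add: field_simps)
  have "(1 / real n * (\<Sum>j=1..n. of_bool (x j > \<gamma> * order_stat n x 1))) powr \<beta> \<le> (1::real)"
    using powr_mono2[OF assms _ le] by (simp add: sum_nonneg)
  then have "real n * (1 / real n * (\<Sum>j=1..n. of_bool (x j > \<gamma> * order_stat n x 1))) powr \<beta> \<le> real n * 1"
    by (intro mult_left_mono) auto
  then have "\<lfloor>real n * (1 / real n * (\<Sum>j=1..n. of_bool (x j > \<gamma> * order_stat n x 1))) powr \<beta>\<rfloor> \<le> int n"
    by linarith
  then show ?thesis unfolding k_hat_def by simp
qed (simp add: k_hat_def)

lemma measurable_k_hat:
  assumes [measurable]: "\<And>j. (\<lambda>\<omega>. x \<omega> j) \<in> borel_measurable N"
  shows "(\<lambda>\<omega>. k_hat \<beta> \<gamma> n (x \<omega>)) \<in> measurable N (count_space UNIV)"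
proof (cases "n = 0")
  case True then show ?thesis by (simp add: k_hat_def)
next
  case False
  then have [measurable]: "(\<lambda>\<omega>. order_stat n (x \<omega>) 1) \<in> borel_measurable N"
    by (intro borel_measurable_order_stat) auto
  show ?thesis unfolding k_hat_def by measurable
qed

text \<open>The random index takes countably many values, all at most \<open>n\<close>; capping it at \<open>n\<close> avoids the indices for which
\<open>order_stat\<close> is unspecified.\<close>

lemma borel_measurable_hill_k_hat:
  assumes [measurable]: "\<And>j. (\<lambda>\<omega>. x \<omega> j) \<in> borel_measurable N" and \<beta>: "0 \<le> \<beta>"
  shows "(\<lambda>\<omega>. let k = k_hat \<beta> \<gamma> n (x \<omega>) in sqrt (real k) * (hill n (x \<omega>) k - c)) \<in> borel_measurable N"
proof -
  note k = measurable_k_hat[OF assms(1), of \<beta> \<gamma> n]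
  have h: "(\<lambda>\<omega>. sqrt (real k) * (hill n (x \<omega>) k - c)) \<in> borel_measurable N" if "k \<le> n" for k
  proof -
    have os: "(\<lambda>\<omega>. order_stat n (x \<omega>) i) \<in> borel_measurable N" if "i \<in> {1..k}" for i
      using that \<open>k \<le> n\<close> by (intro borel_measurable_order_stat) auto
    have "(\<lambda>\<omega>. \<Sum>i=1..k. ln (order_stat n (x \<omega>) i / order_stat n (x \<omega>) k)) \<in> borel_measurable N"
    proof (rule borel_measurable_sum)
      fix i assume i: "i \<in> {1..k}"
      have [measurable]: "(\<lambda>\<omega>. order_stat n (x \<omega>) i) \<in> borel_measurable N"
        "(\<lambda>\<omega>. order_stat n (x \<omega>) k) \<in> borel_measurable N" using os[of i] os[of k] i by auto
      show "(\<lambda>\<omega>. ln (order_stat n (x \<omega>) i / order_stat n (x \<omega>) k)) \<in> borel_measurable N" by measurable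
    qed
    then show ?thesis unfolding hill_def by measurable
  qed
  have "(\<lambda>\<omega>. sqrt (real (min n k)) * (hill n (x \<omega>) (min n k) - c)) \<in> borel_measurable N" for k
    by (rule h) simp
  then have "(\<lambda>\<omega>. (\<lambda>k \<omega>. sqrt (real (min n k)) * (hill n (x \<omega>) (min n k) - c)) (k_hat \<beta> \<gamma> n (x \<omega>)) \<omega>)
      \<in> borel_measurable N"
    by (rule measurable_compose_countable[OF _ k])
  then show ?thesis by (simp only: Let_def min_absorb2[OF k_hat_le[OF \<beta>]])
qed

text \<open>A relative error \<open>\<eta> < 1\<close> in the count survives the concave power \<open>\<beta>\<close>, and rounding down costs at most one unit,
which is another \<open>\<eta>\<close>-fraction of the target.\<close>

lemma k_hat_near:
  assumes n: "n \<ge> 1" and \<beta>: "0 < \<beta>" "\<beta> \<le> 1" and \<eta>: "0 < \<eta>" "\<eta> < 1" and q: "q > 0"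
    and K: "(1 - \<eta>) * (real n * q) \<le> (\<Sum>j=1..n. of_bool (x j > \<gamma> * order_stat n x 1))"
      "(\<Sum>j=1..n. of_bool (x j > \<gamma> * order_stat n x 1)) \<le> (1 + \<eta>) * (real n * q)"
    and large: "1 \<le> \<eta> * (real n * q powr \<beta>)"
  shows "\<bar>real (k_hat \<beta> \<gamma> n x) - real n * q powr \<beta>\<bar> \<le> 2 * \<eta> * (real n * q powr \<beta>)"
proof -
  define K where "K = (\<Sum>j=1..n. of_bool (x j > \<gamma> * order_stat n x 1) :: real)"
  define y where "y = real n * (1 / real n * K) powr \<beta>"
  have Kn: "(1 - \<eta>) * q \<le> 1 / real n * K" "1 / real n * K \<le> (1 + \<eta>) * q"
    using K n unfolding K_def[symmetric] by (simp_all add: field_simps)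
  have "(1 - \<eta>) * q powr \<beta> \<le> (1 - \<eta>) powr \<beta> * q powr \<beta>"
    using powr_mono'[of \<beta> 1 "1 - \<eta>"] \<beta> \<eta> by (intro mult_right_mono) auto
  also have "\<dots> = ((1 - \<eta>) * q) powr \<beta>" using \<eta> q by (simp add: powr_mult)
  also have "\<dots> \<le> (1 / real n * K) powr \<beta>" using Kn(1) \<beta> \<eta> q by (intro powr_mono2) auto
  finally have lo: "real n * ((1 - \<eta>) * q powr \<beta>) \<le> y" unfolding y_def by (intro mult_left_mono) auto
  have K0: "0 \<le> 1 / real n * K" unfolding K_def by (simp add: sum_nonneg)
  have "(1 / real n * K) powr \<beta> \<le> ((1 + \<eta>) * q) powr \<beta>" using Kn(2) \<beta> K0 by (intro powr_mono2) auto
  also have "\<dots> = (1 + \<eta>) powr \<beta> * q powr \<beta>" using \<eta> q by (simp add: powr_mult)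
  also have "\<dots> \<le> (1 + \<eta>) * q powr \<beta>"
    using powr_mono[of \<beta> 1 "1 + \<eta>"] \<beta> \<eta> by (intro mult_right_mono) auto
  finally have up: "y \<le> real n * ((1 + \<eta>) * q powr \<beta>)" unfolding y_def by (intro mult_left_mono) auto
  have y0: "0 \<le> y" unfolding y_def by simp
  have "real (k_hat \<beta> \<gamma> n x) = of_int \<lfloor>y\<rfloor>"
    using y0 unfolding k_hat_def K_def[symmetric] y_def[symmetric] by simp
  then have "real (k_hat \<beta> \<gamma> n x) \<le> y" "y - 1 \<le> real (k_hat \<beta> \<gamma> n x)" by linarith+
  moreover have "real n * ((1 - \<eta>) * q powr \<beta>) = real n * q powr \<beta> - \<eta> * (real n * q powr \<beta>)"
    "real n * ((1 + \<eta>) * q powr \<beta>) = real n * q powr \<beta> + \<eta> * (real n * q powr \<beta>)" by (simp_all add: algebra_simps)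
  ultimately show ?thesis using lo up large unfolding abs_le_iff by linarith
qed

section \<open>Moments, independence and maximal inequalities\<close>

lemma tendsto_zero_of_square:
  fixes f :: "nat \<Rightarrow> real"
  assumes "(\<lambda>n. (f n)\<^sup>2) \<longlonglongrightarrow> 0" shows "f \<longlonglongrightarrow> 0"
  using tendsto_real_sqrt[OF assms] by (simp add: tendsto_rabs_zero_iff)

lemma (in prob_space)
  assumes "{\<omega>\<in>space M. Q \<omega>} \<in> sets M"
  shows expectation_of_bool: "expectation (\<lambda>\<omega>. of_bool (Q \<omega>)) = \<P>(\<omega> in M. Q \<omega>)"
    and integrable_of_bool: "integrable M (\<lambda>\<omega>. of_bool (Q \<omega>) :: real)"
proof -
  have "expectation (\<lambda>\<omega>. of_bool (Q \<omega>)) = expectation (indicator {\<omega>\<in>space M. Q \<omega>})"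
    by (intro Bochner_Integration.integral_cong) (auto simp: indicator_def)
  also have "\<dots> = \<P>(\<omega> in M. Q \<omega>)" 
    unfolding Bochner_Integration.integral_indicator by (rule arg_cong[where f = prob]) auto
  finally show "expectation (\<lambda>\<omega>. of_bool (Q \<omega>)) = \<P>(\<omega> in M. Q \<omega>)" .
  have "integrable M (indicator {\<omega>\<in>space M. Q \<omega>} :: 'a \<Rightarrow> real)"
    using assms by (intro integrable_real_indicator) (simp_all add: less_top[symmetric])
  then show "integrable M (\<lambda>\<omega>. of_bool (Q \<omega>) :: real)"
    by (rule Bochner_Integration.integrable_cong[THEN iffD1, rotated -1]) (auto simp: indicator_def)
qed

text \<open>Resetting the coordinate \<open>j\<close> to a constant leaves a function of the other coordinates, which are independent of
\<open>V j\<close>. This replaces conditioning on the past in the martingale argument below.\<close>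

lemma (in prob_space) expectation_leave_one_out:
  fixes V :: "'i \<Rightarrow> 'a \<Rightarrow> real" and f :: "real \<Rightarrow> real" and g :: "('i \<Rightarrow> real) \<Rightarrow> real"
  assumes ind: "indep_vars (\<lambda>_. borel) V I" and j: "j \<in> I"
    and f[measurable]: "f \<in> borel_measurable borel" and g[measurable]: "g \<in> borel_measurable (PiM I (\<lambda>_. borel))"
    and int: "integrable M (\<lambda>\<omega>. f (V j \<omega>))" and bdd: "\<And>x. \<bar>g x\<bar> \<le> B"
  shows "expectation (\<lambda>\<omega>. f (V j \<omega>) * g ((\<lambda>i\<in>I. V i \<omega>)(j := c)))
       = expectation (\<lambda>\<omega>. f (V j \<omega>)) * expectation (\<lambda>\<omega>. g ((\<lambda>i\<in>I. V i \<omega>)(j := c)))"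
proof -
  have rv: "\<And>i. i \<in> I \<Longrightarrow> V i \<in> borel_measurable M" using ind unfolding indep_vars_def by auto
  have ind2: "indep_var (PiM {j} (\<lambda>_. borel)) (\<lambda>\<omega>. restrict (\<lambda>i. V i \<omega>) {j})
     (PiM (I - {j}) (\<lambda>_. borel)) (\<lambda>\<omega>. restrict (\<lambda>i. V i \<omega>) (I - {j}))"
    by (rule indep_var_restrict[OF ind]) (use j in auto)
  have ins: "insert j (I - {j}) = I" using j by auto
  have upd: "(\<lambda>x. x(j := c)) \<in> measurable (PiM (I - {j}) (\<lambda>_. borel)) (PiM I (\<lambda>_. borel :: real measure))"
    using measurable_fun_upd[of I "I - {j}" j "\<lambda>x. x" "PiM (I - {j}) (\<lambda>_. borel :: real measure)" "\<lambda>_. borel" "\<lambda>_. c"] ins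
    by simp
  have "indep_var borel ((\<lambda>x. f (x j)) \<circ> (\<lambda>\<omega>. restrict (\<lambda>i. V i \<omega>) {j}))
      borel ((\<lambda>x. g (x(j := c))) \<circ> (\<lambda>\<omega>. restrict (\<lambda>i. V i \<omega>) (I - {j})))"
    by (rule indep_var_compose[OF ind2]) (use measurable_compose[OF upd g] in auto)
  moreover have "(\<lambda>x. f (x j)) \<circ> (\<lambda>\<omega>. restrict (\<lambda>i. V i \<omega>) {j}) = (\<lambda>\<omega>. f (V j \<omega>))" by auto
  moreover have "(\<lambda>x. g (x(j := c))) \<circ> (\<lambda>\<omega>. restrict (\<lambda>i. V i \<omega>) (I - {j})) = (\<lambda>\<omega>. g ((\<lambda>i\<in>I. V i \<omega>)(j := c)))"
    by (rule ext) (auto intro!: arg_cong[where f = g])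
  ultimately have iv: "indep_var borel (\<lambda>\<omega>. f (V j \<omega>)) borel (\<lambda>\<omega>. g ((\<lambda>i\<in>I. V i \<omega>)(j := c)))" by simp
  show ?thesis
  proof (rule indep_var_lebesgue_integral[OF iv int])
    show "integrable M (\<lambda>\<omega>. g ((\<lambda>i\<in>I. V i \<omega>)(j := c)))"
      by (rule integrable_const_bound[of _ B]) (use bdd indep_var_rv2[OF iv] in auto)
  qed
qed

lemma (in prob_space) expectation_sum_square:
  fixes X :: "'i \<Rightarrow> 'a \<Rightarrow> real"
  assumes fin: "finite I" and ind: "indep_vars (\<lambda>_. borel) X I"
    and int: "\<And>i. i \<in> I \<Longrightarrow> integrable M (\<lambda>\<omega>. (X i \<omega>)\<^sup>2)" and zero: "\<And>i. i \<in> I \<Longrightarrow> expectation (X i) = 0"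
  shows "integrable M (\<lambda>\<omega>. (\<Sum>i\<in>I. X i \<omega>)\<^sup>2)"
    and "expectation (\<lambda>\<omega>. (\<Sum>i\<in>I. X i \<omega>)\<^sup>2) = (\<Sum>i\<in>I. expectation (\<lambda>\<omega>. (X i \<omega>)\<^sup>2))"
proof -
  have rv: "\<And>i. i \<in> I \<Longrightarrow> X i \<in> borel_measurable M" using ind unfolding indep_vars_def by auto
  have int1: "i \<in> I \<Longrightarrow> integrable M (X i)" for i
    by (rule square_integrable_imp_integrable[OF rv int])
  have prod: "integrable M (\<lambda>\<omega>. X i \<omega> * X l \<omega>) \<and>
      expectation (\<lambda>\<omega>. X i \<omega> * X l \<omega>) = (if l = i then expectation (\<lambda>\<omega>. (X i \<omega>)\<^sup>2) else 0)" if "i \<in> I" "l \<in> I" for i l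
  proof (cases "l = i")
    case True then show ?thesis using int[of i] that by (simp add: power2_eq_square)
  next
    case False
    have "indep_var borel ((\<lambda>x. x i) \<circ> (\<lambda>\<omega>. restrict (\<lambda>i. X i \<omega>) {i}))
        borel ((\<lambda>x. x l) \<circ> (\<lambda>\<omega>. restrict (\<lambda>i. X i \<omega>) {l}))"
      by (rule indep_var_compose[OF indep_var_restrict[OF ind]]) (use that False in auto)
    then have iv: "indep_var borel (X i) borel (X l)" by (simp add: comp_def)
    show ?thesis
      using indep_var_integrable[OF iv] indep_var_lebesgue_integral[OF iv] int1 that zero False by simp
  qed
  have eq: "(\<Sum>i\<in>I. X i \<omega>)\<^sup>2 = (\<Sum>i\<in>I. \<Sum>l\<in>I. X i \<omega> * X l \<omega>)" for \<omega>
    by (simp add: power2_eq_square sum_product)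
  show "integrable M (\<lambda>\<omega>. (\<Sum>i\<in>I. X i \<omega>)\<^sup>2)" unfolding eq using prod by auto
  have "expectation (\<lambda>\<omega>. (\<Sum>i\<in>I. X i \<omega>)\<^sup>2) = (\<Sum>i\<in>I. \<Sum>l\<in>I. expectation (\<lambda>\<omega>. X i \<omega> * X l \<omega>))"
    unfolding eq using prod by (subst Bochner_Integration.integral_sum; auto)+
  also have "\<dots> = (\<Sum>i\<in>I. expectation (\<lambda>\<omega>. (X i \<omega>)\<^sup>2))"
    using prod fin by (intro sum.cong refl) simp
  finally show "expectation (\<lambda>\<omega>. (\<Sum>i\<in>I. X i \<omega>)\<^sup>2) = (\<Sum>i\<in>I. expectation (\<lambda>\<omega>. (X i \<omega>)\<^sup>2))" .
qed

text \<open>The second moment, rather than the variance, appears on the right: it is simpler to compute for indicators and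
scores, and here the means are negligible.\<close>

lemma (in prob_space) chebyshev_indep_sum:
  fixes X :: "'i \<Rightarrow> 'a \<Rightarrow> real"
  assumes fin: "finite I" and ind: "indep_vars (\<lambda>_. borel) X I"
    and int: "\<And>i. i \<in> I \<Longrightarrow> integrable M (\<lambda>\<omega>. (X i \<omega>)\<^sup>2)" and c: "c > 0"
  shows "\<P>(\<omega> in M. \<bar>(\<Sum>i\<in>I. X i \<omega>) - (\<Sum>i\<in>I. expectation (X i))\<bar> \<ge> c)
     \<le> (\<Sum>i\<in>I. expectation (\<lambda>\<omega>. (X i \<omega>)\<^sup>2)) / c\<^sup>2"
proof -
  have rv: "\<And>i. i \<in> I \<Longrightarrow> X i \<in> borel_measurable M" using ind unfolding indep_vars_def by auto
  have int1: "i \<in> I \<Longrightarrow> integrable M (X i)" for i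
    by (rule square_integrable_imp_integrable[OF rv int])
  define Y where "Y i \<omega> = X i \<omega> - expectation (X i)" for i \<omega>
  have indY: "indep_vars (\<lambda>_. borel) Y I"
    unfolding Y_def[abs_def] by (rule indep_vars_compose2[OF ind]) auto
  have sqY: "(Y i \<omega>)\<^sup>2 = (X i \<omega>)\<^sup>2 - 2 * expectation (X i) * X i \<omega> + (expectation (X i))\<^sup>2" for i \<omega>
    unfolding Y_def by (simp add: power2_diff algebra_simps)
  have intY: "integrable M (\<lambda>\<omega>. (Y i \<omega>)\<^sup>2)" if "i \<in> I" for i
    unfolding sqY using int[OF that] int1[OF that] by auto
  have zeroY: "expectation (Y i) = 0" if "i \<in> I" for i
    unfolding Y_def using int1[OF that] by (simp add: prob_space)
  have leY: "expectation (\<lambda>\<omega>. (Y i \<omega>)\<^sup>2) \<le> expectation (\<lambda>\<omega>. (X i \<omega>)\<^sup>2)" if "i \<in> I" for i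
    unfolding sqY using int[OF that] int1[OF that] by (simp add: prob_space power2_eq_square)
  note sq = expectation_sum_square[OF fin indY intY zeroY]
  have Yeq: "(\<Sum>i\<in>I. X i \<omega>) - (\<Sum>i\<in>I. expectation (X i)) = (\<Sum>i\<in>I. Y i \<omega>)" for \<omega>
    by (simp add: Y_def sum_subtractf)
  have "\<P>(\<omega> in M. \<bar>\<Sum>i\<in>I. Y i \<omega>\<bar> \<ge> c) \<le> expectation (\<lambda>\<omega>. (\<Sum>i\<in>I. Y i \<omega>)\<^sup>2) / c\<^sup>2"
  proof -
    have "{\<omega>\<in>space M. \<bar>\<Sum>i\<in>I. Y i \<omega>\<bar> \<ge> c} = {\<omega>\<in>space M. (\<Sum>i\<in>I. Y i \<omega>)\<^sup>2 \<ge> c\<^sup>2}"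
      using c by (auto simp: abs_le_square_iff[symmetric])
    then show ?thesis
      using integral_Markov_inequality_measure[of M "\<lambda>\<omega>. (\<Sum>i\<in>I. Y i \<omega>)\<^sup>2" "space M" "c\<^sup>2"] sq(1) c by simp
  qed
  also have "\<dots> \<le> (\<Sum>i\<in>I. expectation (\<lambda>\<omega>. (X i \<omega>)\<^sup>2)) / c\<^sup>2"
    using sq(2) leY by (intro divide_right_mono) (auto intro: sum_mono)
  finally show ?thesis unfolding Yeq .
qed

text \<open>The condition \<open>orth\<close> is all that the classical proof extracts from the martingale property: the increment after the first
passage time is orthogonal to the value at that time, restricted to the passage event.\<close>

lemma (in prob_space) kolmogorov_maximal_inequality:
  fixes Z :: "nat \<Rightarrow> 'a \<Rightarrow> real"
  assumes Z[measurable]: "\<And>i. Z i \<in> borel_measurable M" and bdd: "\<And>i \<omega>. i \<le> m \<Longrightarrow> \<bar>Z i \<omega>\<bar> \<le> B" and c: "c > 0"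
    and orth: "\<And>i. i \<le> m \<Longrightarrow>
      expectation (\<lambda>\<omega>. (Z m \<omega> - Z i \<omega>) * (Z i \<omega> * of_bool (\<bar>Z i \<omega>\<bar> \<ge> c \<and> (\<forall>l<i. \<bar>Z l \<omega>\<bar> < c)))) = 0"
  shows "\<P>(\<omega> in M. \<exists>i\<le>m. \<bar>Z i \<omega>\<bar> \<ge> c) \<le> expectation (\<lambda>\<omega>. (Z m \<omega>)\<^sup>2) / c\<^sup>2"
proof -
  define a where "a i \<omega> \<longleftrightarrow> \<bar>Z i \<omega>\<bar> \<ge> c \<and> (\<forall>l<i. \<bar>Z l \<omega>\<bar> < c)" for i \<omega>
  have [measurable]: "Measurable.pred M (a i)" for i unfolding a_def[abs_def] by measurable
  let ?E = "\<lambda>\<omega>. \<exists>i\<le>m. \<bar>Z i \<omega>\<bar> \<ge> c"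
  let ?t = "\<lambda>i \<omega>. (Z m \<omega> - Z i \<omega>) * (Z i \<omega> * of_bool (a i \<omega>))"
  have B0: "B \<ge> 0" using bdd[of 0] abs_ge_zero order_trans by blast
  have int_t: "integrable M (?t i)" if i: "i \<le> m" for i
  proof (rule integrable_const_bound)
    show "AE \<omega> in M. norm (?t i \<omega>) \<le> (B + B) * (B * 1)"
    proof (intro AE_I2)
      fix \<omega>
      have "\<bar>Z m \<omega> - Z i \<omega>\<bar> \<le> B + B" using bdd[of m \<omega>] bdd[OF i, of \<omega>] by linarith
      then show "norm (?t i \<omega>) \<le> (B + B) * (B * 1)"
        unfolding real_norm_def abs_mult using bdd[OF i, of \<omega>] B0 by (intro mult_mono) auto
    qed
  qed measurable
  have int_sq: "integrable M (\<lambda>\<omega>. (Z m \<omega>)\<^sup>2)"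
  proof (rule integrable_const_bound)
    show "AE \<omega> in M. norm ((Z m \<omega>)\<^sup>2) \<le> B\<^sup>2"
      using bdd[of m] by (auto intro!: AE_I2 simp: power2_le_iff_abs_le B0)
  qed measurable
  have pw: "c\<^sup>2 * of_bool (?E \<omega>) + 2 * (\<Sum>i\<le>m. ?t i \<omega>) \<le> (Z m \<omega>)\<^sup>2" for \<omega>
  proof (cases "?E \<omega>")
    case True
    define i0 where "i0 = (LEAST i. \<bar>Z i \<omega>\<bar> \<ge> c)"
    have ex: "\<exists>i. \<bar>Z i \<omega>\<bar> \<ge> c" using True by blast
    have i0: "\<bar>Z i0 \<omega>\<bar> \<ge> c" unfolding i0_def by (rule LeastI_ex[OF ex])
    have lt: "\<bar>Z l \<omega>\<bar> < c" if "l < i0" for l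
      using not_less_Least[OF that[unfolded i0_def]] by simp
    have i0m: "i0 \<le> m" using True unfolding i0_def by (meson Least_le order_trans)
    have a_iff: "a i \<omega> \<longleftrightarrow> i = i0" for i
      unfolding a_def using i0 lt by (metis linorder_cases not_less)
    have "(\<Sum>i\<le>m. ?t i \<omega>) = (\<Sum>i\<in>{i0}. ?t i \<omega>)"
      by (rule sum.mono_neutral_right) (use i0m a_iff in auto)
    also have "\<dots> = (Z m \<omega> - Z i0 \<omega>) * Z i0 \<omega>" by (simp add: a_iff)
    finally have s: "(\<Sum>i\<le>m. ?t i \<omega>) = (Z m \<omega> - Z i0 \<omega>) * Z i0 \<omega>" .
    have "(Z m \<omega>)\<^sup>2 - 2 * ((Z m \<omega> - Z i0 \<omega>) * Z i0 \<omega>) = (Z m \<omega> - Z i0 \<omega>)\<^sup>2 + (Z i0 \<omega>)\<^sup>2"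
      by (simp add: power2_eq_square algebra_simps)
    moreover have "c\<^sup>2 \<le> (Z i0 \<omega>)\<^sup>2" using i0 c by (simp add: abs_le_square_iff[symmetric])
    moreover have "0 \<le> (Z m \<omega> - Z i0 \<omega>)\<^sup>2" by simp
    ultimately have "c\<^sup>2 * 1 + 2 * ((Z m \<omega> - Z i0 \<omega>) * Z i0 \<omega>) \<le> (Z m \<omega>)\<^sup>2" by linarith
    moreover have "of_bool (?E \<omega>) = (1::real)" using True by simp
    ultimately show ?thesis unfolding s by (simp only:)
  next
    case False
    then have "\<not> a i \<omega>" if "i \<le> m" for i using that unfolding a_def by auto
    then have "(\<Sum>i\<le>m. ?t i \<omega>) = 0" by (intro sum.neutral) auto
    then show ?thesis using False by auto
  qed
  have Em: "{\<omega>\<in>space M. ?E \<omega>} \<in> sets M" by measurable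
  note EE = expectation_of_bool[OF Em] and intE = integrable_of_bool[OF Em]
  have "c\<^sup>2 * \<P>(\<omega> in M. ?E \<omega>) + 2 * (\<Sum>i\<le>m. expectation (?t i))
      = expectation (\<lambda>\<omega>. c\<^sup>2 * of_bool (?E \<omega>) + 2 * (\<Sum>i\<le>m. ?t i \<omega>))"
    unfolding EE[symmetric] using int_t intE by (subst Bochner_Integration.integral_add) auto
  also have "\<dots> \<le> expectation (\<lambda>\<omega>. (Z m \<omega>)\<^sup>2)"
    by (intro integral_mono pw Bochner_Integration.integrable_add integrable_mult_right
        Bochner_Integration.integrable_sum intE int_t int_sq) auto
  also have "(\<Sum>i\<le>m. expectation (?t i)) = 0"
    using orth unfolding a_def by (intro sum.neutral) auto
  finally show ?thesis using c by (simp add: field_simps)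
qed

text \<open>Markov's inequality in the form used to discard nonnegative remainders.\<close>

lemma (in prob_space) markov_relative:
  fixes Y :: "nat \<Rightarrow> 'a \<Rightarrow> real"
  assumes int: "\<forall>\<^sub>F n in sequentially. integrable M (Y n)" and nonneg: "\<And>n \<omega>. 0 \<le> Y n \<omega>"
    and a: "\<forall>\<^sub>F n in sequentially. a n > 0" and lim: "(\<lambda>n. expectation (Y n) / a n) \<longlonglongrightarrow> 0" and \<epsilon>: "\<epsilon> > 0"
  shows "(\<lambda>n. \<P>(\<omega> in M. Y n \<omega> > \<epsilon> * a n)) \<longlonglongrightarrow> 0"
proof (rule tendsto_sandwich[OF _ _ tendsto_const])
  show "\<forall>\<^sub>F n in sequentially. \<P>(\<omega> in M. Y n \<omega> > \<epsilon> * a n) \<le> 1 / \<epsilon> * (expectation (Y n) / a n)"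
    using a int
  proof eventually_elim
    case (elim n)
    have [measurable]: "Y n \<in> borel_measurable M" using elim(2) by auto
    have "\<P>(\<omega> in M. Y n \<omega> > \<epsilon> * a n) \<le> \<P>(\<omega> in M. Y n \<omega> \<ge> \<epsilon> * a n)"
      by (intro finite_measure_mono) auto
    also have "\<dots> \<le> expectation (Y n) / (\<epsilon> * a n)"
      using integral_Markov_inequality_measure[OF elim(2), of "space M" "\<epsilon> * a n"] nonneg elim(1) \<epsilon> by simp
    finally show ?case by simp
  qed
  show "(\<lambda>n. 1 / \<epsilon> * (expectation (Y n) / a n)) \<longlonglongrightarrow> 0" by (rule tendsto_mult_right_zero[OF lim])
qed simp

text \<open>Divided by its mean, the tail count is a martingale as the level increases. The increment of the \<open>j\<close>-th summand
beyond level \<open>s i\<close> vanishes unless \<open>V j > s i\<close>, and then every count up to \<open>s i\<close> is unchanged when \<open>V j\<close> is replaced by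
\<open>s i + 1\<close>; so the increment, whose mean is zero, is orthogonal to the past.\<close>

lemma (in prob_space) empirical_tail_maximal_inequality:
  fixes V :: "'i \<Rightarrow> 'a \<Rightarrow> real" and s :: "nat \<Rightarrow> real" and T :: "real \<Rightarrow> real"
  assumes fin: "finite I" and ind: "indep_vars (\<lambda>_. borel) V I"
    and T: "\<And>j x. j \<in> I \<Longrightarrow> \<P>(\<omega> in M. V j \<omega> > x) = T x"
    and mono: "\<And>i l. i \<le> l \<Longrightarrow> l \<le> m \<Longrightarrow> s i \<le> s l"
    and pos: "\<And>i. i \<le> m \<Longrightarrow> T (s i) > 0" and c: "c > 0"
  shows "\<P>(\<omega> in M. \<exists>i\<le>m. \<bar>(\<Sum>j\<in>I. of_bool (V j \<omega> > s i)) / T (s i) - (\<Sum>j\<in>I. of_bool (V j \<omega> > s 0)) / T (s 0)\<bar> \<ge> c)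
     \<le> real (card I) * (1 / T (s m) - 1 / T (s 0)) / c\<^sup>2"
proof -
  have rv: "\<And>i. i \<in> I \<Longrightarrow> V i \<in> borel_measurable M" using ind unfolding indep_vars_def by auto
  define u where "u i v = of_bool (v > s i) / T (s i)" for i v
  define \<zeta> where "\<zeta> i x = (\<Sum>j\<in>I. u i (x j) - u 0 (x j))" for i and x :: "'i \<Rightarrow> real"
  define g where "g i x = \<zeta> i x * of_bool (\<bar>\<zeta> i x\<bar> \<ge> c \<and> (\<forall>l<i. \<bar>\<zeta> l x\<bar> < c))" for i and x :: "'i \<Rightarrow> real"
  define Z where "Z i \<omega> = \<zeta> i (\<lambda>j\<in>I. V j \<omega>)" for i \<omega>
  have u_meas[measurable]: "u i \<in> borel_measurable borel" for i unfolding u_def[abs_def] by measurable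
  have \<zeta>_meas[measurable]: "\<zeta> i \<in> borel_measurable (PiM I (\<lambda>_. borel))" for i
  proof -
    have "(\<lambda>x. u l (x j)) \<in> borel_measurable (PiM I (\<lambda>_. borel))" if "j \<in> I" for l j
      using that by measurable
    then show ?thesis unfolding \<zeta>_def[abs_def] by (intro borel_measurable_sum borel_measurable_diff) auto
  qed
  have g_meas[measurable]: "g i \<in> borel_measurable (PiM I (\<lambda>_. borel))" for i unfolding g_def[abs_def] by measurable
  have Z_meas[measurable]: "Z i \<in> borel_measurable M" for i
    unfolding Z_def[abs_def] by (rule measurable_compose[OF measurable_restrict \<zeta>_meas]) (rule rv)
  define b where "b i = 1 / T (s i)" for i
  have b: "b i \<ge> 0" if "i \<le> m" for i using pos[OF that] by (simp add: b_def)
  have ub: "0 \<le> u i v" "u i v \<le> b i" if "i \<le> m" for i v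
    using b[OF that] by (auto simp: u_def b_def)
  define B where "B = real (card I) * (Max (b ` {..m}) + b 0)"
  have b_Max: "b i \<le> Max (b ` {..m})" if "i \<le> m" for i using that by (intro Max_ge) auto
  have \<zeta>B: "\<bar>\<zeta> i x\<bar> \<le> B" if "i \<le> m" for i x
  proof -
    have "\<bar>\<zeta> i x\<bar> \<le> (\<Sum>j\<in>I. \<bar>u i (x j) - u 0 (x j)\<bar>)" unfolding \<zeta>_def by (rule sum_abs)
    also have "\<dots> \<le> (\<Sum>j\<in>I. Max (b ` {..m}) + b 0)"
    proof (rule sum_mono)
      fix j
      show "\<bar>u i (x j) - u 0 (x j)\<bar> \<le> Max (b ` {..m}) + b 0"
        using ub[OF that, of "x j"] ub[of 0 "x j"] b_Max[OF that] by (simp add: abs_le_iff)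
    qed
    finally show ?thesis by (simp add: B_def)
  qed
  have Zdiff: "Z i \<omega> = (\<Sum>j\<in>I. of_bool (V j \<omega> > s i)) / T (s i) - (\<Sum>j\<in>I. of_bool (V j \<omega> > s 0)) / T (s 0)" for i \<omega>
    by (simp add: Z_def \<zeta>_def u_def sum_subtractf sum_divide_distrib)
  have Eind: "expectation (\<lambda>\<omega>. of_bool (V j \<omega> > x)) = T x" "integrable M (\<lambda>\<omega>. of_bool (V j \<omega> > x) :: real)" if j: "j \<in> I" for j x
  proof -
    have [measurable]: "V j \<in> borel_measurable M" by (rule rv[OF j])
    have S: "{\<omega>\<in>space M. V j \<omega> > x} \<in> sets M" by measurable
    show "expectation (\<lambda>\<omega>. of_bool (V j \<omega> > x)) = T x" using expectation_of_bool[OF S] T[OF j] by simp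
    show "integrable M (\<lambda>\<omega>. of_bool (V j \<omega> > x) :: real)" by (rule integrable_of_bool[OF S])
  qed
  have Eu: "expectation (\<lambda>\<omega>. u i (V j \<omega>)) = 1" "integrable M (\<lambda>\<omega>. u i (V j \<omega>))" if "j \<in> I" "i \<le> m" for i j
    using Eind[OF that(1), of "s i"] pos[OF that(2)] unfolding u_def by auto
  have orth: "expectation (\<lambda>\<omega>. (Z m \<omega> - Z i \<omega>) * (Z i \<omega> * of_bool (\<bar>Z i \<omega>\<bar> \<ge> c \<and> (\<forall>l<i. \<bar>Z l \<omega>\<bar> < c)))) = 0"
    if i: "i \<le> m" for i
  proof -
    let ?f = "\<lambda>v. u m v - u i v"
    have local: "?f (V j \<omega>) * g i (\<lambda>j\<in>I. V j \<omega>) = ?f (V j \<omega>) * g i ((\<lambda>j\<in>I. V j \<omega>)(j := s i + 1))"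
      if j: "j \<in> I" for j \<omega>
    proof (cases "V j \<omega> > s i")
      case False
      then show ?thesis using mono[of i m] i by (simp add: u_def)
    next
      case True
      have "\<zeta> l (\<lambda>j\<in>I. V j \<omega>) = \<zeta> l ((\<lambda>j\<in>I. V j \<omega>)(j := s i + 1))" if l: "l \<le> i" for l
        unfolding \<zeta>_def
      proof (rule sum.cong[OF refl])
        fix j' assume j': "j' \<in> I"
        have "s l \<le> s i" "s 0 \<le> s i" using mono i l by auto
        then show "u l ((\<lambda>j\<in>I. V j \<omega>) j') - u 0 ((\<lambda>j\<in>I. V j \<omega>) j')
           = u l (((\<lambda>j\<in>I. V j \<omega>)(j := s i + 1)) j') - u 0 (((\<lambda>j\<in>I. V j \<omega>)(j := s i + 1)) j')"
          using True j' by (cases "j' = j") (auto simp: u_def)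
      qed
      then have "g i (\<lambda>j\<in>I. V j \<omega>) = g i ((\<lambda>j\<in>I. V j \<omega>)(j := s i + 1))"
        unfolding g_def by simp
      then show ?thesis by simp
    qed
    have gB: "\<bar>g i x\<bar> \<le> B" for x
      using \<zeta>B[OF i, of x] unfolding g_def by (auto simp: abs_mult of_bool_def split: if_splits)
    have int_f: "integrable M (\<lambda>\<omega>. ?f (V j \<omega>))" if "j \<in> I" for j
      using Eu[OF that] i by auto
    have int_fg: "integrable M (\<lambda>\<omega>. ?f (V j \<omega>) * g i (\<lambda>j\<in>I. V j \<omega>))" if j: "j \<in> I" for j
    proof (rule Bochner_Integration.integrable_bound)
      show "integrable M (\<lambda>\<omega>. B * ?f (V j \<omega>))" using int_f[OF j] by simp
      have [measurable]: "(\<lambda>\<omega>. g i (\<lambda>j\<in>I. V j \<omega>)) \<in> borel_measurable M"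
        by (rule measurable_compose[OF measurable_restrict g_meas]) (rule rv)
      show "(\<lambda>\<omega>. ?f (V j \<omega>) * g i (\<lambda>j\<in>I. V j \<omega>)) \<in> borel_measurable M" using int_f[OF j] by measurable
      show "AE \<omega> in M. norm (?f (V j \<omega>) * g i (\<lambda>j\<in>I. V j \<omega>)) \<le> norm (B * ?f (V j \<omega>))"
        using gB by (intro AE_I2) (auto simp: abs_mult mult.commute intro!: mult_mono order_trans[OF gB])
    qed
    have "(Z m \<omega> - Z i \<omega>) * (Z i \<omega> * of_bool (\<bar>Z i \<omega>\<bar> \<ge> c \<and> (\<forall>l<i. \<bar>Z l \<omega>\<bar> < c)))
        = (\<Sum>j\<in>I. ?f (V j \<omega>) * g i (\<lambda>j\<in>I. V j \<omega>))" for \<omega>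
      by (simp add: Z_def g_def \<zeta>_def sum_subtractf sum_distrib_right[symmetric])
    then have "expectation (\<lambda>\<omega>. (Z m \<omega> - Z i \<omega>) * (Z i \<omega> * of_bool (\<bar>Z i \<omega>\<bar> \<ge> c \<and> (\<forall>l<i. \<bar>Z l \<omega>\<bar> < c))))
        = (\<Sum>j\<in>I. expectation (\<lambda>\<omega>. ?f (V j \<omega>) * g i (\<lambda>j\<in>I. V j \<omega>)))"
      using int_fg by simp
    also have "\<dots> = (\<Sum>j\<in>I. expectation (\<lambda>\<omega>. ?f (V j \<omega>)) * expectation (\<lambda>\<omega>. g i ((\<lambda>j\<in>I. V j \<omega>)(j := s i + 1))))"
    proof (rule sum.cong[OF refl])
      fix j assume j: "j \<in> I"
      show "expectation (\<lambda>\<omega>. ?f (V j \<omega>) * g i (\<lambda>j\<in>I. V j \<omega>))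
        = expectation (\<lambda>\<omega>. ?f (V j \<omega>)) * expectation (\<lambda>\<omega>. g i ((\<lambda>j\<in>I. V j \<omega>)(j := s i + 1)))"
        unfolding local[OF j]
        by (rule expectation_leave_one_out[OF ind j _ g_meas int_f[OF j] gB]) measurable
    qed
    also have "\<dots> = 0" using Eu i by (intro sum.neutral) auto
    finally show ?thesis .
  qed
  have "\<P>(\<omega> in M. \<exists>i\<le>m. \<bar>Z i \<omega>\<bar> \<ge> c) \<le> expectation (\<lambda>\<omega>. (Z m \<omega>)\<^sup>2) / c\<^sup>2"
  proof (rule kolmogorov_maximal_inequality[where B = B, OF Z_meas _ c])
    show "\<bar>Z i \<omega>\<bar> \<le> B" if "i \<le> m" for i \<omega> unfolding Z_def by (rule \<zeta>B[OF that])
  qed (rule orth)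
  also have "expectation (\<lambda>\<omega>. (Z m \<omega>)\<^sup>2) = real (card I) * (1 / T (s m) - 1 / T (s 0))"
  proof -
    define Y where "Y j \<omega> = u m (V j \<omega>) - u 0 (V j \<omega>)" for j \<omega>
    have ZY: "Z m \<omega> = (\<Sum>j\<in>I. Y j \<omega>)" for \<omega> by (simp add: Z_def \<zeta>_def Y_def)
    have indY: "indep_vars (\<lambda>_. borel) Y I"
      unfolding Y_def[abs_def] by (rule indep_vars_compose2[OF ind]) auto
    have sq: "(Y j \<omega>)\<^sup>2 = of_bool (V j \<omega> > s m) * (1 / (T (s m))\<^sup>2 - 2 / (T (s m) * T (s 0)))
        + of_bool (V j \<omega> > s 0) / (T (s 0))\<^sup>2" for j \<omega>
      using mono[of 0 m] by (auto simp: Y_def u_def of_bool_def power2_diff power_divide)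
    have sqE: "expectation (\<lambda>\<omega>. (Y j \<omega>)\<^sup>2) = 1 / T (s m) - 1 / T (s 0)" "integrable M (\<lambda>\<omega>. (Y j \<omega>)\<^sup>2)" if "j \<in> I" for j
    proof -
      have "expectation (\<lambda>\<omega>. (Y j \<omega>)\<^sup>2) = T (s m) * (1 / (T (s m))\<^sup>2 - 2 / (T (s m) * T (s 0))) + T (s 0) / (T (s 0))\<^sup>2"
        unfolding sq using Eind[OF that] by simp
      also have "\<dots> = 1 / T (s m) - 1 / T (s 0)"
        using pos[of m] pos[of 0] by (simp add: field_simps power2_eq_square)
      finally show "expectation (\<lambda>\<omega>. (Y j \<omega>)\<^sup>2) = 1 / T (s m) - 1 / T (s 0)" .
      show "integrable M (\<lambda>\<omega>. (Y j \<omega>)\<^sup>2)" unfolding sq using Eind[OF that] by simp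
    qed
    have zY: "expectation (Y j) = 0" if "j \<in> I" for j
      unfolding Y_def using Eu[OF that] by simp
    show ?thesis unfolding ZY using expectation_sum_square(2)[OF fin indY sqE(2) zY] sqE(1) by simp
  qed
  finally show ?thesis unfolding Zdiff .
qed

text \<open>Layer cake formula for the powers of the positive part.\<close>

lemma (in prob_space) nn_integral_power_excess:
  assumes [measurable]: "X \<in> borel_measurable M"
  shows "(\<integral>\<^sup>+\<omega>. ennreal (max 0 (X \<omega>) ^ Suc l) \<partial>M)
     = (\<integral>\<^sup>+t. ennreal (real (Suc l) * t ^ l) * indicator {0..} t * emeasure M {\<omega>\<in>space M. X \<omega> > t} \<partial>lborel)"
proof -
  interpret PS: pair_sigma_finite M lborel ..
  have layer: "ennreal (max 0 x ^ Suc l) = (\<integral>\<^sup>+t. ennreal (real (Suc l) * t ^ l) * indicator {0..} t * indicator {..<x} t \<partial>lborel)" for x :: real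
  proof -
    have "(\<integral>\<^sup>+t. ennreal (real (Suc l) * t ^ l) * indicator {0..} t * indicator {..<x} t \<partial>lborel)
        = (\<integral>\<^sup>+t. ennreal (real (Suc l) * t ^ l) * indicator {0..max 0 x} t \<partial>lborel)"
    proof (rule nn_integral_cong_AE)
      show "AE t in lborel. ennreal (real (Suc l) * t ^ l) * indicator {0..} t * indicator {..<x} t
          = ennreal (real (Suc l) * t ^ l) * indicator {0..max 0 x} t"
        using AE_lborel_singleton[of x] AE_lborel_singleton[of "0::real"]
        by eventually_elim (auto simp: indicator_def)
    qed
    also have "\<dots> = ennreal (max 0 x ^ Suc l - 0 ^ Suc l)"
    proof (rule nn_integral_FTC_Icc)
      show "((\<lambda>t. t ^ Suc l) has_real_derivative real (Suc l) * t ^ l) (at t)" for t :: real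
        using DERIV_pow[of "Suc l" t] by simp
    qed auto
    finally show ?thesis by simp
  qed
  have "(\<integral>\<^sup>+\<omega>. ennreal (max 0 (X \<omega>) ^ Suc l) \<partial>M)
      = (\<integral>\<^sup>+\<omega>. \<integral>\<^sup>+t. ennreal (real (Suc l) * t ^ l) * indicator {0..} t * indicator {..<X \<omega>} t \<partial>lborel \<partial>M)"
    unfolding layer ..
  also have "\<dots> = (\<integral>\<^sup>+t. \<integral>\<^sup>+\<omega>. ennreal (real (Suc l) * t ^ l) * indicator {0..} t * indicator {..<X \<omega>} t \<partial>M \<partial>lborel)"
    by (rule PS.Fubini'[symmetric]) (auto simp: indicator_def lessThan_def)
  also have "\<dots> = (\<integral>\<^sup>+t. ennreal (real (Suc l) * t ^ l) * indicator {0..} t * emeasure M {\<omega>\<in>space M. X \<omega> > t} \<partial>lborel)"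
  proof (rule nn_integral_cong)
    fix t :: real
    have "(\<integral>\<^sup>+\<omega>. ennreal (real (Suc l) * t ^ l) * indicator {0..} t * indicator {..<X \<omega>} t \<partial>M)
        = (\<integral>\<^sup>+\<omega>. ennreal (real (Suc l) * t ^ l) * indicator {0..} t * indicator {\<omega>\<in>space M. X \<omega> > t} \<omega> \<partial>M)"
      by (intro nn_integral_cong) (auto simp: indicator_def)
    then show "(\<integral>\<^sup>+\<omega>. ennreal (real (Suc l) * t ^ l) * indicator {0..} t * indicator {..<X \<omega>} t \<partial>M)
        = ennreal (real (Suc l) * t ^ l) * indicator {0..} t * emeasure M {\<omega>\<in>space M. X \<omega> > t}"
      by (subst (asm) nn_integral_cmult_indicator) auto
  qed
  finally show ?thesis .
qed

text \<open>A tail squeezed between two multiples of the standard exponential tail has moments squeezed between the same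
multiples of the factorials.\<close>

lemma (in prob_space) power_excess_moment_bounds:
  assumes X[measurable]: "X \<in> borel_measurable M" and a: "0 \<le> a" "a \<le> b"
    and tail: "\<And>t. t \<ge> 0 \<Longrightarrow> a * exp (- t) \<le> \<P>(\<omega> in M. X \<omega> > t)" "\<And>t. t \<ge> 0 \<Longrightarrow> \<P>(\<omega> in M. X \<omega> > t) \<le> b * exp (- t)"
  shows "integrable M (\<lambda>\<omega>. max 0 (X \<omega>) ^ Suc l)"
    and "a * fact (Suc l) \<le> expectation (\<lambda>\<omega>. max 0 (X \<omega>) ^ Suc l)"
    and "expectation (\<lambda>\<omega>. max 0 (X \<omega>) ^ Suc l) \<le> b * fact (Suc l)"
proof -
  let ?E = "\<integral>\<^sup>+\<omega>. ennreal (max 0 (X \<omega>) ^ Suc l) \<partial>M"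
  have exp_int: "(\<integral>\<^sup>+t. ennreal (real (Suc l) * t ^ l) * indicator {0..} t * ennreal (d * exp (- t)) \<partial>lborel)
      = ennreal (d * fact (Suc l))" if d: "d \<ge> 0" for d
  proof -
    have "(\<integral>\<^sup>+t. ennreal (real (Suc l) * t ^ l) * indicator {0..} t * ennreal (d * exp (- t)) \<partial>lborel)
        = (\<integral>\<^sup>+t. ennreal (d * real (Suc l)) * (ennreal (t ^ l * exp (- t)) * indicator {0..} t) \<partial>lborel)"
      using d by (intro nn_integral_cong) (auto simp: indicator_def ennreal_mult[symmetric] ac_simps)
    also have "\<dots> = ennreal (d * real (Suc l)) * ennreal (fact l)"
      by (subst nn_integral_cmult) (auto simp: nn_intergal_power_times_exp_Ici)
    also have "\<dots> = ennreal (d * fact (Suc l))"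
      using d by (simp add: ennreal_mult[symmetric] mult_ac)
    finally show ?thesis .
  qed
  have "?E \<le> (\<integral>\<^sup>+t. ennreal (real (Suc l) * t ^ l) * indicator {0..} t * ennreal (b * exp (- t)) \<partial>lborel)"
    unfolding nn_integral_power_excess[OF X]
    using tail(2) by (intro nn_integral_mono) (auto simp: indicator_def emeasure_eq_measure intro!: mult_left_mono ennreal_leI)
  then have up: "?E \<le> ennreal (b * fact (Suc l))" using exp_int[of b] a by simp
  have "(\<integral>\<^sup>+t. ennreal (real (Suc l) * t ^ l) * indicator {0..} t * ennreal (a * exp (- t)) \<partial>lborel) \<le> ?E"
    unfolding nn_integral_power_excess[OF X]
    using tail(1) by (intro nn_integral_mono) (auto simp: indicator_def emeasure_eq_measure intro!: mult_left_mono ennreal_leI)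
  then have lo: "ennreal (a * fact (Suc l)) \<le> ?E" using exp_int[of a] a by simp
  show int: "integrable M (\<lambda>\<omega>. max 0 (X \<omega>) ^ Suc l)"
  proof (rule integrableI_nonneg)
    show "?E < \<infinity>" using up by (rule le_less_trans) simp
  qed auto
  have eq: "?E = ennreal (expectation (\<lambda>\<omega>. max 0 (X \<omega>) ^ Suc l))"
    by (rule nn_integral_eq_integral[OF int]) auto
  show "a * fact (Suc l) \<le> expectation (\<lambda>\<omega>. max 0 (X \<omega>) ^ Suc l)"
    using lo unfolding eq by (subst (asm) ennreal_le_iff) auto
  show "expectation (\<lambda>\<omega>. max 0 (X \<omega>) ^ Suc l) \<le> b * fact (Suc l)"
    using up a unfolding eq by (subst (asm) ennreal_le_iff) (auto simp del: fact_Suc)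
qed

section \<open>Weak convergence\<close>

lemma norm_iexp_diff_le: "cmod (iexp x - iexp y) \<le> \<bar>x - y\<bar>"
proof -
  have "iexp x - iexp y = iexp y * (iexp (x - y) - 1)"
    by (simp add: exp_add[symmetric] algebra_simps)
  then have "cmod (iexp x - iexp y) = cmod (iexp (x - y) - 1)"
    by (simp add: norm_mult)
  also have "\<dots> \<le> \<bar>x - y\<bar>" using iexp_approx1[of "x - y" 0] by simp
  finally show ?thesis .
qed

text \<open>Slutsky's lemma. The characteristic functions differ by at most \<open>\<bar>t\<bar> \<epsilon>\<close> where the variables are \<open>\<epsilon>\<close>-close and by at
most 2 elsewhere.\<close>

lemma (in prob_space) weak_conv_m_close_in_probability:
  assumes X[measurable]: "\<And>n. X n \<in> borel_measurable M" and Y[measurable]: "\<And>n. Y n \<in> borel_measurable M"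
    and \<mu>: "real_distribution \<mu>" and conv: "weak_conv_m (\<lambda>n. distr M borel (Y n)) \<mu>"
    and close: "\<And>\<epsilon>. \<epsilon> > 0 \<Longrightarrow> (\<lambda>n. \<P>(\<omega> in M. \<bar>X n \<omega> - Y n \<omega>\<bar> > \<epsilon>)) \<longlonglongrightarrow> 0"
  shows "weak_conv_m (\<lambda>n. distr M borel (X n)) \<mu>"
proof (rule levy_continuity)
  fix t :: real
  have char_eq: "char (distr M borel Z) t = (\<integral>\<omega>. iexp (t * Z \<omega>) \<partial>M)" if [measurable]: "Z \<in> borel_measurable M" for Z
    unfolding char_def by (subst integral_distr) auto
  have int: "integrable M (\<lambda>\<omega>. iexp (t * Z \<omega>))" if [measurable]: "Z \<in> borel_measurable M" for Z
    by (rule integrable_const_bound[of _ 1]) auto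
  have Ylim: "(\<lambda>n. char (distr M borel (Y n)) t) \<longlonglongrightarrow> char \<mu> t"
    by (rule levy_continuity1[OF _ \<mu> conv]) simp
  have "(\<lambda>n. char (distr M borel (X n)) t - char (distr M borel (Y n)) t) \<longlonglongrightarrow> 0"
  proof (rule LIMSEQ_I)
    fix r :: real assume r: "r > 0"
    define \<epsilon> where "\<epsilon> = r / (2 * (\<bar>t\<bar> + 1))"
    have \<epsilon>: "\<epsilon> > 0" using r by (simp add: \<epsilon>_def add_nonneg_pos)
    have t\<epsilon>: "\<bar>t\<bar> * \<epsilon> \<le> r / 2" using r by (simp add: \<epsilon>_def field_simps)
    have "\<forall>\<^sub>F n in sequentially. \<P>(\<omega> in M. \<bar>X n \<omega> - Y n \<omega>\<bar> > \<epsilon>) < r / 4"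
      using close[OF \<epsilon>] r by (intro order_tendstoD) auto
    then obtain N where N: "\<And>n. n \<ge> N \<Longrightarrow> \<P>(\<omega> in M. \<bar>X n \<omega> - Y n \<omega>\<bar> > \<epsilon>) < r / 4"
      unfolding eventually_sequentially by blast
    show "\<exists>N. \<forall>n\<ge>N. norm (char (distr M borel (X n)) t - char (distr M borel (Y n)) t - 0) < r"
    proof (intro exI allI impI)
      fix n assume n: "n \<ge> N"
      let ?B = "{\<omega>\<in>space M. \<bar>X n \<omega> - Y n \<omega>\<bar> > \<epsilon>}"
      have B: "?B \<in> sets M" by measurable
      have intB: "integrable M (indicator ?B :: _ \<Rightarrow> real)"
        by (intro integrable_real_indicator B) (simp add: less_top[symmetric])
      have "norm (char (distr M borel (X n)) t - char (distr M borel (Y n)) t)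
          = norm (\<integral>\<omega>. iexp (t * X n \<omega>) - iexp (t * Y n \<omega>) \<partial>M)"
        unfolding char_eq[OF X] char_eq[OF Y] Bochner_Integration.integral_diff[OF int[OF X] int[OF Y]] ..
      also have "\<dots> \<le> (\<integral>\<omega>. norm (iexp (t * X n \<omega>) - iexp (t * Y n \<omega>)) \<partial>M)"
        by (rule integral_norm_bound)
      also have "\<dots> \<le> (\<integral>\<omega>. \<bar>t\<bar> * \<epsilon> + 2 * indicator ?B \<omega> \<partial>M)"
      proof (rule integral_mono)
        show "integrable M (\<lambda>\<omega>. norm (iexp (t * X n \<omega>) - iexp (t * Y n \<omega>)))"
          by (intro integrable_norm Bochner_Integration.integrable_diff int X Y)
        show "integrable M (\<lambda>\<omega>. \<bar>t\<bar> * \<epsilon> + 2 * indicator ?B \<omega>)" using intB by simp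
        fix \<omega> assume \<omega>: "\<omega> \<in> space M"
        have "norm (iexp (t * X n \<omega>) - iexp (t * Y n \<omega>)) \<le> \<bar>t\<bar> * \<bar>X n \<omega> - Y n \<omega>\<bar>"
          using norm_iexp_diff_le[of "t * X n \<omega>" "t * Y n \<omega>"] by (simp add: abs_mult[symmetric] algebra_simps)
        moreover have "\<bar>t\<bar> * \<bar>X n \<omega> - Y n \<omega>\<bar> \<le> \<bar>t\<bar> * \<epsilon>" if "\<omega> \<notin> ?B"
          using that \<omega> by (intro mult_left_mono) auto
        moreover have "norm (iexp (t * X n \<omega>) - iexp (t * Y n \<omega>)) \<le> 2"
          using norm_triangle_ineq4[of "iexp (t * X n \<omega>)" "iexp (t * Y n \<omega>)"] by simp
        moreover have "0 \<le> \<bar>t\<bar> * \<epsilon>" using \<epsilon> by simp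
        ultimately show "norm (iexp (t * X n \<omega>) - iexp (t * Y n \<omega>)) \<le> \<bar>t\<bar> * \<epsilon> + 2 * indicator ?B \<omega>"
          by (cases "\<omega> \<in> ?B") (auto simp del: norm_exp_i_times mem_Collect_eq)
      qed
      also have "\<dots> = \<bar>t\<bar> * \<epsilon> + 2 * prob ?B"
        using intB B by (subst Bochner_Integration.integral_add) (auto simp: prob_space)
      also have "\<dots> < r" using N[OF n] t\<epsilon> by simp
      finally show "norm (char (distr M borel (X n)) t - char (distr M borel (Y n)) t - 0) < r" by simp
    qed
  qed
  from tendsto_add[OF this Ylim] show "(\<lambda>n. char (distr M borel (X n)) t) \<longlonglongrightarrow> char \<mu> t" by simp
qed (use \<mu> in auto)

text \<open>Rows of identically distributed summands whose normalization is already included. The characteristic function of a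
summand is \<open>1 - t\<^sup>2/(2n) + o(1/n)\<close> by the expansion to second order with third moment remainder.\<close>

lemma (in prob_space) lyapunov_triangular_clt:
  fixes X :: "nat \<Rightarrow> nat \<Rightarrow> 'a \<Rightarrow> real"
  assumes indep: "\<And>n. indep_vars (\<lambda>_. borel) (X n) {1..n}"
    and rv: "\<And>n j. X n j \<in> borel_measurable M"
    and ident: "\<And>n j. distr M borel (X n j) = distr M borel (X n 1)"
    and int: "\<forall>\<^sub>F n in sequentially. \<forall>k\<le>3. integrable M (\<lambda>\<omega>. X n 1 \<omega> ^ k)"
    and m1: "(\<lambda>n. real n * expectation (X n 1)) \<longlonglongrightarrow> 0"
    and m2: "(\<lambda>n. real n * expectation (\<lambda>\<omega>. X n 1 \<omega> ^ 2)) \<longlonglongrightarrow> 1"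
    and m3: "(\<lambda>n. real n * expectation (\<lambda>\<omega>. \<bar>X n 1 \<omega>\<bar> ^ 3)) \<longlonglongrightarrow> 0"
  shows "weak_conv_m (\<lambda>n. distr M borel (\<lambda>\<omega>. \<Sum>j=1..n. X n j \<omega>)) std_normal_distribution"
proof (rule levy_continuity)
  note [measurable] = rv
  fix t :: real
  define \<psi> where "\<psi> n = char (distr M borel (X n 1)) t" for n
  define e where "e n = \<bar>t\<bar> * \<bar>real n * expectation (X n 1)\<bar>
     + t^2/2 * \<bar>real n * expectation (\<lambda>\<omega>. X n 1 \<omega> ^ 2) - 1\<bar>
     + \<bar>t\<bar>^3 / 6 * (real n * expectation (\<lambda>\<omega>. \<bar>X n 1 \<omega>\<bar> ^ 3))" for n
  have elim: "e \<longlonglongrightarrow> 0"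
  proof -
    have "e \<longlonglongrightarrow> \<bar>t\<bar> * \<bar>0\<bar> + t^2/2 * \<bar>1 - 1\<bar> + \<bar>t\<bar>^3/6 * 0"
      unfolding e_def
      by (intro tendsto_add tendsto_mult[OF tendsto_const] tendsto_rabs tendsto_diff[OF _ tendsto_const] m1 m2 m3)
    then show ?thesis by simp
  qed
  have char_sum: "char (distr M borel (\<lambda>\<omega>. \<Sum>j=1..n. X n j \<omega>)) t = \<psi> n ^ n" for n
  proof -
    have "char (distr M borel (X n j)) t = \<psi> n" for j unfolding \<psi>_def by (subst ident) (rule refl)
    then show ?thesis by (subst char_distr_sum[OF indep]) simp
  qed
  obtain n0 where n0: "\<And>n k. n \<ge> n0 \<Longrightarrow> k \<le> 3 \<Longrightarrow> integrable M (\<lambda>\<omega>. X n 1 \<omega> ^ k)"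
    using int unfolding eventually_sequentially by blast
  have approx: "real n * cmod (\<psi> n - (1 + (-(t^2) / 2) / n)) \<le> e n" if n: "n \<ge> 1" and "n \<ge> n0" for n
  proof -
    note int = n0[OF \<open>n \<ge> n0\<close>]
    let ?D = "distr M borel (X n 1)"
    interpret D: real_distribution ?D by simp
    have intD: "integrable ?D (\<lambda>x. x ^ k)" if "k \<le> 3" for k
      using int[OF that] by (subst integrable_distr_eq) auto
    have intD2: "integrable ?D (\<lambda>x. x ^ k)" if "k \<le> 2" for k
      using that by (intro intD) simp
    have ED: "D.expectation (\<lambda>x. x ^ k) = expectation (\<lambda>\<omega>. X n 1 \<omega> ^ k)" for k
      by (subst integral_distr) auto
    have int3: "integrable M (\<lambda>\<omega>. \<bar>X n 1 \<omega>\<bar> ^ 3)"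
      using integrable_abs[OF int[of 3]] by (simp add: power_abs)
    have "D.expectation (\<lambda>x. min (2 * \<bar>x\<bar>^2 * Suc 2) (\<bar>t\<bar> * \<bar>x\<bar>^Suc 2))
        = expectation (\<lambda>\<omega>. min (2 * \<bar>X n 1 \<omega>\<bar>^2 * Suc 2) (\<bar>t\<bar> * \<bar>X n 1 \<omega>\<bar>^Suc 2))"
      by (subst integral_distr) auto
    also have "\<dots> \<le> expectation (\<lambda>\<omega>. \<bar>t\<bar> * \<bar>X n 1 \<omega>\<bar>^3)"
    proof (rule integral_mono)
      show i3: "integrable M (\<lambda>\<omega>. \<bar>t\<bar> * \<bar>X n 1 \<omega>\<bar>^3)" using int3 by simp
      show "integrable M (\<lambda>\<omega>. min (2 * \<bar>X n 1 \<omega>\<bar>^2 * Suc 2) (\<bar>t\<bar> * \<bar>X n 1 \<omega>\<bar>^Suc 2))"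
        by (rule Bochner_Integration.integrable_bound[OF i3]) (auto simp: numeral_3_eq_3)
    qed (auto simp: numeral_3_eq_3)
    finally have b3: "D.expectation (\<lambda>x. min (2 * \<bar>x\<bar>^2 * Suc 2) (\<bar>t\<bar> * \<bar>x\<bar>^Suc 2))
        \<le> \<bar>t\<bar> * expectation (\<lambda>\<omega>. \<bar>X n 1 \<omega>\<bar>^3)" by simp
    have "cmod (\<psi> n - (\<Sum>k\<le>2. ((\<i> * t)^k / fact k) * expectation (\<lambda>\<omega>. X n 1 \<omega> ^ k)))
        \<le> (\<bar>t\<bar>^2 / fact (Suc 2)) * (\<bar>t\<bar> * expectation (\<lambda>\<omega>. \<bar>X n 1 \<omega>\<bar>^3))"
      unfolding \<psi>_def ED[symmetric]
      by (rule order_trans[OF D.char_approx2[OF intD2, where t = t] mult_left_mono[OF b3]]) auto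
    also have "\<dots> = \<bar>t\<bar>^3 / 6 * expectation (\<lambda>\<omega>. \<bar>X n 1 \<omega>\<bar>^3)"
      by (simp add: power2_eq_square power3_eq_cube fact_numeral)
    finally have c1: "cmod (\<psi> n - (\<Sum>k\<le>2. ((\<i> * t)^k / fact k) * expectation (\<lambda>\<omega>. X n 1 \<omega> ^ k)))
        \<le> \<bar>t\<bar>^3 / 6 * expectation (\<lambda>\<omega>. \<bar>X n 1 \<omega>\<bar>^3)" .
    let ?a = "expectation (X n 1)" and ?b = "expectation (\<lambda>\<omega>. X n 1 \<omega> ^ 2)"
    have s: "(\<Sum>k\<le>2. ((\<i> * t)^k / fact k) * expectation (\<lambda>\<omega>. X n 1 \<omega> ^ k))
        = 1 + \<i> * (t * ?a) - complex_of_real (t^2/2 * ?b)"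
      by (simp add: numeral_2_eq_2 prob_space power_mult_distrib)
    have s2: "(1 + \<i> * (t * ?a) - complex_of_real (t^2/2 * ?b)) - (1 + (-(t^2) / 2) / n)
        = \<i> * of_real (t * ?a) - complex_of_real (t^2/2 * (?b - 1 / n))"
      by (simp add: algebra_simps)
    have c2: "cmod ((1 + \<i> * (t * ?a) - complex_of_real (t^2/2 * ?b)) - (1 + (-(t^2) / 2) / n))
        \<le> \<bar>t * ?a\<bar> + \<bar>t^2/2 * (?b - 1 / n)\<bar>"
      unfolding s2 by (rule order_trans[OF norm_triangle_ineq4]) (simp add: norm_mult del: of_real_mult of_real_diff)
    have "cmod (\<psi> n - (1 + (-(t^2) / 2) / n))
        \<le> \<bar>t * ?a\<bar> + \<bar>t^2/2 * (?b - 1 / n)\<bar> + \<bar>t\<bar>^3 / 6 * expectation (\<lambda>\<omega>. \<bar>X n 1 \<omega>\<bar>^3)"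
      using norm_triangle_le[OF add_mono[OF c1[unfolded s] c2]] by (simp add: algebra_simps)
    then have "real n * cmod (\<psi> n - (1 + (-(t^2) / 2) / n))
        \<le> real n * (\<bar>t * ?a\<bar> + \<bar>t^2/2 * (?b - 1 / n)\<bar> + \<bar>t\<bar>^3 / 6 * expectation (\<lambda>\<omega>. \<bar>X n 1 \<omega>\<bar>^3))"
      by (intro mult_left_mono) auto
    also have "\<dots> = e n"
    proof -
      have "real n * \<bar>t^2/2 * (?b - 1 / n)\<bar> = t^2/2 * \<bar>real n * (?b - 1/n)\<bar>"
        by (simp add: abs_mult)
      also have "real n * (?b - 1/n) = real n * ?b - 1" using n by (simp add: algebra_simps)
      finally show ?thesis unfolding e_def by (simp add: abs_mult algebra_simps)
    qed
    finally show ?thesis .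
  qed
  have main: "\<forall>\<^sub>F n in sequentially. cmod (\<psi> n ^ n - (1 + (-(t^2) / 2) / n)^n) \<le> e n"
  proof (rule eventually_sequentiallyI)
    fix n :: nat
    assume "n \<ge> max (max 1 n0) (nat \<lceil>t^2 / 4\<rceil>)"
    then have "nat \<lceil>t^2 / 4\<rceil> \<le> n" and n1: "n \<ge> 1" "n \<ge> n0" by auto
    then have n: "n \<ge> t^2 / 4" by (subst (asm) nat_ceiling_le_eq)
    interpret D: real_distribution "distr M borel (X n 1)" by simp
    have "norm (\<psi> n) \<le> 1" unfolding \<psi>_def by (rule D.cmod_char_le_1)
    then have "norm (\<psi> n ^ n - (complex_of_real (1 + (-(t^2) / 2) / n))^n) \<le>
         n * norm (\<psi> n - (complex_of_real (1 + (-(t^2) / 2) / n)))"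
      using n n1 by (auto intro!: norm_power_diff abs_leI
               simp del: of_real_diff simp: of_real_diff[symmetric] divide_le_eq)
    also have "\<dots> \<le> e n" using approx[OF n1] by simp
    finally show "cmod (\<psi> n ^ n - (1 + (-(t^2) / 2) / n)^n) \<le> e n" by simp
  qed
  have "(\<lambda>n. complex_of_real ((1 + (-(t^2) / 2) / n)^n)) \<longlonglongrightarrow> complex_of_real (exp (-(t^2) / 2))"
    by (rule isCont_tendsto_compose [OF _ tendsto_exp_limit_sequentially]) auto
  then have "(\<lambda>n. \<psi> n ^ n) \<longlonglongrightarrow> complex_of_real (exp (-(t^2) / 2))"
    by (rule Lim_transform) (rule Lim_null_comparison[OF main elim])
  then show "(\<lambda>n. char (distr M borel (\<lambda>\<omega>. \<Sum>j=1..n. X n j \<omega>)) t) \<longlonglongrightarrow> char std_normal_distribution t"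
    unfolding char_sum char_std_normal_distribution .
qed (use rv in \<open>auto intro!: real_dist_normal_dist\<close>)

lemma (in prob_space) weak_conv_m_scale_std_normal:
  assumes X[measurable]: "\<And>n. X n \<in> borel_measurable M" and a: "a > 0"
    and conv: "weak_conv_m (\<lambda>n. distr M borel (X n)) std_normal_distribution"
  shows "weak_conv_m (\<lambda>n. distr M borel (\<lambda>\<omega>. a * X n \<omega>)) (density lborel (normal_density 0 a))"
proof -
  have dist: "density lborel (normal_density 0 a) = distr std_normal_distribution borel (\<lambda>x. a * x)"
  proof -
    interpret S: prob_space std_normal_distribution by (rule prob_space_normal_density) simp
    have "distributed std_normal_distribution lborel (\<lambda>x. x) std_normal_density"
      unfolding distributed_def by (simp add: distr_id2)
    then have "distributed std_normal_distribution lborel (\<lambda>x. 0 + a * x) (normal_density (0 + a * 0) (\<bar>a\<bar> * 1))"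
      using a by (intro S.normal_density_affine) auto
    then have "distr std_normal_distribution lborel (\<lambda>x. a * x) = density lborel (normal_density 0 a)"
      using distributed_distr_eq_density a by fastforce
    moreover have "distr std_normal_distribution lborel (\<lambda>x. a * x) = distr std_normal_distribution borel (\<lambda>x. a * x)"
      by (rule distr_cong) auto
    ultimately show ?thesis by simp
  qed
  have rd: "real_distribution (distr std_normal_distribution borel (\<lambda>x. a * x))"
    using real_dist_normal_dist by (intro prob_space.real_distribution_distr) (auto simp: real_distribution_def)
  show ?thesis unfolding dist
  proof (rule levy_continuity)
    fix t
    have "char (distr M borel (\<lambda>\<omega>. a * X n \<omega>)) t = char (distr M borel (X n)) (t * a)" for n
      unfolding char_def by (simp add: integral_distr mult_ac)
    moreover have "char (distr std_normal_distribution borel (\<lambda>x. a * x)) t = char std_normal_distribution (t * a)"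
      unfolding char_def by (simp add: integral_distr mult_ac)
    ultimately show "(\<lambda>n. char (distr M borel (\<lambda>\<omega>. a * X n \<omega>)) t)
        \<longlonglongrightarrow> char (distr std_normal_distribution borel (\<lambda>x. a * x)) t"
      using levy_continuity1[OF _ real_dist_normal_dist conv, of "t * a"] by simp
  qed (use rd in auto)
qed

text \<open>Changing the normalization from \<open>\<surd>\<kappa>\<close> to \<open>\<surd>k\<close> costs a relative error of order \<open>\<delta>\<close>, which compensates the crude
bound on the score \<open>D\<close> of order \<open>(\<epsilon> / \<delta>) \<surd>\<kappa>\<close>.\<close>

lemma sqrt_ratio_error:
  fixes k \<kappa> D q \<epsilon> \<delta> :: real
  assumes \<kappa>: "\<kappa> > 0" and \<delta>: "0 < \<delta>" "\<delta> \<le> 1/2" and \<epsilon>: "\<epsilon> > 0"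
    and k: "\<bar>k - \<kappa>\<bar> \<le> \<delta> / 4 * \<kappa>" and q: "\<bar>q - D\<bar> \<le> 24 * \<epsilon> * sqrt \<kappa>"
    and D: "\<bar>D\<bar> \<le> (\<epsilon> / \<delta> + \<epsilon>) * sqrt \<kappa>"
  shows "\<bar>q / sqrt k - D / sqrt \<kappa>\<bar> \<le> 50 * \<epsilon>"
proof -
  have "\<delta> / 4 * \<kappa> \<le> 1/4 * \<kappa>" using \<delta> \<kappa> by (intro mult_right_mono) auto
  then have k4: "\<kappa> / 4 \<le> k" using abs_le_D2[OF k] \<kappa> by linarith
  then have k0: "k > 0" using \<kappa> by simp
  have sk: "sqrt \<kappa> / 2 \<le> sqrt k"
    using real_sqrt_le_mono[OF k4] by (simp add: real_sqrt_divide)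
  have s\<kappa>: "sqrt \<kappa> > 0" "sqrt k > 0" using \<kappa> k0 by auto
  have q1: "\<bar>(q - D) / sqrt k\<bar> \<le> 48 * \<epsilon>"
  proof -
    have "\<bar>q - D\<bar> / sqrt k \<le> (24 * \<epsilon> * sqrt \<kappa>) / (sqrt \<kappa> / 2)"
      using q sk s\<kappa> \<epsilon> by (intro frac_le) auto
    then show ?thesis using s\<kappa> by simp
  qed
  have q2: "\<bar>D * (1 / sqrt k - 1 / sqrt \<kappa>)\<bar> \<le> \<epsilon> * 2"
  proof -
    have "1 / sqrt k - 1 / sqrt \<kappa> = (\<kappa> - k) / (sqrt k * sqrt \<kappa> * (sqrt \<kappa> + sqrt k))"
    proof -
      have "\<kappa> - k = (sqrt \<kappa> - sqrt k) * (sqrt \<kappa> + sqrt k)" using \<kappa> k0 by (simp add: algebra_simps)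
      moreover have "sqrt \<kappa> + sqrt k \<noteq> 0" using s\<kappa> by linarith
      ultimately have "(\<kappa> - k) / (sqrt k * sqrt \<kappa> * (sqrt \<kappa> + sqrt k)) = (sqrt \<kappa> - sqrt k) / (sqrt k * sqrt \<kappa>)" by simp
      also have "\<dots> = 1 / sqrt k - 1 / sqrt \<kappa>" using s\<kappa> by (simp add: diff_divide_distrib)
      finally show ?thesis by simp
    qed
    then have "\<bar>1 / sqrt k - 1 / sqrt \<kappa>\<bar> = \<bar>\<kappa> - k\<bar> / (sqrt k * sqrt \<kappa> * (sqrt \<kappa> + sqrt k))"
      using s\<kappa> by (simp add: abs_mult)
    also have "\<dots> \<le> (\<delta> / 4 * \<kappa>) / (sqrt \<kappa> / 2 * sqrt \<kappa> * sqrt \<kappa>)"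
      using k sk s\<kappa> \<delta> \<kappa> by (intro frac_le mult_mono) (auto simp: abs_minus_commute)
    also have "\<dots> = \<delta> / 2 / sqrt \<kappa>"
    proof -
      have "sqrt \<kappa> / 2 * sqrt \<kappa> * sqrt \<kappa> = \<kappa> / 2 * sqrt \<kappa>" using \<kappa> by simp
      then show ?thesis using \<kappa> by simp
    qed
    finally have d: "\<bar>1 / sqrt k - 1 / sqrt \<kappa>\<bar> \<le> \<delta> / 2 / sqrt \<kappa>" .
    have "\<bar>D\<bar> * \<bar>1 / sqrt k - 1 / sqrt \<kappa>\<bar> \<le> ((\<epsilon> / \<delta> + \<epsilon>) * sqrt \<kappa>) * (\<delta> / 2 / sqrt \<kappa>)"
      using D d \<delta> \<epsilon> s\<kappa> by (intro mult_mono) auto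
    also have "\<dots> = \<epsilon> / 2 + \<epsilon> * (\<delta> / 2)" using s\<kappa> \<delta> by (simp add: field_simps)
    also have "\<dots> \<le> \<epsilon> / 2 + \<epsilon> * 1" using \<delta> \<epsilon> by (intro add_left_mono mult_left_mono) auto
    also have "\<dots> \<le> \<epsilon> * 2" using \<epsilon> by simp
    finally show ?thesis unfolding abs_mult .
  qed
  have "q / sqrt k - D / sqrt \<kappa> = (q - D) / sqrt k + D * (1 / sqrt k - 1 / sqrt \<kappa>)"
    by (simp add: diff_divide_distrib right_diff_distrib)
  then have "\<bar>q / sqrt k - D / sqrt \<kappa>\<bar> \<le> \<bar>(q - D) / sqrt k\<bar> + \<bar>D * (1 / sqrt k - 1 / sqrt \<kappa>)\<bar>"
    by (simp only: abs_triangle_ineq)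
  also have "\<dots> \<le> 48 * \<epsilon> + \<epsilon> * 2" by (rule add_mono[OF q1 q2])
  finally show ?thesis by simp
qed

section \<open>Samples with nearly exponential tails\<close>

text \<open>Any sequence of i.i.d. variables whose tail is exponential up to an exponentially small relative error. The logarithms of
a sample with Hall-type power tail have this form.\<close>

locale exponential_tail_sample = prob_space M for M :: "'a measure" +
  fixes V :: "nat \<Rightarrow> 'a \<Rightarrow> real" and T :: "real \<Rightarrow> real" and K \<tau> v0 :: real
  assumes indep: "indep_vars (\<lambda>_. borel) V UNIV"
    and ident: "distr M borel (V j) = distr M borel (V 0)"
    and tail_prob: "\<P>(\<omega> in M. V j \<omega> > v) = T v"
    and \<tau>_pos: "\<tau> > 0"
    and tail_expansion: "v \<ge> v0 \<Longrightarrow> \<bar>T v * exp v - 1\<bar> \<le> K * exp (- \<tau> * v)"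
begin

definition exceed :: "nat \<Rightarrow> real \<Rightarrow> 'a \<Rightarrow> real" where
  "exceed n s \<omega> = (\<Sum>j=1..n. of_bool (V j \<omega> > s))"

definition excess :: "nat \<Rightarrow> real \<Rightarrow> 'a \<Rightarrow> real" where
  "excess n s \<omega> = (\<Sum>j=1..n. max 0 (V j \<omega> - s))"

text \<open>For exponential variables the excess over \<open>s\<close>, given that it is positive, has mean 1, so this difference is centred
whatever the level \<open>s\<close>.\<close>

definition score :: "nat \<Rightarrow> real \<Rightarrow> 'a \<Rightarrow> real" where
  "score n s \<omega> = excess n s \<omega> - exceed n s \<omega>"

text \<open>The fluctuation is centred at the ideal exponential value instead of the true mean, since this makes it the negative
derivative of \<open>excess n s - n exp (- s)\<close>.\<close>

definition fluct :: "nat \<Rightarrow> real \<Rightarrow> 'a \<Rightarrow> real" where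
  "fluct n s \<omega> = exceed n s \<omega> - real n * exp (- s)"

lemma V_measurable[measurable]: "V j \<in> borel_measurable M"
  using indep unfolding indep_vars_def by auto

lemma exceed_measurable[measurable]: "exceed n s \<in> borel_measurable M"
  unfolding exceed_def[abs_def] by measurable

lemma excess_measurable[measurable]: "excess n s \<in> borel_measurable M"
  unfolding excess_def[abs_def] by measurable

lemma score_measurable[measurable]: "score n s \<in> borel_measurable M"
  unfolding score_def[abs_def] by measurable

lemma indep_row: "indep_vars (\<lambda>_. borel) V {1..n}"
  by (rule indep_vars_subset[OF indep]) simp

lemma K_nonneg: "K \<ge> 0"
  using tail_expansion[of v0] abs_ge_zero order_trans zero_le_mult_iff[of K "exp (- \<tau> * v0)"] by (metis exp_gt_zero less_eq_real_def not_le order_refl)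

lemma tail_antimono: "s \<le> t \<Longrightarrow> T t \<le> T s"
  unfolding tail_prob[where j = 0, symmetric] by (intro finite_measure_mono) auto

lemma tail_nonneg: "0 \<le> T s"
  unfolding tail_prob[where j = 0, symmetric] by simp

lemma tail_bounds:
  assumes "v0 \<le> s" "s \<le> v" "K * exp (- \<tau> * s) \<le> r"
  shows "(1 - r) * exp (- v) \<le> T v" "T v \<le> (1 + r) * exp (- v)"
proof -
  have "K * exp (- \<tau> * v) \<le> K * exp (- \<tau> * s)"
    using assms(2) \<tau>_pos K_nonneg by (intro mult_left_mono) auto
  then have "\<bar>T v * exp v - 1\<bar> \<le> r" using tail_expansion[of v] assms by simp
  then have "1 - r \<le> T v * exp v" "T v * exp v \<le> 1 + r" by linarith+
  then show "(1 - r) * exp (- v) \<le> T v" "T v \<le> (1 + r) * exp (- v)"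
    by (simp_all add: exp_minus field_simps)
qed

lemma integrable_indicator_tail: "integrable M (\<lambda>\<omega>. of_bool (V j \<omega> > s) :: real)"
  by (rule integrable_of_bool) measurable

lemma expectation_indicator_tail: "expectation (\<lambda>\<omega>. of_bool (V j \<omega> > s)) = T s"
  unfolding tail_prob[where j = j, symmetric] by (rule expectation_of_bool) measurable

lemma exceed_chebyshev:
  assumes "c > 0"
  shows "\<P>(\<omega> in M. \<bar>exceed n s \<omega> - real n * T s\<bar> \<ge> c) \<le> real n * T s / c\<^sup>2"
proof -
  have ind: "indep_vars (\<lambda>_. borel) (\<lambda>j \<omega>. of_bool (V j \<omega> > s) :: real) {1..n}"
    by (rule indep_vars_compose2[OF indep_row]) auto
  have sq: "(of_bool b :: real)\<^sup>2 = of_bool b" for b by (cases b) auto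
  show ?thesis
    using chebyshev_indep_sum[OF _ ind _ assms]
    by (simp add: sq expectation_indicator_tail integrable_indicator_tail exceed_def)
qed

lemma excess_moments:
  assumes s: "v0 \<le> s" "K * exp (- \<tau> * s) \<le> r" "r \<le> 1"
  shows "integrable M (\<lambda>\<omega>. max 0 (V j \<omega> - s) ^ Suc l)"
    and "(1 - r) * exp (- s) * fact (Suc l) \<le> expectation (\<lambda>\<omega>. max 0 (V j \<omega> - s) ^ Suc l)"
    and "expectation (\<lambda>\<omega>. max 0 (V j \<omega> - s) ^ Suc l) \<le> (1 + r) * exp (- s) * fact (Suc l)"
proof -
  have r0: "0 \<le> r" using s(2) K_nonneg by (smt (verit) exp_ge_zero mult_nonneg_nonneg)
  have ev: "{\<omega>\<in>space M. V j \<omega> - s > t} = {\<omega>\<in>space M. V j \<omega> > s + t}" for t by auto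
  have t1: "(1 - r) * exp (- s) * exp (- t) \<le> \<P>(\<omega> in M. V j \<omega> - s > t)"
    and t2: "\<P>(\<omega> in M. V j \<omega> - s > t) \<le> (1 + r) * exp (- s) * exp (- t)" if "t \<ge> 0" for t
    using tail_bounds[OF s(1) _ s(2), of "s + t"] that unfolding ev tail_prob by (simp_all add: exp_diff exp_minus field_simps)
  have le: "(1 - r) * exp (- s) \<le> (1 + r) * exp (- s)" using r0 by (intro mult_right_mono) auto
  have ge: "0 \<le> (1 - r) * exp (- s)" using s(3) by simp
  show "integrable M (\<lambda>\<omega>. max 0 (V j \<omega> - s) ^ Suc l)"
    by (rule power_excess_moment_bounds(1)[OF _ ge le t1 t2]) auto
  show "(1 - r) * exp (- s) * fact (Suc l) \<le> expectation (\<lambda>\<omega>. max 0 (V j \<omega> - s) ^ Suc l)"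
    by (rule power_excess_moment_bounds(2)[OF _ ge le t1 t2]) auto
  show "expectation (\<lambda>\<omega>. max 0 (V j \<omega> - s) ^ Suc l) \<le> (1 + r) * exp (- s) * fact (Suc l)"
    by (rule power_excess_moment_bounds(3)[OF _ ge le t1 t2]) auto
qed

text \<open>The \<open>k\<close>-th moment of the excess is \<open>k! exp (- s)\<close> up to a relative error \<open>r\<close>. In the second moment of the score the
main terms combine to \<open>2 - 2 + 1 = 1\<close>, in the first they cancel.\<close>

lemma score_moments:
  assumes s: "v0 \<le> s" "K * exp (- \<tau> * s) \<le> r" "r \<le> 1"
  defines "\<psi> j \<omega> \<equiv> max 0 (V j \<omega> - s) - of_bool (V j \<omega> > s)"
  shows "k \<le> 3 \<Longrightarrow> integrable M (\<lambda>\<omega>. \<psi> j \<omega> ^ k)"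
    and "\<bar>expectation (\<psi> j)\<bar> \<le> 2 * r * exp (- s)"
    and "\<bar>expectation (\<lambda>\<omega>. \<psi> j \<omega> ^ 2) - exp (- s)\<bar> \<le> 5 * r * exp (- s)"
    and "expectation (\<lambda>\<omega>. \<bar>\<psi> j \<omega>\<bar> ^ 3) \<le> 14 * exp (- s)"
proof -
  let ?Y = "\<lambda>\<omega>. max 0 (V j \<omega> - s)" and ?b = "\<lambda>\<omega>. of_bool (V j \<omega> > s) :: real"
  note mom = excess_moments[OF s, where j = j]
  have i1: "integrable M ?Y" "integrable M (\<lambda>\<omega>. ?Y \<omega> ^ 2)" "integrable M (\<lambda>\<omega>. ?Y \<omega> ^ 3)"
    using mom(1)[of 0] mom(1)[of 1] mom(1)[of 2] by (simp_all add: numeral_2_eq_2 numeral_3_eq_3)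
  have E1: "(1 - r) * exp (- s) \<le> expectation ?Y" "expectation ?Y \<le> (1 + r) * exp (- s)"
    using mom(2,3)[of 0] by simp_all
  have E2: "2 * (1 - r) * exp (- s) \<le> expectation (\<lambda>\<omega>. ?Y \<omega> ^ 2)" "expectation (\<lambda>\<omega>. ?Y \<omega> ^ 2) \<le> 2 * (1 + r) * exp (- s)"
    using mom(2,3)[of 1] by (simp_all add: numeral_2_eq_2 algebra_simps)
  have E3: "expectation (\<lambda>\<omega>. ?Y \<omega> ^ 3) \<le> 6 * (1 + r) * exp (- s)"
    using mom(3)[of 2] by (simp add: eval_nat_numeral algebra_simps)
  note T1 = tail_bounds[OF s(1) order_refl s(2)]
  note ib = integrable_indicator_tail[where j = j and s = s] and Eb = expectation_indicator_tail[where j = j and s = s]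
  have sq: "\<psi> j \<omega> ^ 2 = ?Y \<omega> ^ 2 - 2 * ?Y \<omega> + ?b \<omega>" for \<omega>
    unfolding \<psi>_def by (auto simp: power2_diff of_bool_def)
  have meas[measurable]: "\<psi> j \<in> borel_measurable M" unfolding \<psi>_def[abs_def] by measurable
  have cube: "\<bar>\<psi> j \<omega>\<bar> ^ 3 \<le> ?Y \<omega> ^ 3 + ?b \<omega>" for \<omega>
  proof (cases "V j \<omega> > s")
    case True
    have "\<bar>y - 1\<bar> ^ 3 \<le> y ^ 3 + 1" if "y > 0" for y :: real
    proof (cases "y \<ge> 1")
      case True
      then have "(y - 1) ^ 3 \<le> y ^ 3" by (intro power_mono) auto
      moreover have "\<bar>y - 1\<bar> = y - 1" using True by simp
      ultimately show ?thesis by linarith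
    next
      case False
      then have "(1 - y) ^ 3 \<le> 1" using that by (intro power_le_one) auto
      moreover have "0 \<le> y ^ 3" "\<bar>y - 1\<bar> = 1 - y" using that False by (auto intro: zero_le_power)
      ultimately show ?thesis by (metis add_increasing order_trans add.commute le_add_same_cancel2)
    qed
    from this[of "V j \<omega> - s"] show ?thesis using True unfolding \<psi>_def by simp
  qed (simp add: \<psi>_def)
  have icube: "integrable M (\<lambda>\<omega>. \<psi> j \<omega> ^ 3)"
    by (rule Bochner_Integration.integrable_bound[of M "\<lambda>\<omega>. ?Y \<omega> ^ 3 + ?b \<omega>"])
      (use i1 ib cube in \<open>auto simp: power_abs[symmetric] intro!: AE_I2\<close>)
  show "integrable M (\<lambda>\<omega>. \<psi> j \<omega> ^ k)" if "k \<le> 3"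
  proof -
    from that consider "k = 0" | "k = 1" | "k = 2" | "k = 3" by linarith
    then show ?thesis
    proof cases
      case 2 then show ?thesis using i1 ib by (simp add: \<psi>_def)
    next
      case 3 then show ?thesis using i1 ib by (simp add: sq)
    qed (use icube in auto)
  qed
  have "expectation (\<psi> j) = expectation ?Y - T s" unfolding \<psi>_def using i1 ib Eb by simp
  then show "\<bar>expectation (\<psi> j)\<bar> \<le> 2 * r * exp (- s)" using E1 T1 by (simp add: algebra_simps abs_le_iff)
  have "expectation (\<lambda>\<omega>. \<psi> j \<omega> ^ 2) = expectation (\<lambda>\<omega>. ?Y \<omega> ^ 2) - 2 * expectation ?Y + T s"
    unfolding sq using i1 ib Eb by simp
  then show "\<bar>expectation (\<lambda>\<omega>. \<psi> j \<omega> ^ 2) - exp (- s)\<bar> \<le> 5 * r * exp (- s)"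
    using E1 E2 T1 by (simp add: algebra_simps abs_le_iff)
  have "expectation (\<lambda>\<omega>. \<bar>\<psi> j \<omega>\<bar> ^ 3) \<le> expectation (\<lambda>\<omega>. ?Y \<omega> ^ 3 + ?b \<omega>)"
  proof (rule integral_mono)
    show "integrable M (\<lambda>\<omega>. \<bar>\<psi> j \<omega>\<bar> ^ 3)" using integrable_abs[OF icube] by (simp add: power_abs)
  qed (use i1 ib cube in auto)
  also have "\<dots> = expectation (\<lambda>\<omega>. ?Y \<omega> ^ 3) + T s" using i1 ib Eb by simp
  also have "\<dots> \<le> 6 * (1 + r) * exp (- s) + (1 + r) * exp (- s)" using E3 T1 by simp
  also have "\<dots> = 7 * (1 + r) * exp (- s)" by (simp add: algebra_simps)
  also have "\<dots> \<le> 14 * exp (- s)" using s(3) by simp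
  finally show "expectation (\<lambda>\<omega>. \<bar>\<psi> j \<omega>\<bar> ^ 3) \<le> 14 * exp (- s)" .
qed

lemma score_eq_sum: "score n s \<omega> = (\<Sum>j=1..n. max 0 (V j \<omega> - s) - of_bool (V j \<omega> > s))"
  by (simp add: score_def excess_def exceed_def sum_subtractf)

lemma score_chebyshev:
  assumes s: "v0 \<le> s" "K * exp (- \<tau> * s) \<le> r" "r \<le> 1" and c: "c > 0"
  shows "\<P>(\<omega> in M. \<bar>score n s \<omega>\<bar> \<ge> c + 2 * r * (real n * exp (- s))) \<le> 6 * (real n * exp (- s)) / c\<^sup>2"
proof -
  define \<psi> where "\<psi> j \<omega> = max 0 (V j \<omega> - s) - of_bool (V j \<omega> > s)" for j \<omega>
  note mom = score_moments[OF s, folded \<psi>_def]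
  have r0: "0 \<le> r" using s(2) K_nonneg by (smt (verit) exp_ge_zero mult_nonneg_nonneg)
  have ind: "indep_vars (\<lambda>_. borel) \<psi> {1..n}"
    unfolding \<psi>_def[abs_def] by (rule indep_vars_compose2[OF indep_row]) auto
  have meas[measurable]: "\<psi> j \<in> borel_measurable M" for j unfolding \<psi>_def[abs_def] by measurable
  have sc: "score n s \<omega> = (\<Sum>j=1..n. \<psi> j \<omega>)" for \<omega> by (simp add: score_eq_sum \<psi>_def)
  have "\<bar>\<Sum>j=1..n. expectation (\<psi> j)\<bar> \<le> (\<Sum>j=1..n. 2 * r * exp (- s))"
    by (rule order_trans[OF sum_abs sum_mono]) (use mom(2) in auto)
  then have mean: "\<bar>\<Sum>j=1..n. expectation (\<psi> j)\<bar> \<le> 2 * r * (real n * exp (- s))" by (simp add: mult_ac)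
  have "expectation (\<lambda>\<omega>. (\<psi> j \<omega>)\<^sup>2) \<le> 6 * exp (- s)" for j
  proof -
    have "r * exp (- s) \<le> 1 * exp (- s)" using s(3) by (intro mult_right_mono) auto
    then show ?thesis using mom(3)[of j] by linarith
  qed
  then have var: "(\<Sum>j=1..n. expectation (\<lambda>\<omega>. (\<psi> j \<omega>)\<^sup>2)) \<le> 6 * (real n * exp (- s))"
    using sum_bounded_above[of "{1..n}" "\<lambda>j. expectation (\<lambda>\<omega>. (\<psi> j \<omega>)\<^sup>2)" "6 * exp (- s)"] by (simp add: mult_ac)
  have "\<P>(\<omega> in M. \<bar>score n s \<omega>\<bar> \<ge> c + 2 * r * (real n * exp (- s)))
      \<le> \<P>(\<omega> in M. \<bar>(\<Sum>j=1..n. \<psi> j \<omega>) - (\<Sum>j=1..n. expectation (\<psi> j))\<bar> \<ge> c)"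
    unfolding sc using mean by (intro finite_measure_mono) auto
  also have "\<dots> \<le> (\<Sum>j=1..n. expectation (\<lambda>\<omega>. (\<psi> j \<omega>)\<^sup>2)) / c\<^sup>2"
    by (rule chebyshev_indep_sum[OF _ ind _ c]) (use mom(1)[of 2] in auto)
  also have "\<dots> \<le> 6 * (real n * exp (- s)) / c\<^sup>2" using var by (intro divide_right_mono) auto
  finally show ?thesis .
qed

text \<open>The Lyapunov ratio is of order \<open>1 / \<surd>\<kappa>\<close>, and the hypothesis \<open>bias\<close> is exactly what makes the means negligible.\<close>

theorem score_clt:
  fixes \<sigma> :: "nat \<Rightarrow> real"
  defines "\<kappa> n \<equiv> real n * exp (- \<sigma> n)"
  assumes \<sigma>: "filterlim \<sigma> at_top sequentially" and \<kappa>: "filterlim \<kappa> at_top sequentially"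
    and bias: "(\<lambda>n. sqrt (\<kappa> n) * exp (- \<tau> * \<sigma> n)) \<longlonglongrightarrow> 0"
  shows "weak_conv_m (\<lambda>n. distr M borel (\<lambda>\<omega>. score n (\<sigma> n) \<omega> / sqrt (\<kappa> n))) std_normal_distribution"
proof -
  define \<psi> where "\<psi> n j \<omega> = max 0 (V j \<omega> - \<sigma> n) - of_bool (V j \<omega> > \<sigma> n)" for n j \<omega>
  define X where "X n j \<omega> = \<psi> n j \<omega> / sqrt (\<kappa> n)" for n j \<omega>
  define r where "r n = K * exp (- \<tau> * \<sigma> n)" for n
  have r0: "r n \<ge> 0" for n unfolding r_def using K_nonneg by simp
  have r_lim: "r \<longlonglongrightarrow> 0"
    unfolding r_def[abs_def] by (rule tendsto_exp_decay[OF \<tau>_pos \<sigma>])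
  have sqrt_lim: "filterlim (\<lambda>n. sqrt (\<kappa> n)) at_top sequentially" by (rule filterlim_compose[OF sqrt_at_top \<kappa>])
  have inv_lim: "(\<lambda>n. 1 / sqrt (\<kappa> n)) \<longlonglongrightarrow> 0"
    by (rule tendsto_divide_0[OF tendsto_const filterlim_at_top_imp_at_infinity[OF sqrt_lim]])
  have ev: "\<forall>\<^sub>F n in sequentially. v0 \<le> \<sigma> n \<and> r n \<le> 1 \<and> \<kappa> n > 0"
  proof -
    have "\<forall>\<^sub>F n in sequentially. r n < 1" by (rule order_tendstoD[OF r_lim]) simp
    with filterlim_at_top[THEN iffD1, OF \<sigma>, rule_format, of v0]
      filterlim_at_top_dense[THEN iffD1, OF \<kappa>, rule_format, of 0]
    show ?thesis by eventually_elim auto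
  qed
  have [measurable]: "\<psi> n j \<in> borel_measurable M" for n j unfolding \<psi>_def[abs_def] by measurable
  have rvX[measurable]: "X n j \<in> borel_measurable M" for n j unfolding X_def[abs_def] by measurable
  have score: "score n (\<sigma> n) \<omega> / sqrt (\<kappa> n) = (\<Sum>j=1..n. X n j \<omega>)" for n \<omega>
    unfolding X_def \<psi>_def score_eq_sum by (simp add: sum_divide_distrib)
  define f where "f n v = (max 0 (v - \<sigma> n) - of_bool (v > \<sigma> n)) / sqrt (\<kappa> n)" for n v
  have [measurable]: "f n \<in> borel_measurable borel" for n unfolding f_def[abs_def] by measurable
  have Xf: "X n j = (\<lambda>\<omega>. f n (V j \<omega>))" for n j unfolding X_def \<psi>_def f_def by auto
  have identX: "distr M borel (X n j) = distr M borel (X n 1)" for n j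
  proof -
    have "distr M borel (X n j) = distr (distr M borel (V j)) borel (f n)" for j
      unfolding Xf by (subst distr_distr) (auto simp: comp_def)
    then show ?thesis using ident by metis
  qed
  have mom: "real n * \<bar>expectation (X n 1)\<bar> \<le> 2 * K * (sqrt (\<kappa> n) * exp (- \<tau> * \<sigma> n))"
      "\<bar>real n * expectation (\<lambda>\<omega>. X n 1 \<omega> ^ 2) - 1\<bar> \<le> 5 * r n"
      "real n * expectation (\<lambda>\<omega>. \<bar>X n 1 \<omega>\<bar> ^ 3) \<le> 14 * (1 / sqrt (\<kappa> n))"
      "\<forall>k\<le>3. integrable M (\<lambda>\<omega>. X n 1 \<omega> ^ k)"
    if n: "v0 \<le> \<sigma> n \<and> r n \<le> 1 \<and> \<kappa> n > 0" for n
  proof -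
    have pm: "K * exp (- \<tau> * \<sigma> n) \<le> r n" unfolding r_def by simp
    note m = score_moments[OF conjunct1[OF n] pm, folded \<psi>_def]
    have n1: "v0 \<le> \<sigma> n" "r n \<le> 1" "\<kappa> n > 0" using n by auto
    have sq: "sqrt (\<kappa> n) * sqrt (\<kappa> n) = \<kappa> n" "sqrt (\<kappa> n) > 0" using n1 by auto
    have exp_eq: "real n * exp (- \<sigma> n) = \<kappa> n" by (simp add: \<kappa>_def)
    have "real n * \<bar>expectation (X n 1)\<bar> = real n * \<bar>expectation (\<psi> n 1)\<bar> / sqrt (\<kappa> n)"
      unfolding X_def using sq by simp
    also have "\<dots> \<le> real n * (2 * r n * exp (- \<sigma> n)) / sqrt (\<kappa> n)"
      using m(2)[OF n1(2), of 1] sq by (intro divide_right_mono mult_left_mono) auto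
    also have "\<dots> = 2 * r n * (\<kappa> n / sqrt (\<kappa> n))" unfolding exp_eq[symmetric] by (simp add: mult_ac)
    also have "\<kappa> n / sqrt (\<kappa> n) = sqrt (\<kappa> n)" using n1 real_div_sqrt by simp
    finally show "real n * \<bar>expectation (X n 1)\<bar> \<le> 2 * K * (sqrt (\<kappa> n) * exp (- \<tau> * \<sigma> n))"
      by (simp add: r_def mult_ac)
    have X2: "X n 1 \<omega> ^ 2 = \<psi> n 1 \<omega> ^ 2 / \<kappa> n" for \<omega> unfolding X_def using n1 by (simp add: power_divide)
    have "\<bar>real n * expectation (\<lambda>\<omega>. X n 1 \<omega> ^ 2) - 1\<bar> = real n / \<kappa> n * \<bar>expectation (\<lambda>\<omega>. \<psi> n 1 \<omega> ^ 2) - exp (- \<sigma> n)\<bar>"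
    proof -
      have "real n * expectation (\<lambda>\<omega>. X n 1 \<omega> ^ 2) - 1 = real n / \<kappa> n * (expectation (\<lambda>\<omega>. \<psi> n 1 \<omega> ^ 2) - exp (- \<sigma> n))"
        unfolding X2 using n1 exp_eq by (simp add: right_diff_distrib)
      then show ?thesis using n1 by (simp add: abs_mult)
    qed
    also have "\<dots> \<le> real n / \<kappa> n * (5 * r n * exp (- \<sigma> n))"
      using m(3)[OF n1(2), of 1] n1 by (intro mult_left_mono) auto
    also have "\<dots> = 5 * r n * (real n * exp (- \<sigma> n) / \<kappa> n)" by simp
    also have "\<dots> = 5 * r n" unfolding exp_eq using n1 by simp
    finally show "\<bar>real n * expectation (\<lambda>\<omega>. X n 1 \<omega> ^ 2) - 1\<bar> \<le> 5 * r n" .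
    have X3: "\<bar>X n 1 \<omega>\<bar> ^ 3 = \<bar>\<psi> n 1 \<omega>\<bar> ^ 3 / (\<kappa> n * sqrt (\<kappa> n))" for \<omega>
      unfolding X_def using n1 by (simp add: power_divide power3_eq_cube)
    have "real n * expectation (\<lambda>\<omega>. \<bar>X n 1 \<omega>\<bar> ^ 3) = real n * expectation (\<lambda>\<omega>. \<bar>\<psi> n 1 \<omega>\<bar> ^ 3) / (\<kappa> n * sqrt (\<kappa> n))"
      unfolding X3 by simp
    also have "\<dots> \<le> real n * (14 * exp (- \<sigma> n)) / (\<kappa> n * sqrt (\<kappa> n))"
      using m(4)[OF n1(2), of 1] n1 by (intro divide_right_mono mult_left_mono) auto
    also have "\<dots> = 14 * (real n * exp (- \<sigma> n) / \<kappa> n) / sqrt (\<kappa> n)" by simp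
    also have "\<dots> = 14 * (1 / sqrt (\<kappa> n))" unfolding exp_eq using n1 by simp
    finally show "real n * expectation (\<lambda>\<omega>. \<bar>X n 1 \<omega>\<bar> ^ 3) \<le> 14 * (1 / sqrt (\<kappa> n))" .
    show "\<forall>k\<le>3. integrable M (\<lambda>\<omega>. X n 1 \<omega> ^ k)"
      unfolding X_def power_divide using m(1)[OF n1(2)] by auto
  qed
  show ?thesis unfolding score
  proof (rule lyapunov_triangular_clt)
    show "indep_vars (\<lambda>_. borel) (X n) {1..n}" for n
      unfolding Xf by (rule indep_vars_compose2[OF indep_row]) auto
    show "\<forall>\<^sub>F n in sequentially. \<forall>k\<le>3. integrable M (\<lambda>\<omega>. X n 1 \<omega> ^ k)"
      using ev by eventually_elim (rule mom(4))
    show "(\<lambda>n. real n * expectation (X n 1)) \<longlonglongrightarrow> 0"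
    proof (rule Lim_null_comparison)
      show "\<forall>\<^sub>F n in sequentially. norm (real n * expectation (X n 1)) \<le> 2 * K * (sqrt (\<kappa> n) * exp (- \<tau> * \<sigma> n))"
        using ev by eventually_elim (use mom(1) in \<open>simp add: abs_mult\<close>)
      show "(\<lambda>n. 2 * K * (sqrt (\<kappa> n) * exp (- \<tau> * \<sigma> n))) \<longlonglongrightarrow> 0" by (rule tendsto_mult_right_zero[OF bias])
    qed
    have "(\<lambda>n. real n * expectation (\<lambda>\<omega>. X n 1 \<omega> ^ 2) - 1) \<longlonglongrightarrow> 0"
    proof (rule Lim_null_comparison)
      show "\<forall>\<^sub>F n in sequentially. norm (real n * expectation (\<lambda>\<omega>. X n 1 \<omega> ^ 2) - 1) \<le> 5 * r n"
        using ev by eventually_elim (use mom(2) in simp)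
      show "(\<lambda>n. 5 * r n) \<longlonglongrightarrow> 0" by (rule tendsto_mult_right_zero[OF r_lim])
    qed
    then show "(\<lambda>n. real n * expectation (\<lambda>\<omega>. X n 1 \<omega> ^ 2)) \<longlonglongrightarrow> 1" by (simp add: LIM_zero_iff)
    show "(\<lambda>n. real n * expectation (\<lambda>\<omega>. \<bar>X n 1 \<omega>\<bar> ^ 3)) \<longlonglongrightarrow> 0"
    proof (rule Lim_null_comparison)
      show "\<forall>\<^sub>F n in sequentially. norm (real n * expectation (\<lambda>\<omega>. \<bar>X n 1 \<omega>\<bar> ^ 3)) \<le> 14 * (1 / sqrt (\<kappa> n))"
        using ev by eventually_elim (use mom(3) in simp)
      show "(\<lambda>n. 14 * (1 / sqrt (\<kappa> n))) \<longlonglongrightarrow> 0" by (rule tendsto_mult_right_zero[OF inv_lim])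
    qed
    show "distr M borel (X n j) = distr M borel (X n 1)" for n j by (rule identX)
  qed (rule rvX)
qed

section \<open>Fluctuations in a window of levels\<close>

text \<open>The maximal inequality is applied on a grid of \<open>n\<close> steps. Its bound does not depend on the grid, and
between neighbouring points monotonicity of the counts leaves an error below \<open>2 exp (- \<sigma>)\<close>. The exceptional
probability is of order \<open>\<delta> / \<epsilon>\<^sup>2\<close>, which is small for narrow windows, whereas the fluctuation
at the left end is only bounded by a multiple of \<open>(\<epsilon> / \<delta>) \<surd>\<kappa>\<close>; multiplied with the width of the
window this is again of order \<open>\<epsilon> \<surd>\<kappa>\<close>.\<close>

lemma fluctuation_window:
  fixes n :: nat and \<sigma> \<delta> \<epsilon> :: real
  defines "\<kappa> \<equiv> real n * exp (- \<sigma>)" and "r \<equiv> K * exp (- \<tau> * (\<sigma> - 1))"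
  assumes n: "n \<ge> 1" and \<delta>: "0 < \<delta>" "\<delta> \<le> 1/2" and \<epsilon>: "\<epsilon> > 0"
    and v0: "v0 \<le> \<sigma> - 1" and r: "r \<le> \<delta> / 4" "2 * sqrt \<kappa> * r \<le> \<epsilon>"
    and small: "2 * exp (- \<sigma>) \<le> \<epsilon> * sqrt \<kappa>"
  obtains E where "E \<in> sets M" "prob (space M - E) \<le> 111 * \<delta> / \<epsilon>\<^sup>2"
    "\<And>\<omega>. \<omega> \<in> E \<Longrightarrow> \<bar>fluct n (\<sigma> - \<delta>) \<omega>\<bar> \<le> 2 * (\<epsilon> / \<delta>) * sqrt \<kappa>"
    "\<And>\<omega> s. \<omega> \<in> E \<Longrightarrow> \<sigma> - \<delta> \<le> s \<Longrightarrow> s \<le> \<sigma> + \<delta> \<Longrightarrow>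
        \<bar>fluct n s \<omega> - fluct n (\<sigma> - \<delta>) \<omega>\<bar> \<le> 8 * \<epsilon> * sqrt \<kappa>"
proof -
  define a where "a = \<sigma> - \<delta>"
  define b where "b = \<sigma> + \<delta>"
  define e where "e = exp (- \<sigma>)"
  have e: "e > 0" unfolding e_def by simp
  have \<kappa>: "\<kappa> > 0" "\<kappa> = real n * e" unfolding \<kappa>_def e_def using n by auto
  have sq: "sqrt \<kappa> > 0" "sqrt \<kappa> * sqrt \<kappa> = \<kappa>" using \<kappa> by auto
  have r0: "r \<ge> 0" unfolding r_def using K_nonneg by simp
  have ed: "1 + \<delta> \<le> exp \<delta>" "exp \<delta> \<le> 1 + 2 * \<delta>" "1 - \<delta> \<le> exp (- \<delta>)"
    using exp_ge_add_one_self[of \<delta>] exp_ge_add_one_self[of "-\<delta>"] real_exp_bound_lemma[of \<delta>] \<delta> by auto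
  have exp_a: "exp (- a) = e * exp \<delta>" and exp_b: "exp (- b) = e * exp (- \<delta>)"
    unfolding a_def b_def e_def by (simp_all add: exp_add[symmetric])
  have rK: "K * exp (- \<tau> * (\<sigma> - 1)) \<le> r" unfolding r_def by simp
  have tb: "(1 - r) * exp (- s) \<le> T s" "T s \<le> (1 + r) * exp (- s)" if "a \<le> s" for s
    using tail_bounds[OF v0 _ rK, of s] that \<delta> unfolding a_def by auto
  have r18: "r \<le> 1/8" using r \<delta> by simp
  have Ta_up: "T a \<le> 3 * e"
  proof -
    have "T a \<le> (1 + r) * (e * exp \<delta>)" using tb(2)[of a] exp_a by simp
    also have "\<dots> \<le> (1 + 1/8) * (e * 2)" using r18 r0 ed \<delta> e by (intro mult_mono) auto
    also have "\<dots> \<le> 3 * e" using e by simp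
    finally show ?thesis .
  qed
  have Ta_lo: "e \<le> T a"
  proof -
    have "1 * e \<le> ((1 - \<delta>/4) * (1 + \<delta>)) * e"
    proof (rule mult_right_mono)
      have "(1 - \<delta>/4) * (1 + \<delta>) = 1 + \<delta> * (3/4 - \<delta>/4)" by (simp add: field_simps)
      moreover have "0 \<le> \<delta> * (3/4 - \<delta>/4)" using \<delta> by (intro mult_nonneg_nonneg) auto
      ultimately show "1 \<le> (1 - \<delta>/4) * (1 + \<delta>)" by simp
    qed (use e in simp)
    also have "\<dots> \<le> ((1 - r) * exp \<delta>) * e" using ed r \<delta> e r18 by (intro mult_right_mono mult_mono) auto
    also have "\<dots> \<le> T a" using tb(1)[of a] exp_a by (simp add: mult_ac)
    finally show ?thesis by simp
  qed
  have Tb_lo: "e / 3 \<le> T b"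
  proof -
    have "1/3 * e \<le> ((1 - 1/8) * (1/2)) * e" using e by (intro mult_right_mono) auto
    also have "\<dots> \<le> ((1 - r) * exp (- \<delta>)) * e"
      using ed r18 \<delta> e by (intro mult_right_mono mult_mono) auto
    also have "\<dots> \<le> T b" using tb(1)[of b] exp_b \<delta> by (simp add: mult_ac a_def b_def)
    finally show ?thesis by simp
  qed
  have Tdiff: "T a - T b \<le> 4 * \<delta> * e"
  proof -
    have "T a - T b \<le> (1 + r) * (e * exp \<delta>) - (1 - r) * (e * exp (- \<delta>))"
      using tb(2)[of a] tb(1)[of b] exp_a exp_b \<delta> by (simp add: a_def b_def)
    also have "\<dots> = e * ((exp \<delta> - exp (- \<delta>)) + r * (exp \<delta> + exp (- \<delta>)))" by (simp add: algebra_simps)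
    also have "\<dots> \<le> e * (4 * \<delta>)"
    proof (rule mult_left_mono)
      have "r * (exp \<delta> + exp (- \<delta>)) \<le> \<delta> / 4 * 3"
      proof (rule mult_mono)
        have "exp (- \<delta>) \<le> 1" using \<delta> by simp
        then show "exp \<delta> + exp (- \<delta>) \<le> 3" using ed \<delta> by linarith
      qed (use r \<delta> in auto)
      then show "exp \<delta> - exp (- \<delta>) + r * (exp \<delta> + exp (- \<delta>)) \<le> 4 * \<delta>" using ed \<delta> by simp
    qed (use e in simp)
    finally show ?thesis by (simp add: mult_ac)
  qed
  have Tpos: "T a > 0" "T b > 0" using Ta_lo Tb_lo e by linarith+
  define s where "s i = a + 2 * \<delta> * (real i / real n)" for i :: nat
  have s0: "s 0 = a" and sn: "s n = b" unfolding s_def using n by (auto simp: a_def b_def)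
  have s_mono: "s i \<le> s l" if "i \<le> l" for i l
    unfolding s_def using that \<delta> by (intro add_left_mono mult_left_mono divide_right_mono) auto
  have sT: "T b \<le> T (s i)" "T (s i) \<le> T a" "a \<le> s i" "s i \<le> b" if "i \<le> n" for i
    using tail_antimono[of "s i" b] tail_antimono[of a "s i"] s_mono[of 0 i] s_mono[of i n] that s0 sn by auto
  \<comment> \<open>This is \<open>\<epsilon> \<surd>\<kappa>\<close> on the scale of the martingale, whose values are multiplied by at most \<open>3 e\<close> to return to counts.\<close>
  define c where "c = \<epsilon> * sqrt \<kappa> / (3 * e)"
  have c: "c > 0" unfolding c_def using \<epsilon> sq e by simp
  define c2 where "c2 = \<epsilon> / \<delta> * sqrt \<kappa>"
  have c2: "c2 > 0" unfolding c2_def using \<epsilon> sq \<delta> by simp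
  define B1 where "B1 = {\<omega>\<in>space M. \<exists>i\<le>n. \<bar>exceed n (s i) \<omega> / T (s i) - exceed n (s 0) \<omega> / T (s 0)\<bar> \<ge> c}"
  define B2 where "B2 = {\<omega>\<in>space M. \<bar>exceed n a \<omega> - real n * T a\<bar> \<ge> c2}"
  have B_meas[measurable]: "B1 \<in> sets M" "B2 \<in> sets M" unfolding B1_def B2_def by measurable
  have P1: "prob B1 \<le> 108 * \<delta> / \<epsilon>\<^sup>2"
  proof -
    have "prob B1 \<le> real (card {1..n}) * (1 / T (s n) - 1 / T (s 0)) / c\<^sup>2"
      unfolding B1_def exceed_def
      by (rule empirical_tail_maximal_inequality[OF _ indep_row tail_prob])
        (use s_mono sT Tpos c in \<open>auto intro: less_le_trans\<close>)
    also have "\<dots> = real n * (1 / T b - 1 / T a) / c\<^sup>2" by (simp add: s0 sn)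
    also have "\<dots> \<le> real n * (12 * \<delta> / e) / c\<^sup>2"
    proof (intro divide_right_mono mult_left_mono)
      have "1 / T b - 1 / T a = (T a - T b) / (T a * T b)" using Tpos by (simp add: field_simps)
      also have "\<dots> \<le> (4 * \<delta> * e) / (e * (e / 3))"
        using Tdiff Ta_lo Tb_lo e \<delta> by (intro frac_le mult_mono) auto
      also have "\<dots> = 12 * \<delta> / e" using e by (simp add: field_simps)
      finally show "1 / T b - 1 / T a \<le> 12 * \<delta> / e" .
    qed auto
    also have "\<dots> = 108 * \<delta> * (real n * e) / (\<epsilon>\<^sup>2 * \<kappa>)"
    proof -
      have "c\<^sup>2 = \<epsilon>\<^sup>2 * \<kappa> / (9 * (e * e))"
        unfolding c_def using \<kappa>(1) by (simp add: power_divide power_mult_distrib power2_eq_square)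
      then show ?thesis using e by (simp add: mult_ac)
    qed
    also have "\<dots> = 108 * \<delta> / \<epsilon>\<^sup>2" unfolding \<kappa>(2)[symmetric] using \<kappa>(1) by simp
    finally show ?thesis .
  qed
  have P2: "prob B2 \<le> 3 * \<delta> / \<epsilon>\<^sup>2"
  proof -
    have "prob B2 \<le> real n * T a / c2\<^sup>2" unfolding B2_def by (rule exceed_chebyshev[OF c2])
    also have "\<dots> \<le> real n * (3 * e) / c2\<^sup>2" using Ta_up by (intro divide_right_mono mult_left_mono) auto
    also have "\<dots> = 3 * \<kappa> / c2\<^sup>2" unfolding \<kappa>(2) by simp
    also have "\<dots> = 3 * \<delta>\<^sup>2 / \<epsilon>\<^sup>2"
      unfolding c2_def using \<kappa>(1) \<delta> by (simp add: power_divide power_mult_distrib)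
    also have "\<dots> \<le> 3 * \<delta> / \<epsilon>\<^sup>2"
      using \<delta> by (intro divide_right_mono mult_left_mono) (auto simp: power2_eq_square)
    finally show ?thesis .
  qed
  define E where "E = space M - (B1 \<union> B2)"
  have G_T: "\<bar>fluct n s \<omega> - (exceed n s \<omega> - real n * T s)\<bar> \<le> \<epsilon> * sqrt \<kappa>" if "a \<le> s" for s \<omega>
  proof -
    have "\<bar>T s - exp (- s)\<bar> \<le> r * exp (- s)" using tb[OF that] by (simp add: algebra_simps abs_le_iff)
    also have "\<dots> \<le> r * (2 * e)"
    proof (rule mult_left_mono[OF _ r0])
      have "exp (- s) \<le> exp (- a)" using that by simp
      also have "\<dots> \<le> 2 * e" using exp_a ed \<delta> e by simp
      finally show "exp (- s) \<le> 2 * e" .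
    qed
    finally have "real n * \<bar>T s - exp (- s)\<bar> \<le> real n * (r * (2 * e))" by (intro mult_left_mono) auto
    also have "\<dots> = (2 * sqrt \<kappa> * r) * sqrt \<kappa>" using sq(2) \<kappa>(2) by (simp add: mult_ac)
    also have "\<dots> \<le> \<epsilon> * sqrt \<kappa>" using r(2) sq by (intro mult_right_mono) auto
    also have "real n * \<bar>T s - exp (- s)\<bar> = \<bar>real n * T s - real n * exp (- s)\<bar>"
      by (simp add: abs_mult right_diff_distrib[symmetric])
    finally show ?thesis unfolding fluct_def by simp
  qed
  have grid: "\<bar>fluct n (s i) \<omega> - fluct n a \<omega>\<bar> \<le> 7 * \<epsilon> * sqrt \<kappa>" if \<omega>: "\<omega> \<in> E" and i: "i \<le> n" for \<omega> i
  proof -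
    let ?A = "exceed n a \<omega>" and ?S = "exceed n (s i) \<omega>"
    have q: "0 < T (s i)" "T (s i) \<le> T a" using sT[OF i] Tpos by auto
    have "\<bar>?S / T (s i) - ?A / T a\<bar> \<le> c"
      using \<omega> i s0 unfolding E_def B1_def by auto
    then have "T (s i) * \<bar>?S / T (s i) - ?A / T a\<bar> \<le> (3 * e) * c"
      using q Ta_up c e by (intro mult_mono) auto
    also have "\<dots> = \<epsilon> * sqrt \<kappa>" unfolding c_def using e by simp
    also have "T (s i) * \<bar>?S / T (s i) - ?A / T a\<bar> = \<bar>?S - T (s i) / T a * ?A\<bar>"
    proof -
      have "T (s i) * (?S / T (s i) - ?A / T a) = ?S - T (s i) / T a * ?A"
        using q by (simp add: right_diff_distrib)
      moreover have "T (s i) * \<bar>?S / T (s i) - ?A / T a\<bar> = \<bar>T (s i) * (?S / T (s i) - ?A / T a)\<bar>"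
        using q by (simp add: abs_mult)
      ultimately show ?thesis by simp
    qed
    finally have d1: "\<bar>?S - T (s i) / T a * ?A\<bar> \<le> \<epsilon> * sqrt \<kappa>" .
    have "\<bar>?A - real n * T a\<bar> \<le> c2" using \<omega> unfolding E_def B2_def by auto
    moreover have "0 \<le> 1 - T (s i) / T a" "1 - T (s i) / T a \<le> 4 * \<delta>"
    proof -
      show "0 \<le> 1 - T (s i) / T a" using q Tpos by simp
      have "1 - T (s i) / T a = (T a - T (s i)) / T a" using Tpos by (simp add: field_simps)
      also have "\<dots> \<le> (4 * \<delta> * e) / e"
        using Tdiff sT(1)[OF i] Ta_lo e \<delta> by (intro frac_le) auto
      finally show "1 - T (s i) / T a \<le> 4 * \<delta>" using e by simp
    qed
    ultimately have "(1 - T (s i) / T a) * \<bar>?A - real n * T a\<bar> \<le> (4 * \<delta>) * c2"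
      using \<delta> by (intro mult_mono) auto
    also have "\<dots> = 4 * \<epsilon> * sqrt \<kappa>" unfolding c2_def using \<delta> by simp
    finally have d2: "\<bar>(1 - T (s i) / T a) * (?A - real n * T a)\<bar> \<le> 4 * \<epsilon> * sqrt \<kappa>"
      using \<open>0 \<le> 1 - T (s i) / T a\<close> by (simp add: abs_mult)
    have "(?S - real n * T (s i)) - (?A - real n * T a)
        = (?S - T (s i) / T a * ?A) - (1 - T (s i) / T a) * (?A - real n * T a)"
      using Tpos by (simp add: field_simps)
    then have "\<bar>(?S - real n * T (s i)) - (?A - real n * T a)\<bar>
        \<le> \<bar>?S - T (s i) / T a * ?A\<bar> + \<bar>(1 - T (s i) / T a) * (?A - real n * T a)\<bar>"
      by (simp only: abs_triangle_ineq4)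
    also have "\<dots> \<le> \<epsilon> * sqrt \<kappa> + 4 * \<epsilon> * sqrt \<kappa>" by (rule add_mono[OF d1 d2])
    finally have "\<bar>(?S - real n * T (s i)) - (?A - real n * T a)\<bar> \<le> 5 * \<epsilon> * sqrt \<kappa>" by simp
    with G_T[of "s i" \<omega>] G_T[of a \<omega>] sT(3)[OF i] show ?thesis by linarith
  qed
  have fine: "\<bar>fluct n t \<omega> - fluct n a \<omega>\<bar> \<le> 8 * \<epsilon> * sqrt \<kappa>" if \<omega>: "\<omega> \<in> E" and t: "a \<le> t" "t \<le> b" for \<omega> t
  proof (cases "t = b")
    case True
    then have "fluct n t \<omega> = fluct n (s n) \<omega>" using sn by simp
    moreover have "0 < \<epsilon> * sqrt \<kappa>" using \<epsilon> sq by simp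
    ultimately show ?thesis using grid[OF \<omega>, of n] by simp
  next
    case False
    define i where "i = nat \<lfloor>(t - a) / (2 * \<delta>) * real n\<rfloor>"
    have z0: "0 \<le> (t - a) / (2 * \<delta>) * real n" using t \<delta> by simp
    have zn: "(t - a) / (2 * \<delta>) * real n < real n"
    proof -
      have "(t - a) / (2 * \<delta>) < 1" using t False \<delta> by (simp add: a_def b_def)
      then show ?thesis using n mult_strict_right_mono[of "(t - a) / (2 * \<delta>)" 1 "real n"] by simp
    qed
    have i1: "real i \<le> (t - a) / (2 * \<delta>) * real n" "(t - a) / (2 * \<delta>) * real n < real i + 1"
      unfolding i_def using z0 by linarith+
    have i_lt: "i < n" using i1 zn by simp
    have st: "s i \<le> t" "t \<le> s (Suc i)"
      using i1 n \<delta> unfolding s_def by (simp_all add: field_simps)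
    have N_mono: "exceed n y \<omega> \<le> exceed n x \<omega>" if "x \<le> y" for x y
      unfolding exceed_def using that by (intro sum_mono) (auto simp: of_bool_def)
    have gap: "real n * (exp (- s i) - exp (- s (Suc i))) \<le> \<epsilon> * sqrt \<kappa>"
    proof -
      have step: "s (Suc i) = s i + 2 * \<delta> / real n" unfolding s_def using n by (simp add: field_simps)
      have "exp (- s i) - exp (- s (Suc i)) = exp (- s i) * (1 - exp (- (2 * \<delta> / real n)))"
        unfolding step by (simp add: right_diff_distrib exp_add[symmetric])
      also have "\<dots> \<le> (2 * e) * (2 * \<delta> / real n)"
      proof (rule mult_mono)
        have "exp (- s i) \<le> exp (- a)" using sT(3)[of i] i_lt by simp
        also have "\<dots> \<le> 2 * e" using exp_a ed \<delta> e by simp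
        finally show "exp (- s i) \<le> 2 * e" .
        show "1 - exp (- (2 * \<delta> / real n)) \<le> 2 * \<delta> / real n"
          using exp_ge_add_one_self[of "- (2 * \<delta> / real n)"] by linarith
        show "0 \<le> 1 - exp (- (2 * \<delta> / real n))" using \<delta> by simp
      qed (use e in auto)
      finally have "real n * (exp (- s i) - exp (- s (Suc i))) \<le> real n * ((2 * e) * (2 * \<delta> / real n))"
        by (intro mult_left_mono) auto
      also have "\<dots> = (2 * e) * (2 * \<delta>)" using n by simp
      also have "\<dots> \<le> (2 * e) * 1" using e \<delta> by (intro mult_left_mono) auto
      also have "\<dots> \<le> \<epsilon> * sqrt \<kappa>" using small by (simp add: e_def)
      finally show ?thesis .
    qed
    have ex: "exp (- t) \<le> exp (- s i)" "exp (- s (Suc i)) \<le> exp (- t)" using st by auto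
    have "fluct n t \<omega> \<le> fluct n (s i) \<omega> + real n * (exp (- s i) - exp (- s (Suc i)))"
      unfolding fluct_def using N_mono[OF st(1)] mult_left_mono[OF ex(2), of "real n"] by (simp add: right_diff_distrib)
    moreover have "fluct n (s (Suc i)) \<omega> - real n * (exp (- s i) - exp (- s (Suc i))) \<le> fluct n t \<omega>"
      unfolding fluct_def using N_mono[OF st(2)] mult_left_mono[OF ex(1), of "real n"] by (simp add: right_diff_distrib)
    ultimately show ?thesis using gap grid[OF \<omega>, of i] grid[OF \<omega>, of "Suc i"] i_lt by linarith
  qed
  show ?thesis
  proof (rule that)
    show "E \<in> sets M" unfolding E_def by measurable
    have "space M - E \<subseteq> B1 \<union> B2" unfolding E_def by auto
    then have "prob (space M - E) \<le> prob (B1 \<union> B2)" by (intro finite_measure_mono) auto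
    also have "\<dots> \<le> prob B1 + prob B2" by (rule measure_Un_le) auto
    also have "\<dots> \<le> 111 * \<delta> / \<epsilon>\<^sup>2" using P1 P2 by (simp add: add_divide_distrib[symmetric])
    finally show "prob (space M - E) \<le> 111 * \<delta> / \<epsilon>\<^sup>2" .
    fix \<omega> assume \<omega>: "\<omega> \<in> E"
    have "\<bar>exceed n a \<omega> - real n * T a\<bar> \<le> c2" using \<omega> unfolding E_def B2_def by auto
    then have "\<bar>fluct n a \<omega>\<bar> \<le> \<epsilon> / \<delta> * sqrt \<kappa> + \<epsilon> * sqrt \<kappa>" using G_T[of a \<omega>] unfolding c2_def by linarith
    also have "\<epsilon> * sqrt \<kappa> \<le> \<epsilon> / \<delta> * sqrt \<kappa>"
      using \<epsilon> \<delta> sq by (intro mult_right_mono) (auto simp: field_simps)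
    finally show "\<bar>fluct n (\<sigma> - \<delta>) \<omega>\<bar> \<le> 2 * (\<epsilon> / \<delta>) * sqrt \<kappa>" unfolding a_def by simp
    show "\<bar>fluct n s \<omega> - fluct n (\<sigma> - \<delta>) \<omega>\<bar> \<le> 8 * \<epsilon> * sqrt \<kappa>" if "\<sigma> - \<delta> \<le> s" "s \<le> \<sigma> + \<delta>" for s
      using fine[OF \<omega>, of s] that unfolding a_def b_def by simp
  qed
qed

text \<open>The excess is differentiable except at the sample points, where it has a kink; finitely many such points do not
affect the fundamental theorem of calculus.\<close>

lemma excess_diff_eq_integral:
  assumes "x \<le> y"
  shows "((\<lambda>s. - fluct n s \<omega>) has_integral
     (excess n y \<omega> - real n * exp (- y)) - (excess n x \<omega> - real n * exp (- x))) {x..y}"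
proof (rule fundamental_theorem_of_calculus_interior_strong[of "(\<lambda>j. V j \<omega>) ` {1..n}"])
  show "continuous_on {x..y} (\<lambda>s. excess n s \<omega> - real n * exp (- s))"
    unfolding excess_def by (intro continuous_intros)
  fix s assume s: "s \<in> {x<..<y} - (\<lambda>j. V j \<omega>) ` {1..n}"
  have "((\<lambda>s. max 0 (V j \<omega> - s)) has_real_derivative - of_bool (V j \<omega> > s)) (at s)" if "j \<in> {1..n}" for j
  proof -
    have "V j \<omega> \<noteq> s" using s that by auto
    then consider "V j \<omega> > s" | "V j \<omega> < s" by linarith
    then show ?thesis
    proof cases
      case 1
      have "((\<lambda>s. V j \<omega> - s) has_real_derivative -1) (at s)" by (auto intro!: derivative_eq_intros)
      then have "((\<lambda>s. max 0 (V j \<omega> - s)) has_real_derivative -1) (at s)"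
        by (rule has_field_derivative_transform_within_open[of _ _ _ "{..<V j \<omega>}"]) (use 1 in auto)
      then show ?thesis using 1 by simp
    next
      case 2
      have "((\<lambda>s. 0) has_real_derivative 0) (at s)" by simp
      then have "((\<lambda>s. max 0 (V j \<omega> - s)) has_real_derivative 0) (at s)"
        by (rule has_field_derivative_transform_within_open[of _ _ _ "{V j \<omega><..}"]) (use 2 in auto)
      then show ?thesis using 2 by simp
    qed
  qed
  then have "((\<lambda>s. \<Sum>j=1..n. max 0 (V j \<omega> - s)) has_real_derivative (\<Sum>j=1..n. - of_bool (V j \<omega> > s))) (at s)"
    by (rule DERIV_sum)
  moreover have "((\<lambda>s. real n * exp (- s)) has_real_derivative - real n * exp (- s)) (at s)"
    by (auto intro!: derivative_eq_intros)
  ultimately have "((\<lambda>s. excess n s \<omega> - real n * exp (- s)) has_real_derivative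
      (\<Sum>j=1..n. - of_bool (V j \<omega> > s)) - - real n * exp (- s)) (at s)"
    unfolding excess_def by (rule DERIV_diff)
  then show "((\<lambda>s. excess n s \<omega> - real n * exp (- s)) has_vector_derivative - fluct n s \<omega>) (at s)"
    unfolding has_real_derivative_iff_has_vector_derivative[symmetric] fluct_def exceed_def by (simp add: sum_negf)
qed (use assms in auto)

lemma abs_excess_diff_le:
  assumes bound: "\<And>s. s \<in> {min x y..max x y} \<Longrightarrow> \<bar>fluct n s \<omega>\<bar> \<le> C"
  shows "\<bar>(excess n y \<omega> - real n * exp (- y)) - (excess n x \<omega> - real n * exp (- x))\<bar> \<le> C * \<bar>y - x\<bar>"
proof -
  have *: "\<bar>(excess n y \<omega> - real n * exp (- y)) - (excess n x \<omega> - real n * exp (- x))\<bar> \<le> C * (y - x)"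
    if "x \<le> y" "\<And>s. s \<in> {x..y} \<Longrightarrow> \<bar>fluct n s \<omega>\<bar> \<le> C" for x y
  proof -
    have C0: "0 \<le> C" using that(2)[of x] that(1) by (auto intro: order_trans[OF abs_ge_zero])
    have "norm ((excess n y \<omega> - real n * exp (- y)) - (excess n x \<omega> - real n * exp (- x))) \<le> C * measure lborel {x..y}"
      by (rule has_integral_bound_real[OF C0 finite.emptyI excess_diff_eq_integral[OF that(1)]]) (use that(2) in auto)
    then show ?thesis using that(1) by simp
  qed
  show ?thesis
  proof (cases "x \<le> y")
    case True then show ?thesis using *[of x y] bound by simp
  next
    case False then show ?thesis using *[of y x] bound by (simp add: abs_minus_commute)
  qed
qed

text \<open>The score at \<open>\<sigma>\<close> differs from \<open>excess n S - k\<close> by the integral of the fluctuation between \<open>\<sigma>\<close> and \<open>S\<close> and by the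
difference of two fluctuations at \<open>S\<close> and \<open>\<sigma>\<close>. In the second term \<open>k\<close> takes the place of the count at \<open>S\<close>, which
may jump there; \<open>below\<close> and \<open>above\<close> bracket \<open>k\<close> by the count at \<open>S\<close> and the counts just below \<open>S\<close>.\<close>

lemma excess_at_order_level:
  fixes n k :: nat and \<sigma> \<delta> \<epsilon> S :: real
  defines "\<kappa> \<equiv> real n * exp (- \<sigma>)"
  assumes n: "n \<ge> 1" and \<delta>: "0 < \<delta>" "\<delta> \<le> 1/2" and \<epsilon>: "\<epsilon> > 0"
    and small: "2 * exp (- \<sigma>) \<le> \<epsilon> * sqrt \<kappa>"
    and base: "\<bar>fluct n (\<sigma> - \<delta>) \<omega>\<bar> \<le> 2 * (\<epsilon> / \<delta>) * sqrt \<kappa>"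
    and osc: "\<And>s. \<sigma> - \<delta> \<le> s \<Longrightarrow> s \<le> \<sigma> + \<delta> \<Longrightarrow> \<bar>fluct n s \<omega> - fluct n (\<sigma> - \<delta>) \<omega>\<bar> \<le> 8 * \<epsilon> * sqrt \<kappa>"
    and S: "\<sigma> - \<delta> < S" "S \<le> \<sigma> + \<delta>"
    and below: "exceed n S \<omega> < real k"
    and above: "\<And>s. \<sigma> - \<delta> \<le> s \<Longrightarrow> s < S \<Longrightarrow> real k \<le> exceed n s \<omega>"
  shows "\<bar>excess n S \<omega> - real k - score n \<sigma> \<omega>\<bar> \<le> 23 * \<epsilon> * sqrt \<kappa>"
proof -
  have sq: "sqrt \<kappa> > 0" unfolding \<kappa>_def using n by simp
  let ?C = "2 * (\<epsilon> / \<delta>) * sqrt \<kappa> + 8 * \<epsilon> * sqrt \<kappa>"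
  have "\<bar>fluct n s \<omega>\<bar> \<le> ?C" if "s \<in> {min \<sigma> S..max \<sigma> S}" for s
    using osc[of s] base that S \<delta> by (auto simp: min_def max_def split: if_splits)
  then have "\<bar>(excess n S \<omega> - real n * exp (- S)) - (excess n \<sigma> \<omega> - real n * exp (- \<sigma>))\<bar> \<le> ?C * \<bar>S - \<sigma>\<bar>"
    by (rule abs_excess_diff_le)
  also have "\<dots> \<le> ?C * \<delta>" using S \<delta> \<epsilon> sq by (intro mult_left_mono) auto
  also have "\<dots> = 2 * \<epsilon> * sqrt \<kappa> + 8 * \<epsilon> * sqrt \<kappa> * \<delta>" using \<delta> by (simp add: field_simps)
  also have "\<dots> \<le> 6 * \<epsilon> * sqrt \<kappa>"
    using mult_left_mono[OF \<delta>(2), of "8 * \<epsilon> * sqrt \<kappa>"] \<epsilon> sq by simp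
  finally have main: "\<bar>(excess n S \<omega> - real n * exp (- S)) - (excess n \<sigma> \<omega> - real n * exp (- \<sigma>))\<bar> \<le> 6 * \<epsilon> * sqrt \<kappa>" .
  have osc_up: "fluct n s \<omega> \<le> fluct n (\<sigma> - \<delta>) \<omega> + 8 * \<epsilon> * sqrt \<kappa>"
    and osc_low: "fluct n (\<sigma> - \<delta>) \<omega> - 8 * \<epsilon> * sqrt \<kappa> \<le> fluct n s \<omega>"
    if "\<sigma> - \<delta> \<le> s" "s \<le> \<sigma> + \<delta>" for s
    using abs_le_D1[OF osc[OF that]] abs_le_D2[OF osc[OF that]] by linarith+
  have low: "fluct n (\<sigma> - \<delta>) \<omega> - 8 * \<epsilon> * sqrt \<kappa> \<le> real k - real n * exp (- S)"
    using osc_low[of S] S below unfolding fluct_def[of n S] by linarith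
  have up: "real k - real n * exp (- S) \<le> fluct n (\<sigma> - \<delta>) \<omega> + 9 * \<epsilon> * sqrt \<kappa>"
  proof -
    \<comment> \<open>A level just below \<open>S\<close>: a step of size \<open>1 / n\<close> changes \<open>n exp (- s)\<close> by at most \<open>2 exp (- \<sigma>)\<close>.\<close>
    define s where "s = max (\<sigma> - \<delta>) (S - 1 / real n)"
    have s: "\<sigma> - \<delta> \<le> s" "s < S" "S - s \<le> 1 / real n" unfolding s_def using S n by auto
    have "exp (- s) - exp (- S) = exp (- s) * (1 - exp (- (S - s)))"
      by (simp add: right_diff_distrib exp_add[symmetric])
    also have "\<dots> \<le> (2 * exp (- \<sigma>)) * (1 / real n)"
    proof (rule mult_mono)
      have "exp (- s) \<le> exp (\<delta> - \<sigma>)" using s by simp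
      also have "\<dots> = exp \<delta> * exp (- \<sigma>)" by (simp add: exp_add[symmetric])
      also have "\<dots> \<le> 2 * exp (- \<sigma>)" using real_exp_bound_lemma[of \<delta>] \<delta> by (intro mult_right_mono) auto
      finally show "exp (- s) \<le> 2 * exp (- \<sigma>)" .
      show "1 - exp (- (S - s)) \<le> 1 / real n" using exp_ge_add_one_self[of "- (S - s)"] s by linarith
    qed (use s in auto)
    finally have "real n * (exp (- s) - exp (- S)) \<le> real n * ((2 * exp (- \<sigma>)) * (1 / real n))"
      by (intro mult_left_mono) auto
    also have "\<dots> \<le> \<epsilon> * sqrt \<kappa>" using small n by simp
    finally have "real n * exp (- s) - real n * exp (- S) \<le> \<epsilon> * sqrt \<kappa>" by (simp add: right_diff_distrib)
    moreover have "fluct n s \<omega> \<le> fluct n (\<sigma> - \<delta>) \<omega> + 8 * \<epsilon> * sqrt \<kappa>" using s S by (intro osc_up) auto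
    ultimately show ?thesis using above[OF s(1,2)] unfolding fluct_def[of n s] by linarith
  qed
  have "fluct n \<sigma> \<omega> = exceed n \<sigma> \<omega> - real n * exp (- \<sigma>)" by (simp add: fluct_def)
  moreover have "fluct n \<sigma> \<omega> \<le> fluct n (\<sigma> - \<delta>) \<omega> + 8 * \<epsilon> * sqrt \<kappa>"
    "fluct n (\<sigma> - \<delta>) \<omega> - 8 * \<epsilon> * sqrt \<kappa> \<le> fluct n \<sigma> \<omega>"
    using osc_up[of \<sigma>] osc_low[of \<sigma>] \<delta> by auto
  moreover note abs_le_D1[OF main] abs_le_D2[OF main] low up
  ultimately show ?thesis unfolding score_def by (intro abs_leI) linarith+
qed

text \<open>Once \<open>\<surd>\<kappa>\<close> is large, shifting the level by \<open>\<delta>\<close> changes the count by more than the fluctuations, so a rank within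
\<open>\<delta> \<kappa> / 4\<close> of \<open>\<kappa>\<close> is attained inside the window.\<close>

lemma exceed_window_ends:
  fixes n :: nat and \<sigma> \<delta> \<epsilon> :: real
  defines "\<kappa> \<equiv> real n * exp (- \<sigma>)"
  assumes \<delta>: "0 < \<delta>" "\<delta> \<le> 1/2" and \<epsilon>: "\<epsilon> > 0" and n: "n \<ge> 1"
    and large: "24 * \<epsilon> / \<delta>\<^sup>2 < sqrt \<kappa>"
    and base: "\<bar>fluct n (\<sigma> - \<delta>) \<omega>\<bar> \<le> 2 * (\<epsilon> / \<delta>) * sqrt \<kappa>"
    and osc: "\<And>s. \<sigma> - \<delta> \<le> s \<Longrightarrow> s \<le> \<sigma> + \<delta> \<Longrightarrow> \<bar>fluct n s \<omega> - fluct n (\<sigma> - \<delta>) \<omega>\<bar> \<le> 8 * \<epsilon> * sqrt \<kappa>"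
  shows "(1 + \<delta> / 4) * \<kappa> \<le> exceed n (\<sigma> - \<delta>) \<omega>" and "exceed n (\<sigma> + \<delta>) \<omega> < (1 - \<delta> / 4) * \<kappa>"
proof -
  have \<kappa>: "\<kappa> > 0" unfolding \<kappa>_def using n by simp
  have sq: "sqrt \<kappa> > 0" "sqrt \<kappa> * sqrt \<kappa> = \<kappa>" using \<kappa> by auto
  have "24 * \<epsilon> / \<delta>\<^sup>2 * sqrt \<kappa> < \<kappa>" using mult_strict_right_mono[OF large sq(1)] sq(2) by simp
  then have "24 * \<epsilon> / \<delta>\<^sup>2 * sqrt \<kappa> * (\<delta>\<^sup>2 / (4 * \<delta>)) < \<kappa> * (\<delta>\<^sup>2 / (4 * \<delta>))"
    using \<delta> by (intro mult_strict_right_mono) auto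
  then have L: "6 * (\<epsilon> / \<delta>) * sqrt \<kappa> < \<delta> / 4 * \<kappa>" using \<delta> by (simp add: power2_eq_square mult.commute)
  have \<epsilon>\<delta>: "8 * \<epsilon> * sqrt \<kappa> \<le> 4 * (\<epsilon> / \<delta>) * sqrt \<kappa>"
    using \<delta> \<epsilon> sq by (intro mult_right_mono) (auto simp: field_simps)
  have ea: "(1 + \<delta>) * \<kappa> \<le> real n * exp (- (\<sigma> - \<delta>))"
  proof -
    have "real n * exp (- (\<sigma> - \<delta>)) = exp \<delta> * \<kappa>" unfolding \<kappa>_def by (simp add: exp_diff exp_minus field_simps)
    then show ?thesis using exp_ge_add_one_self[of \<delta>] \<kappa> by (simp add: mult_right_mono)
  qed
  have eb: "real n * exp (- (\<sigma> + \<delta>)) \<le> (1 - \<delta> / 2) * \<kappa>"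
  proof -
    have "real n * exp (- (\<sigma> + \<delta>)) = exp (- \<delta>) * \<kappa>" unfolding \<kappa>_def by (simp add: exp_diff exp_minus field_simps exp_add)
    moreover have "exp (- \<delta>) \<le> 1 - \<delta> / 2"
    proof -
      have "exp (- \<delta>) * (1 + \<delta>) \<le> exp (- \<delta>) * exp \<delta>" using exp_ge_add_one_self[of \<delta>] by (intro mult_left_mono) auto
      also have "\<dots> = 1" by (simp add: exp_minus)
      also have "\<dots> \<le> (1 - \<delta> / 2) * (1 + \<delta>)"
      proof -
        have "(1 - \<delta> / 2) * (1 + \<delta>) = 1 + \<delta> * (1/2 - \<delta>/2)" by (simp add: field_simps)
        moreover have "0 \<le> \<delta> * (1/2 - \<delta>/2)" using \<delta> by (intro mult_nonneg_nonneg) auto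
        ultimately show ?thesis by simp
      qed
      finally show ?thesis using \<delta> by simp
    qed
    ultimately show ?thesis using \<kappa> by (simp add: mult_right_mono)
  qed
  show "(1 + \<delta> / 4) * \<kappa> \<le> exceed n (\<sigma> - \<delta>) \<omega>"
  proof -
    have "(1 + \<delta>) * \<kappa> = (1 + \<delta> / 4) * \<kappa> + 3 * (\<delta> / 4 * \<kappa>)" by (simp add: algebra_simps)
    moreover have "0 < \<delta> / 4 * \<kappa>" using \<delta> \<kappa> by simp
    moreover have "0 < (\<epsilon> / \<delta>) * sqrt \<kappa>" using \<delta> \<epsilon> sq by simp
    ultimately show ?thesis using ea abs_le_D2[OF base] L unfolding fluct_def by linarith
  qed
  show "exceed n (\<sigma> + \<delta>) \<omega> < (1 - \<delta> / 4) * \<kappa>"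
  proof -
    have "(1 - \<delta> / 2) * \<kappa> = (1 - \<delta> / 4) * \<kappa> - \<delta> / 4 * \<kappa>" by (simp add: algebra_simps)
    moreover have "fluct n (\<sigma> + \<delta>) \<omega> - fluct n (\<sigma> - \<delta>) \<omega> \<le> 8 * \<epsilon> * sqrt \<kappa>"
      using osc[of "\<sigma> + \<delta>"] \<delta> by (auto dest: abs_le_D1)
    ultimately show ?thesis
      using eb abs_le_D1[OF base] L \<epsilon>\<delta> unfolding fluct_def[of n "\<sigma> + \<delta>"] by linarith
  qed
qed

section \<open>Central limit theorem at a random level\<close>

lemma exceed_relative_error:
  assumes w: "filterlim w at_top sequentially" and big: "filterlim (\<lambda>n. real n * exp (- w n)) at_top sequentially"
    and \<eta>: "\<eta> > 0"
  shows "(\<lambda>n. \<P>(\<omega> in M. \<bar>exceed n (w n) \<omega> - real n * exp (- w n)\<bar> > \<eta> * (real n * exp (- w n)))) \<longlonglongrightarrow> 0"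
proof -
  define m where "m n = real n * exp (- w n)" for n
  define r where "r n = K * exp (- \<tau> * w n)" for n
  have r_lim: "r \<longlonglongrightarrow> 0"
    unfolding r_def[abs_def] by (rule tendsto_exp_decay[OF \<tau>_pos w])
  have ev: "\<forall>\<^sub>F n in sequentially. v0 \<le> w n \<and> r n < min 1 (\<eta> / 2) \<and> m n > 0"
  proof -
    have "\<forall>\<^sub>F n in sequentially. r n < min 1 (\<eta> / 2)" using \<eta> by (intro order_tendstoD[OF r_lim]) simp
    with filterlim_at_top[THEN iffD1, OF w, rule_format, of v0]
      filterlim_at_top_dense[THEN iffD1, OF big, rule_format, of 0]
    show ?thesis unfolding m_def by eventually_elim auto
  qed
  show ?thesis unfolding m_def[symmetric]
  proof (rule tendsto_sandwich[OF _ _ tendsto_const])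
    show "\<forall>\<^sub>F n in sequentially. \<P>(\<omega> in M. \<bar>exceed n (w n) \<omega> - m n\<bar> > \<eta> * m n) \<le> 8 / \<eta>\<^sup>2 * (1 / m n)"
      using ev
    proof eventually_elim
      case (elim n)
      then have n: "v0 \<le> w n" "r n < 1" "r n < \<eta> / 2" "m n > 0" by auto
      have Tb: "(1 - r n) * exp (- w n) \<le> T (w n)" "T (w n) \<le> (1 + r n) * exp (- w n)"
        using tail_bounds[OF n(1) order_refl, of "r n"] by (auto simp: r_def)
      have "real n * ((1 - r n) * exp (- w n)) \<le> real n * T (w n)" "real n * T (w n) \<le> real n * ((1 + r n) * exp (- w n))"
        by (intro mult_left_mono Tb; simp)+
      then have nT: "(1 - r n) * m n \<le> real n * T (w n)" "real n * T (w n) \<le> (1 + r n) * m n"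
        unfolding m_def by (simp_all add: mult_ac)
      have rm: "r n * m n \<le> \<eta> / 2 * m n" "r n * m n \<le> 1 * m n" using n by (intro mult_right_mono; simp)+
      have dif: "\<bar>real n * T (w n) - m n\<bar> \<le> \<eta> / 2 * m n" "real n * T (w n) \<le> 2 * m n"
      proof -
        have "m n - r n * m n \<le> real n * T (w n)" "real n * T (w n) \<le> m n + r n * m n"
          using nT by (simp_all add: algebra_simps)
        with rm show "\<bar>real n * T (w n) - m n\<bar> \<le> \<eta> / 2 * m n" "real n * T (w n) \<le> 2 * m n"
          unfolding abs_le_iff by linarith+
      qed
      have c: "\<eta> / 2 * m n > 0" using \<eta> n by simp
      have "\<P>(\<omega> in M. \<bar>exceed n (w n) \<omega> - m n\<bar> > \<eta> * m n) \<le> \<P>(\<omega> in M. \<bar>exceed n (w n) \<omega> - real n * T (w n)\<bar> \<ge> \<eta> / 2 * m n)"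
      proof (intro finite_measure_mono)
        show "{\<omega> \<in> space M. \<bar>exceed n (w n) \<omega> - m n\<bar> > \<eta> * m n} \<subseteq> {\<omega> \<in> space M. \<bar>exceed n (w n) \<omega> - real n * T (w n)\<bar> \<ge> \<eta> / 2 * m n}"
        proof safe
          fix \<omega> assume "\<bar>exceed n (w n) \<omega> - m n\<bar> > \<eta> * m n"
          then show "\<bar>exceed n (w n) \<omega> - real n * T (w n)\<bar> \<ge> \<eta> / 2 * m n"
            using dif(1) by (simp add: abs_if split: if_splits)
        qed
      qed measurable
      also have "\<dots> \<le> real n * T (w n) / (\<eta> / 2 * m n)\<^sup>2" by (rule exceed_chebyshev[OF c])
      also have "\<dots> \<le> 2 * m n / (\<eta> / 2 * m n)\<^sup>2" by (intro divide_right_mono dif(2)) simp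
      also have "\<dots> = 8 / \<eta>\<^sup>2 * (1 / m n)" using n(4) \<eta> by (simp add: power2_eq_square field_simps)
      finally show ?case .
    qed
    have "(\<lambda>n. 1 / m n) \<longlonglongrightarrow> 0"
      by (rule tendsto_divide_0[OF tendsto_const filterlim_at_top_imp_at_infinity]) (use big in \<open>simp add: m_def\<close>)
    then show "(\<lambda>n. 8 / \<eta>\<^sup>2 * (1 / m n)) \<longlonglongrightarrow> 0" by (rule tendsto_mult_right_zero)
  qed simp
qed

text \<open>The hypothesis \<open>link\<close> describes \<open>Q\<close> as the excess at the level of the \<open>k\<close>-th largest observation, up to a remainder
\<open>R\<close>, whenever that level is known to lie in the window. Each choice of the width \<open>\<delta>\<close> gives an exceptional
probability of order \<open>\<delta> / \<epsilon>\<^sup>2\<close> in the limit, and \<open>\<delta>\<close> is arbitrary.\<close>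

theorem random_level_clt:
  fixes \<sigma> :: "nat \<Rightarrow> real" and k :: "nat \<Rightarrow> 'a \<Rightarrow> nat" and Q R :: "nat \<Rightarrow> 'a \<Rightarrow> real"
  defines "\<kappa> n \<equiv> real n * exp (- \<sigma> n)"
  assumes \<sigma>: "filterlim \<sigma> at_top sequentially" and \<kappa>: "filterlim \<kappa> at_top sequentially"
    and bias: "(\<lambda>n. sqrt (\<kappa> n) * exp (- \<tau> * \<sigma> n)) \<longlonglongrightarrow> 0"
    and k_meas[measurable]: "\<And>n. (\<lambda>\<omega>. real (k n \<omega>)) \<in> borel_measurable M"
    and R_meas[measurable]: "\<And>n. R n \<in> borel_measurable M"
    and Z_meas[measurable]: "\<And>n. (\<lambda>\<omega>. (Q n \<omega> - real (k n \<omega>)) / sqrt (real (k n \<omega>))) \<in> borel_measurable M"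
    and k_lim: "\<And>\<eta>. \<eta> > 0 \<Longrightarrow> (\<lambda>n. \<P>(\<omega> in M. \<bar>real (k n \<omega>) - \<kappa> n\<bar> > \<eta> * \<kappa> n)) \<longlonglongrightarrow> 0"
    and R_lim: "\<And>\<epsilon>. \<epsilon> > 0 \<Longrightarrow> (\<lambda>n. \<P>(\<omega> in M. R n \<omega> > \<epsilon> * sqrt (\<kappa> n))) \<longlonglongrightarrow> 0"
    and link: "\<And>\<delta>. 0 < \<delta> \<Longrightarrow> \<forall>\<^sub>F n in sequentially. AE \<omega> in M.
        real (k n \<omega>) \<le> exceed n (\<sigma> n - \<delta>) \<omega> \<longrightarrow> exceed n (\<sigma> n + \<delta>) \<omega> < real (k n \<omega>) \<longrightarrow>
        (\<exists>S. \<sigma> n - \<delta> < S \<and> S \<le> \<sigma> n + \<delta> \<and> exceed n S \<omega> < real (k n \<omega>) \<and>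
          (\<forall>s. \<sigma> n - \<delta> \<le> s \<longrightarrow> s < S \<longrightarrow> real (k n \<omega>) \<le> exceed n s \<omega>) \<and>
          \<bar>Q n \<omega> - excess n S \<omega>\<bar> \<le> R n \<omega>)"
  shows "weak_conv_m (\<lambda>n. distr M borel (\<lambda>\<omega>. (Q n \<omega> - real (k n \<omega>)) / sqrt (real (k n \<omega>)))) std_normal_distribution"
proof (rule weak_conv_m_close_in_probability[OF Z_meas _ real_dist_normal_dist])
  show "weak_conv_m (\<lambda>n. distr M borel (\<lambda>\<omega>. score n (\<sigma> n) \<omega> / sqrt (\<kappa> n))) std_normal_distribution"
    unfolding \<kappa>_def by (rule score_clt[OF \<sigma> \<kappa>[unfolded \<kappa>_def[abs_def]] bias[unfolded \<kappa>_def]])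
  show "(\<lambda>\<omega>. score n (\<sigma> n) \<omega> / sqrt (\<kappa> n)) \<in> borel_measurable M" for n by measurable
  fix \<epsilon>' :: real assume \<epsilon>': "\<epsilon>' > 0"
  \<comment> \<open>\<open>50\<close> is the constant of \<open>sqrt_ratio_error\<close>.\<close>
  define \<epsilon> where "\<epsilon> = \<epsilon>' / 50"
  have \<epsilon>: "\<epsilon> > 0" "\<epsilon>' = 50 * \<epsilon>" using \<epsilon>' by (simp_all add: \<epsilon>_def)
  let ?Z = "\<lambda>n \<omega>. (Q n \<omega> - real (k n \<omega>)) / sqrt (real (k n \<omega>))"
  let ?Y = "\<lambda>n \<omega>. score n (\<sigma> n) \<omega> / sqrt (\<kappa> n)"
  have sqrt_lim: "filterlim (\<lambda>n. sqrt (\<kappa> n)) at_top sequentially" by (rule filterlim_compose[OF sqrt_at_top \<kappa>])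
  define r where "r n = K * exp (- \<tau> * (\<sigma> n - 1))" for n
  have r_eq: "r n = K * exp \<tau> * exp (- \<tau> * \<sigma> n)" for n
    unfolding r_def by (simp add: exp_add[symmetric] algebra_simps)
  have r_lim: "r \<longlonglongrightarrow> 0"
    unfolding r_eq[abs_def] by (rule tendsto_exp_decay[OF \<tau>_pos \<sigma>])
  have sr_lim: "(\<lambda>n. 2 * sqrt (\<kappa> n) * r n) \<longlonglongrightarrow> 0"
    using tendsto_mult_right_zero[OF bias, of "2 * K * exp \<tau>"] unfolding r_eq by (simp add: mult_ac)
  have prob_bound: "\<forall>\<^sub>F n in sequentially. \<P>(\<omega> in M. \<bar>?Z n \<omega> - ?Y n \<omega>\<bar> > \<epsilon>')
      \<le> 117 * \<delta> / \<epsilon>\<^sup>2 + \<P>(\<omega> in M. \<bar>real (k n \<omega>) - \<kappa> n\<bar> > \<delta> / 4 * \<kappa> n) + \<P>(\<omega> in M. R n \<omega> > \<epsilon> * sqrt (\<kappa> n))"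
    if \<delta>: "0 < \<delta>" "\<delta> \<le> 1/2" for \<delta>
  proof -
    have "\<forall>\<^sub>F n in sequentially. n \<ge> 1" by (rule eventually_ge_at_top)
    moreover have "\<forall>\<^sub>F n in sequentially. max (v0 + 1) 0 \<le> \<sigma> n" using filterlim_at_top[THEN iffD1, OF \<sigma>] by blast
    moreover have "\<forall>\<^sub>F n in sequentially. r n < \<delta> / 4" using \<delta> by (intro order_tendstoD[OF r_lim]) simp
    moreover have "\<forall>\<^sub>F n in sequentially. 2 * sqrt (\<kappa> n) * r n < \<epsilon>" using \<epsilon> by (intro order_tendstoD[OF sr_lim]) simp
    moreover have "\<forall>\<^sub>F n in sequentially. max (24 * \<epsilon> / \<delta>\<^sup>2) (2 / \<epsilon>) < sqrt (\<kappa> n)"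
      using filterlim_at_top_dense[THEN iffD1, OF sqrt_lim] by blast
    ultimately show ?thesis using link[OF \<delta>(1)]
    proof eventually_elim
      case (elim n)
      let ?\<kappa> = "real n * exp (- \<sigma> n)"
      have \<kappa>n: "\<kappa> n = ?\<kappa>" by (simp add: \<kappa>_def)
      have \<kappa>pos: "\<kappa> n > 0" unfolding \<kappa>n using elim(1) by simp
      have r1: "K * exp (- \<tau> * (\<sigma> n - 1)) \<le> \<delta> / 4" "2 * sqrt ?\<kappa> * (K * exp (- \<tau> * (\<sigma> n - 1))) \<le> \<epsilon>"
        using elim(3,4) unfolding r_def \<kappa>_def by simp_all
      have v1: "v0 \<le> \<sigma> n - 1" using elim(2) by simp
      have small: "2 * exp (- \<sigma> n) \<le> \<epsilon> * sqrt ?\<kappa>"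
      proof -
        have "2 * exp (- \<sigma> n) \<le> 2" using elim(2) by simp
        also have "2 \<le> \<epsilon> * sqrt ?\<kappa>" using elim(5) \<epsilon> unfolding \<kappa>n by (simp add: field_simps)
        finally show ?thesis .
      qed
      have large: "24 * \<epsilon> / \<delta>\<^sup>2 < sqrt ?\<kappa>" using elim(5) unfolding \<kappa>n by simp
      obtain E where E: "E \<in> sets M" "prob (space M - E) \<le> 111 * \<delta> / \<epsilon>\<^sup>2"
        "\<And>\<omega>. \<omega> \<in> E \<Longrightarrow> \<bar>fluct n (\<sigma> n - \<delta>) \<omega>\<bar> \<le> 2 * (\<epsilon> / \<delta>) * sqrt ?\<kappa>"
        "\<And>\<omega> s. \<omega> \<in> E \<Longrightarrow> \<sigma> n - \<delta> \<le> s \<Longrightarrow> s \<le> \<sigma> n + \<delta> \<Longrightarrow>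
            \<bar>fluct n s \<omega> - fluct n (\<sigma> n - \<delta>) \<omega>\<bar> \<le> 8 * \<epsilon> * sqrt ?\<kappa>"
        using fluctuation_window[OF elim(1) \<delta> \<epsilon>(1) v1 r1 small] by metis
      let ?B1 = "space M - E"
      let ?B2 = "{\<omega>\<in>space M. \<bar>real (k n \<omega>) - \<kappa> n\<bar> > \<delta> / 4 * \<kappa> n}"
      let ?B3 = "{\<omega>\<in>space M. R n \<omega> > \<epsilon> * sqrt (\<kappa> n)}"
      let ?B4 = "{\<omega>\<in>space M. \<bar>score n (\<sigma> n) \<omega>\<bar> \<ge> \<epsilon> / \<delta> * sqrt (\<kappa> n) + 2 * r n * \<kappa> n}"
      have P4: "prob ?B4 \<le> 6 * \<delta> / \<epsilon>\<^sup>2"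
      proof -
        have c: "\<epsilon> / \<delta> * sqrt (\<kappa> n) > 0" using \<epsilon> \<delta> \<kappa>pos by simp
        have v2: "v0 \<le> \<sigma> n" using v1 by simp
        have rr: "K * exp (- \<tau> * \<sigma> n) \<le> r n" unfolding r_def using K_nonneg \<tau>_pos by (intro mult_left_mono) auto
        have r1': "r n \<le> 1" using elim(3) \<delta> by simp
        have "prob ?B4 \<le> 6 * \<kappa> n / (\<epsilon> / \<delta> * sqrt (\<kappa> n))\<^sup>2"
          using score_chebyshev[OF v2 rr r1' c, of n] unfolding \<kappa>_def .
        also have "\<dots> = 6 * \<delta>\<^sup>2 / \<epsilon>\<^sup>2" using \<kappa>pos \<delta> by (simp add: power_mult_distrib power_divide)
        also have "\<dots> \<le> 6 * \<delta> / \<epsilon>\<^sup>2" using \<delta> by (intro divide_right_mono mult_left_mono) (auto simp: power2_eq_square)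
        finally show ?thesis .
      qed
      have "AE \<omega> in M. \<omega> \<in> {\<omega>\<in>space M. \<bar>?Z n \<omega> - ?Y n \<omega>\<bar> > \<epsilon>'} \<longrightarrow> \<omega> \<in> ((?B1 \<union> ?B2) \<union> ?B3) \<union> ?B4"
        using elim(6)
      proof eventually_elim
        case (elim \<omega>)
        show ?case
        proof (rule impI, rule ccontr)
          assume bad: "\<omega> \<in> {\<omega>\<in>space M. \<bar>?Z n \<omega> - ?Y n \<omega>\<bar> > \<epsilon>'}" "\<omega> \<notin> ((?B1 \<union> ?B2) \<union> ?B3) \<union> ?B4"
          then have \<omega>: "\<omega> \<in> E" "\<bar>real (k n \<omega>) - \<kappa> n\<bar> \<le> \<delta> / 4 * \<kappa> n" "R n \<omega> \<le> \<epsilon> * sqrt (\<kappa> n)"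
            "\<bar>score n (\<sigma> n) \<omega>\<bar> \<le> \<epsilon> / \<delta> * sqrt (\<kappa> n) + 2 * r n * \<kappa> n" by auto
          note base = E(3)[OF \<omega>(1)] and osc = E(4)[OF \<omega>(1)]
          note ends = exceed_window_ends[OF \<delta> \<epsilon>(1) \<open>n \<ge> 1\<close> large base osc, folded \<kappa>n]
          have kk: "real (k n \<omega>) \<le> (1 + \<delta>/4) * \<kappa> n" "(1 - \<delta>/4) * \<kappa> n \<le> real (k n \<omega>)"
            using abs_le_D1[OF \<omega>(2)] abs_le_D2[OF \<omega>(2)] by (simp_all add: algebra_simps)
          have "real (k n \<omega>) \<le> exceed n (\<sigma> n - \<delta>) \<omega>" "exceed n (\<sigma> n + \<delta>) \<omega> < real (k n \<omega>)"
            using kk ends by linarith+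
          with elim obtain S where S: "\<sigma> n - \<delta> < S" "S \<le> \<sigma> n + \<delta>" "exceed n S \<omega> < real (k n \<omega>)"
            "\<And>s. \<sigma> n - \<delta> \<le> s \<Longrightarrow> s < S \<Longrightarrow> real (k n \<omega>) \<le> exceed n s \<omega>"
            "\<bar>Q n \<omega> - excess n S \<omega>\<bar> \<le> R n \<omega>" by blast
          have lev: "\<bar>excess n S \<omega> - real (k n \<omega>) - score n (\<sigma> n) \<omega>\<bar> \<le> 23 * \<epsilon> * sqrt (\<kappa> n)"
            unfolding \<kappa>n by (rule excess_at_order_level[OF \<open>n \<ge> 1\<close> \<delta> \<epsilon>(1) small base osc S(1-4)])
          have q: "\<bar>(Q n \<omega> - real (k n \<omega>)) - score n (\<sigma> n) \<omega>\<bar> \<le> 24 * \<epsilon> * sqrt (\<kappa> n)"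
          proof -
            have "\<bar>(Q n \<omega> - real (k n \<omega>)) - score n (\<sigma> n) \<omega>\<bar>
                \<le> \<bar>Q n \<omega> - excess n S \<omega>\<bar> + \<bar>excess n S \<omega> - real (k n \<omega>) - score n (\<sigma> n) \<omega>\<bar>"
              using abs_triangle_ineq[of "Q n \<omega> - excess n S \<omega>" "excess n S \<omega> - real (k n \<omega>) - score n (\<sigma> n) \<omega>"] by simp
            also have "\<dots> \<le> \<epsilon> * sqrt (\<kappa> n) + 23 * \<epsilon> * sqrt (\<kappa> n)" using S(5) \<omega>(3) lev by linarith
            finally show ?thesis by simp
          qed
          have D: "\<bar>score n (\<sigma> n) \<omega>\<bar> \<le> (\<epsilon> / \<delta> + \<epsilon>) * sqrt (\<kappa> n)"
          proof -
            have "2 * r n * \<kappa> n = (2 * sqrt (\<kappa> n) * r n) * sqrt (\<kappa> n)" using \<kappa>pos by simp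
            also have "\<dots> \<le> \<epsilon> * sqrt (\<kappa> n)" using r1(2) \<kappa>pos unfolding r_def \<kappa>n by (intro mult_right_mono) auto
            finally show ?thesis using \<omega>(4) by (simp add: distrib_right)
          qed
          have "\<bar>?Z n \<omega> - ?Y n \<omega>\<bar> \<le> 50 * \<epsilon>" by (rule sqrt_ratio_error[OF \<kappa>pos \<delta> \<epsilon>(1) \<omega>(2) q D])
          then show False using bad(1) \<epsilon>(2) by simp
        qed
      qed
      then have "\<P>(\<omega> in M. \<bar>?Z n \<omega> - ?Y n \<omega>\<bar> > \<epsilon>') \<le> prob (((?B1 \<union> ?B2) \<union> ?B3) \<union> ?B4)"
        by (rule finite_measure_mono_AE) (use E(1) in measurable)
      also have "\<dots> \<le> prob ((?B1 \<union> ?B2) \<union> ?B3) + prob ?B4"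
        by (rule measure_Un_le) (use E(1) in measurable)
      also have "prob ((?B1 \<union> ?B2) \<union> ?B3) \<le> prob (?B1 \<union> ?B2) + prob ?B3"
        by (rule measure_Un_le) (use E(1) in measurable)
      also have "prob (?B1 \<union> ?B2) \<le> prob ?B1 + prob ?B2"
        by (rule measure_Un_le) (use E(1) in measurable)
      finally show ?case using E(2) P4 by (simp add: add_divide_distrib[symmetric])
    qed
  qed
  show "(\<lambda>n. \<P>(\<omega> in M. \<bar>?Z n \<omega> - ?Y n \<omega>\<bar> > \<epsilon>')) \<longlonglongrightarrow> 0"
  proof (rule order_tendstoI)
    fix a :: real assume a: "a > 0"
    \<comment> \<open>With \<open>351 = 3 * 117\<close> each of the three terms of \<open>prob_bound\<close> is at most \<open>a / 3\<close>; \<open>117\<close> is collected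
      from the window and from Chebyshev's inequality for the score.\<close>
    define \<delta> where "\<delta> = min (1/2) (a * \<epsilon>\<^sup>2 / 351)"
    have \<delta>: "0 < \<delta>" "\<delta> \<le> 1/2" unfolding \<delta>_def using a \<epsilon> by auto
    have "117 * \<delta> \<le> 117 * (a * \<epsilon>\<^sup>2 / 351)" unfolding \<delta>_def by simp
    then have d: "117 * \<delta> / \<epsilon>\<^sup>2 \<le> a / 3" using \<epsilon> by (simp add: field_simps)
    have "\<forall>\<^sub>F n in sequentially. \<P>(\<omega> in M. \<bar>real (k n \<omega>) - \<kappa> n\<bar> > \<delta> / 4 * \<kappa> n) < a / 3"
      using k_lim[of "\<delta> / 4"] \<delta> a by (intro order_tendstoD) auto
    moreover have "\<forall>\<^sub>F n in sequentially. \<P>(\<omega> in M. R n \<omega> > \<epsilon> * sqrt (\<kappa> n)) < a / 3"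
      using R_lim[OF \<epsilon>(1)] a by (intro order_tendstoD) auto
    ultimately show "\<forall>\<^sub>F n in sequentially. \<P>(\<omega> in M. \<bar>?Z n \<omega> - ?Y n \<omega>\<bar> > \<epsilon>') < a"
      using prob_bound[OF \<delta>] by eventually_elim (use d in linarith)
  next
    fix a :: real assume "a < 0"
    then show "\<forall>\<^sub>F n in sequentially. a < \<P>(\<omega> in M. \<bar>?Z n \<omega> - ?Y n \<omega>\<bar> > \<epsilon>')"
      by (auto intro!: always_eventually less_le_trans[OF _ measure_nonneg])
  qed
qed

end

section \<open>Truncated samples on the logarithmic scale\<close>

text \<open>Cutting off at 1 keeps the logarithm meaningful for all \<open>h\<close> and is invisible at levels \<open>s \<ge> - ln c\<close>.\<close>

lemma less_log_max_iff:
  fixes \<alpha> c s h :: real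
  assumes \<alpha>: "\<alpha> > 0" and s: "- ln c \<le> s"
  shows "s < \<alpha> * ln (max h 1) - ln c \<longleftrightarrow> exp ((s + ln c) / \<alpha>) < h"
proof -
  have ge: "1 \<le> exp ((s + ln c) / \<alpha>)" using assms by simp
  have "s < \<alpha> * ln (max h 1) - ln c \<longleftrightarrow> (s + ln c) / \<alpha> < ln (max h 1)"
    using \<alpha> by (simp add: field_simps)
  also have "\<dots> \<longleftrightarrow> exp ((s + ln c) / \<alpha>) < max h 1"
    by (metis exp_less_cancel_iff exp_ln less_le_trans max.cobounded2 zero_less_one)
  also have "\<dots> \<longleftrightarrow> exp ((s + ln c) / \<alpha>) < h"
    using ge unfolding less_max_iff_disj by linarith
  finally show ?thesis .
qed

text \<open>The last two assumptions are the two conditions on the number of truncated observations, written with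
\<open>exp (- v) = c m powr (- \<alpha>)\<close> in place of the asymptotically equal probability of truncation.\<close>

locale truncated_tail_sample = exponential_tail_sample P V T K \<tau> v0
  for P :: "'a measure" and V T K \<tau> v0 +
  fixes H L :: "nat \<Rightarrow> 'a \<Rightarrow> real" and m :: "nat \<Rightarrow> real" and \<alpha> \<beta> \<gamma> c l :: real
  assumes H_measurable[measurable]: "H j \<in> borel_measurable P"
    and V_eq: "V j \<omega> = \<alpha> * ln (max (H j \<omega>) 1) - ln c"
    and L_integrable: "integrable P (L j)" and L_mean: "expectation (L j) = l" and L_pos: "AE \<omega> in P. L j \<omega> > 0"
    and H_L_indep: "indep_var borel (H j) borel (L j)"
    and m_pos: "m n > 0" and m_lim: "filterlim m at_top sequentially"
    and \<alpha>: "\<alpha> > 0" and c: "c > 0" and \<beta>: "0 < \<beta>" "\<beta> < 1" and \<gamma>: "0 < \<gamma>" "\<gamma> < 1"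
    and light: "\<alpha> * (1 - \<beta>) \<le> 1" and second_order: "(1 - \<beta>) / \<beta> \<le> \<tau>"
    and heavy_truncation: "filterlim (\<lambda>n. real n * exp (- (\<alpha> * ln (m n) - ln c))) at_top sequentially"
    and few_truncated: "(\<lambda>n. real n * exp (- (2 - \<beta>) * (\<alpha> * ln (m n) - ln c))) \<longlonglongrightarrow> 0"
begin

lemma L_measurable[measurable]: "L j \<in> borel_measurable P"
  using L_integrable by auto

text \<open>\<open>v\<close>, \<open>w\<close> and \<open>\<sigma>\<close> are the levels belonging to the truncation point \<open>m n\<close>, to \<open>\<gamma> m n\<close> and to the asymptotic rank
\<open>\<kappa>\<close> of the random sample fraction.\<close>

definition v :: "nat \<Rightarrow> real" where "v n = \<alpha> * ln (m n) - ln c"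
definition w :: "nat \<Rightarrow> real" where "w n = v n + \<alpha> * ln \<gamma>"
definition \<sigma> :: "nat \<Rightarrow> real" where "\<sigma> n = \<beta> * w n"
definition \<kappa> :: "nat \<Rightarrow> real" where "\<kappa> n = real n * exp (- \<sigma> n)"

text \<open>The inverse of \<open>y \<mapsto> \<alpha> ln y - ln c\<close>.\<close>

definition level :: "real \<Rightarrow> real" where "level s = exp ((s + ln c) / \<alpha>)"

text \<open>The total overshoot of the truncated observations relative to the truncation point. It dominates both the
relative overshoot of the maximum and the sum of the logarithmic overshoots.\<close>

definition U :: "nat \<Rightarrow> 'a \<Rightarrow> real" where
  "U n \<omega> = (\<Sum>j=1..n. of_bool (H j \<omega> > m n) * (max 0 (L j \<omega>) / m n))"

text \<open>Bounds the change of \<open>\<alpha> k h(k)\<close> when the truncated observations are replaced by the original ones.\<close>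

definition R :: "nat \<Rightarrow> 'a \<Rightarrow> real" where "R n \<omega> = \<alpha> * U n \<omega> + excess n (v n) \<omega>"

lemma v_lim: "filterlim v at_top sequentially"
proof -
  have "filterlim (\<lambda>n. \<alpha> * ln (m n)) at_top sequentially"
    by (rule filterlim_tendsto_pos_mult_at_top[OF tendsto_const \<alpha> filterlim_compose[OF ln_at_top m_lim]])
  from filterlim_tendsto_add_at_top[OF tendsto_const this, of "- ln c"]
  show ?thesis unfolding v_def[abs_def] by (simp add: algebra_simps)
qed

lemma w_lim: "filterlim w at_top sequentially"
  using filterlim_tendsto_add_at_top[OF tendsto_const v_lim, of "\<alpha> * ln \<gamma>"]
  unfolding w_def[abs_def] by (simp add: algebra_simps)

lemma \<sigma>_lim: "filterlim \<sigma> at_top sequentially"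
  unfolding \<sigma>_def[abs_def] by (rule filterlim_tendsto_pos_mult_at_top[OF tendsto_const \<beta>(1) w_lim])

lemma few: "(\<lambda>n. real n * exp (- (2 - \<beta>) * v n)) \<longlonglongrightarrow> 0"
  using few_truncated unfolding v_def .

lemma many: "filterlim (\<lambda>n. real n * exp (- v n)) at_top sequentially"
  using heavy_truncation unfolding v_def .

lemma v_nonneg: "\<forall>\<^sub>F n in sequentially. 0 \<le> v n"
  using filterlim_at_top[THEN iffD1, OF v_lim] by blast

lemma exp_w: "exp (- b * w n) = exp (- b * (\<alpha> * ln \<gamma>)) * exp (- b * v n)"
  unfolding w_def by (simp add: exp_add[symmetric] algebra_simps)

lemma \<kappa>_eq: "\<kappa> n = exp (- \<beta> * (\<alpha> * ln \<gamma>)) * (real n * exp (- \<beta> * v n))"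
  unfolding \<kappa>_def \<sigma>_def using exp_w[of \<beta> n] by simp

lemma \<kappa>_lim: "filterlim \<kappa> at_top sequentially"
proof -
  have "filterlim (\<lambda>n. real n * exp (- \<beta> * v n)) at_top sequentially"
  proof (rule filterlim_at_top_mono[OF many])
    show "\<forall>\<^sub>F n in sequentially. real n * exp (- v n) \<le> real n * exp (- \<beta> * v n)"
      using v_nonneg
    proof eventually_elim
      case (elim n)
      then have "\<beta> * v n \<le> 1 * v n" using \<beta> by (intro mult_right_mono) auto
      then show ?case by (intro mult_left_mono) auto
    qed
  qed
  then show ?thesis unfolding \<kappa>_eq[abs_def]
    by (intro filterlim_tendsto_pos_mult_at_top[OF tendsto_const]) auto
qed

lemma \<kappa>_pos: "\<forall>\<^sub>F n in sequentially. 1 < \<kappa> n"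
  using filterlim_at_top_dense[THEN iffD1, OF \<kappa>_lim] by blast

text \<open>The square is a constant times \<open>n exp (- b v)\<close> with \<open>b = \<beta> (1 + 2 \<tau>)\<close>, and \<open>b \<ge> 2 - \<beta>\<close> amounts to
\<open>\<tau> \<ge> (1 - \<beta>) / \<beta>\<close>.\<close>

lemma bias_lim: "(\<lambda>n. sqrt (\<kappa> n) * exp (- \<tau> * \<sigma> n)) \<longlonglongrightarrow> 0"
proof (rule tendsto_zero_of_square)
  define b where "b = \<beta> * (1 + 2 * \<tau>)"
  have "1 - \<beta> \<le> \<beta> * \<tau>" using second_order \<beta> by (simp add: field_simps)
  then have b: "2 - \<beta> \<le> b" unfolding b_def by (simp add: algebra_simps)
  have eq: "(sqrt (\<kappa> n) * exp (- \<tau> * \<sigma> n))\<^sup>2 = exp (- b * (\<alpha> * ln \<gamma>)) * (real n * exp (- b * v n))" for n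
  proof -
    have "(sqrt (\<kappa> n) * exp (- \<tau> * \<sigma> n))\<^sup>2 = \<kappa> n * exp (- 2 * \<tau> * \<sigma> n)"
      unfolding power_mult_distrib by (simp add: \<kappa>_def exp_double[symmetric] mult.assoc flip: exp_of_nat_mult)
    also have "\<dots> = real n * exp (- b * w n)"
      unfolding \<kappa>_def \<sigma>_def b_def by (simp add: exp_add[symmetric] algebra_simps)
    also have "\<dots> = exp (- b * (\<alpha> * ln \<gamma>)) * (real n * exp (- b * v n))" unfolding exp_w by simp
    finally show ?thesis .
  qed
  have "(\<lambda>n. real n * exp (- b * v n)) \<longlonglongrightarrow> 0"
  proof (rule tendsto_sandwich[OF _ _ tendsto_const few])
    show "\<forall>\<^sub>F n in sequentially. real n * exp (- b * v n) \<le> real n * exp (- (2 - \<beta>) * v n)"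
      using v_nonneg
    proof eventually_elim
      case (elim n)
      then have "(2 - \<beta>) * v n \<le> b * v n" using b by (intro mult_right_mono) auto
      then have "- b * v n \<le> - (2 - \<beta>) * v n" by (simp only: minus_mult_left[symmetric] neg_le_iff_le)
      then show ?case by (intro mult_left_mono) auto
    qed
  qed simp
  then show "(\<lambda>n. (sqrt (\<kappa> n) * exp (- \<tau> * \<sigma> n))\<^sup>2) \<longlonglongrightarrow> 0"
    unfolding eq by (rule tendsto_mult_right_zero)
qed

text \<open>The expected number of truncated observations is negligible against the standard deviation \<open>\<surd>\<kappa>\<close>: the square of the
ratio is a constant times \<open>n exp (- (2 - \<beta>) v)\<close>.\<close>

lemma truncated_fraction_lim: "(\<lambda>n. real n * exp (- v n) / sqrt (\<kappa> n)) \<longlonglongrightarrow> 0"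
proof (rule tendsto_zero_of_square)
  have eq: "(real n * exp (- v n) / sqrt (\<kappa> n))\<^sup>2 = exp (\<beta> * (\<alpha> * ln \<gamma>)) * (real n * exp (- (2 - \<beta>) * v n))" if "n \<ge> 1" for n
  proof -
    have "(real n * exp (- v n) / sqrt (\<kappa> n))\<^sup>2 = (real n * exp (- v n))\<^sup>2 / \<kappa> n"
      by (simp add: power_divide \<kappa>_def)
    also have "\<dots> = exp (\<beta> * (\<alpha> * ln \<gamma>)) * (real n * (exp (- v n) * exp (- v n) * exp (\<beta> * v n)))"
      unfolding \<kappa>_eq using that by (simp add: power2_eq_square exp_minus field_simps)
    also have "exp (- v n) * exp (- v n) * exp (\<beta> * v n) = exp (- (2 - \<beta>) * v n)"
      by (simp add: exp_add[symmetric] algebra_simps)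
    finally show ?thesis .
  qed
  have "(\<lambda>n. exp (\<beta> * (\<alpha> * ln \<gamma>)) * (real n * exp (- (2 - \<beta>) * v n))) \<longlonglongrightarrow> 0"
    by (rule tendsto_mult_right_zero[OF few])
  then show "(\<lambda>n. (real n * exp (- v n) / sqrt (\<kappa> n))\<^sup>2) \<longlonglongrightarrow> 0"
    by (rule Lim_transform_eventually) (use eventually_ge_at_top[of 1] in \<open>eventually_elim, simp only: eq\<close>)
qed

text \<open>The sequence is the product of \<open>n exp (- (2 - \<beta>) v)\<close>, which tends to zero, and of \<open>exp ((1 - \<beta>) v) / m\<close>, which is of order
\<open>m powr (\<alpha> (1 - \<beta>) - 1)\<close> and hence bounded.\<close>

lemma overshoot_lim: "(\<lambda>n. real n * exp (- v n) / m n) \<longlonglongrightarrow> 0"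
proof (rule tendsto_sandwich[OF _ _ tendsto_const])
  have "\<forall>\<^sub>F n in sequentially. 1 \<le> m n" using filterlim_at_top[THEN iffD1, OF m_lim] by blast
  then show "\<forall>\<^sub>F n in sequentially. real n * exp (- v n) / m n \<le> exp (- (1 - \<beta>) * ln c) * (real n * exp (- (2 - \<beta>) * v n))"
  proof eventually_elim
    case (elim n)
    have "exp (- v n) / m n = exp (- v n - ln (m n))" using elim by (simp add: exp_diff)
    also have "\<dots> = exp (- (2 - \<beta>) * v n) * exp ((1 - \<beta>) * v n - ln (m n))"
      by (simp add: exp_add[symmetric] algebra_simps)
    also have "\<dots> \<le> exp (- (2 - \<beta>) * v n) * exp (- (1 - \<beta>) * ln c)"
    proof (intro mult_left_mono)
      have "(\<alpha> * (1 - \<beta>)) * ln (m n) \<le> 1 * ln (m n)" using light elim by (intro mult_right_mono) auto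
      then show "exp ((1 - \<beta>) * v n - ln (m n)) \<le> exp (- (1 - \<beta>) * ln c)"
        unfolding v_def by (simp add: algebra_simps)
    qed simp
    finally have "real n * (exp (- v n) / m n) \<le> real n * (exp (- (2 - \<beta>) * v n) * exp (- (1 - \<beta>) * ln c))"
      by (intro mult_left_mono) auto
    then show ?case by (simp add: mult_ac)
  qed
  show "(\<lambda>n. exp (- (1 - \<beta>) * ln c) * (real n * exp (- (2 - \<beta>) * v n))) \<longlonglongrightarrow> 0"
    by (rule tendsto_mult_right_zero[OF few])
  show "\<forall>\<^sub>F n in sequentially. 0 \<le> real n * exp (- v n) / m n"
  proof (intro always_eventually allI)
    show "0 \<le> real n * exp (- v n) / m n" for n using m_pos[of n] by simp
  qed
qed

lemma level_less_iff: "level s < level t \<longleftrightarrow> s < t" and level_pos: "level s > 0"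
  unfolding level_def using \<alpha> by (auto simp: divide_less_cancel)

lemma level_v: "level (v n) = m n"
  unfolding level_def v_def using \<alpha> m_pos[of n] by simp

lemma level_w: "level (w n + x) = \<gamma> * m n * exp (x / \<alpha>)"
proof -
  have "(w n + x + ln c) / \<alpha> = ln (m n) + ln \<gamma> + x / \<alpha>"
    unfolding w_def v_def using \<alpha> by (simp add: field_simps)
  then show ?thesis unfolding level_def using m_pos[of n] \<gamma> by (simp add: exp_add mult_ac)
qed

lemma level_of_log: "y > 0 \<Longrightarrow> level (\<alpha> * ln y - ln c) = y"
  unfolding level_def using \<alpha> by simp

lemma V_greater_iff:
  assumes "- ln c \<le> s" shows "V j \<omega> > s \<longleftrightarrow> H j \<omega> > level s"
  unfolding V_eq level_def by (rule less_log_max_iff[OF \<alpha> assms])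

lemma X_greater_iff:
  assumes "- ln c \<le> s" "s < v n" "L j \<omega> > 0"
  shows "truncated_sample (m n) H L \<omega> j > level s \<longleftrightarrow> V j \<omega> > s"
proof -
  have "level s < m n" using assms(2) level_less_iff[of s "v n"] level_v by simp
  then show ?thesis using assms V_greater_iff[of s j \<omega>] unfolding truncated_sample_def by auto
qed

lemma count_X:
  assumes "- ln c \<le> s" "s < v n" "\<And>j. L j \<omega> > 0"
  shows "(\<Sum>j=1..n. of_bool (truncated_sample (m n) H L \<omega> j > level s)) = exceed n s \<omega>"
  unfolding exceed_def using X_greater_iff[OF assms(1,2)] assms(3) by simp

lemma AE_L_pos: "AE \<omega> in P. \<forall>j. L j \<omega> > 0"
  using L_pos by (simp add: AE_all_countable)

lemma U_nonneg: "U n \<omega> \<ge> 0"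
  unfolding U_def using m_pos[of n] by (intro sum_nonneg) auto

lemma U_expectation:
  assumes "- ln c \<le> v n" shows "integrable P (U n)" and "expectation (U n) = real n * T (v n) * l / m n"
proof -
  have t: "integrable P (\<lambda>\<omega>. of_bool (H j \<omega> > m n) * (max 0 (L j \<omega>) / m n)) \<and>
    expectation (\<lambda>\<omega>. of_bool (H j \<omega> > m n) * (max 0 (L j \<omega>) / m n)) = T (v n) * (l / m n)" for j
  proof -
    have "indep_var borel ((\<lambda>h. of_bool (h > m n) :: real) \<circ> H j) borel ((\<lambda>y. max 0 y / m n) \<circ> L j)"
      by (rule indep_var_compose[OF H_L_indep]) auto
    then have iv: "indep_var borel (\<lambda>\<omega>. of_bool (H j \<omega> > m n) :: real) borel (\<lambda>\<omega>. max 0 (L j \<omega>) / m n)"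
      by (simp add: comp_def)
    have eqV: "of_bool (H j \<omega> > m n) = (of_bool (V j \<omega> > v n) :: real)" for \<omega>
      using V_greater_iff[OF assms, of j \<omega>] level_v by simp
    have i1: "integrable P (\<lambda>\<omega>. of_bool (H j \<omega> > m n) :: real)" "expectation (\<lambda>\<omega>. of_bool (H j \<omega> > m n)) = T (v n)"
      unfolding eqV by (rule integrable_indicator_tail, rule expectation_indicator_tail)
    have i2: "integrable P (\<lambda>\<omega>. max 0 (L j \<omega>) / m n)"
      using L_integrable[of j] by (intro integrable_divide integrable_max) auto
    have "expectation (\<lambda>\<omega>. max 0 (L j \<omega>)) = expectation (L j)"
      by (rule integral_cong_AE) (use L_pos[of j] in auto)
    then have e2: "expectation (\<lambda>\<omega>. max 0 (L j \<omega>) / m n) = l / m n" by (simp add: L_mean)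
    show ?thesis
      using indep_var_integrable[OF iv i1(1) i2] indep_var_lebesgue_integral[OF iv i1(1) i2, unfolded i1(2) e2] by blast
  qed
  show "integrable P (U n)" unfolding U_def[abs_def] using t by auto
  show "expectation (U n) = real n * T (v n) * l / m n"
  proof -
    have "expectation (U n) = (\<Sum>j=1..n. expectation (\<lambda>\<omega>. of_bool (H j \<omega> > m n) * (max 0 (L j \<omega>) / m n)))"
      unfolding U_def[abs_def] using t by (intro Bochner_Integration.integral_sum) blast
    also have "\<dots> = (\<Sum>j=1..n. T (v n) * (l / m n))" using t by (intro sum.cong refl) blast
    finally show ?thesis by simp
  qed
qed

lemma eventually_tail: "\<forall>\<^sub>F n in sequentially. max v0 (- ln c) \<le> v n \<and> K * exp (- \<tau> * v n) \<le> 1"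
proof -
  have "\<forall>\<^sub>F n in sequentially. K * exp (- \<tau> * v n) < 1"
    by (rule order_tendstoD(2)[OF tendsto_exp_decay[OF \<tau>_pos v_lim]]) simp
  with filterlim_at_top[THEN iffD1, OF v_lim, rule_format, of "max v0 (- ln c)"]
  show ?thesis by eventually_elim auto
qed

lemma U_measurable[measurable]: "U n \<in> borel_measurable P"
  unfolding U_def[abs_def] by measurable

lemma R_measurable[measurable]: "R n \<in> borel_measurable P"
  unfolding R_def[abs_def] by measurable

lemma tail_at_v:
  assumes "max v0 (- ln c) \<le> v n \<and> K * exp (- \<tau> * v n) \<le> 1"
  shows "T (v n) \<le> 2 * exp (- v n)"
  using tail_bounds(2)[of "v n" "v n" 1] assms by simp

lemma U_expectation_lim: "(\<lambda>n. expectation (U n)) \<longlonglongrightarrow> 0"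
proof (rule Lim_null_comparison)
  show "\<forall>\<^sub>F n in sequentially. norm (expectation (U n)) \<le> 2 * \<bar>l\<bar> * (real n * exp (- v n) / m n)"
    using eventually_tail
  proof eventually_elim
    case (elim n)
    have "norm (expectation (U n)) = T (v n) * (real n * \<bar>l\<bar> / m n)"
      using U_expectation(2)[of n] elim tail_nonneg m_pos[of n] by (simp add: abs_mult)
    also have "\<dots> \<le> 2 * exp (- v n) * (real n * \<bar>l\<bar> / m n)"
      using tail_at_v[OF elim] m_pos[of n] by (intro mult_right_mono) auto
    finally show ?case by (simp add: mult_ac)
  qed
  show "(\<lambda>n. 2 * \<bar>l\<bar> * (real n * exp (- v n) / m n)) \<longlonglongrightarrow> 0" by (rule tendsto_mult_right_zero[OF overshoot_lim])
qed

lemma U_lim: "\<epsilon> > 0 \<Longrightarrow> (\<lambda>n. \<P>(\<omega> in P. U n \<omega> > \<epsilon>)) \<longlonglongrightarrow> 0"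
  using markov_relative[of U "\<lambda>_. 1" \<epsilon>] U_nonneg U_expectation_lim eventually_mono[OF eventually_tail] U_expectation(1)
  by fastforce

lemma R_lim:
  assumes "\<epsilon> > 0" shows "(\<lambda>n. \<P>(\<omega> in P. R n \<omega> > \<epsilon> * sqrt (\<kappa> n))) \<longlonglongrightarrow> 0"
proof (rule markov_relative[OF _ _ _ _ assms])
  have ex: "integrable P (excess n (v n)) \<and> expectation (excess n (v n)) \<le> real n * (2 * exp (- v n)) \<and> 0 \<le> expectation (excess n (v n))"
    if n: "max v0 (- ln c) \<le> v n \<and> K * exp (- \<tau> * v n) \<le> 1" for n
  proof -
    have mom: "integrable P (\<lambda>\<omega>. max 0 (V j \<omega> - v n)) \<and> expectation (\<lambda>\<omega>. max 0 (V j \<omega> - v n)) \<le> 2 * exp (- v n)" for j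
      using excess_moments(1,3)[of "v n" 1 j 0] n by simp
    have "expectation (excess n (v n)) = (\<Sum>j=1..n. expectation (\<lambda>\<omega>. max 0 (V j \<omega> - v n)))"
      unfolding excess_def[abs_def] using mom by (intro Bochner_Integration.integral_sum) blast
    also have "\<dots> \<le> (\<Sum>j=1..n. 2 * exp (- v n))" using mom by (intro sum_mono) blast
    finally have "expectation (excess n (v n)) \<le> real n * (2 * exp (- v n))" by simp
    moreover have "integrable P (excess n (v n))" unfolding excess_def[abs_def] using mom by auto
    moreover have "0 \<le> expectation (excess n (v n))"
      unfolding excess_def by (intro Bochner_Integration.integral_nonneg sum_nonneg) auto
    ultimately show ?thesis by blast
  qed
  show "\<forall>\<^sub>F n in sequentially. integrable P (R n)"
    using eventually_tail
  proof eventually_elim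
    case (elim n)
    show ?case unfolding R_def[abs_def] using ex[OF elim] U_expectation(1)[of n] elim by auto
  qed
  show "0 \<le> R n \<omega>" for n \<omega>
    unfolding R_def excess_def using U_nonneg \<alpha> by (intro add_nonneg_nonneg mult_nonneg_nonneg sum_nonneg) auto
  show "\<forall>\<^sub>F n in sequentially. 0 < sqrt (\<kappa> n)" using \<kappa>_pos by eventually_elim simp
  show "(\<lambda>n. expectation (R n) / sqrt (\<kappa> n)) \<longlonglongrightarrow> 0"
  proof (rule Lim_null_comparison)
    show "\<forall>\<^sub>F n in sequentially. norm (expectation (R n) / sqrt (\<kappa> n)) \<le> \<alpha> * \<bar>expectation (U n)\<bar> + 2 * (real n * exp (- v n) / sqrt (\<kappa> n))"
      using eventually_tail \<kappa>_pos
    proof eventually_elim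
      case (elim n)
      note exn = ex[OF elim(1)]
      have s: "sqrt (\<kappa> n) \<ge> 1" using elim(2) by simp
      have "expectation (R n) = \<alpha> * expectation (U n) + expectation (excess n (v n))"
        unfolding R_def[abs_def] using exn U_expectation(1)[of n] elim(1) by auto
      then have "\<bar>expectation (R n)\<bar> \<le> \<alpha> * \<bar>expectation (U n)\<bar> + 2 * (real n * exp (- v n))"
        using exn \<alpha> abs_triangle_ineq[of "\<alpha> * expectation (U n)" "expectation (excess n (v n))"]
        by (simp add: abs_mult)
      then have "\<bar>expectation (R n)\<bar> / sqrt (\<kappa> n) \<le> (\<alpha> * \<bar>expectation (U n)\<bar> + 2 * (real n * exp (- v n))) / sqrt (\<kappa> n)"
        using s by (intro divide_right_mono) auto
      also have "\<dots> = \<alpha> * \<bar>expectation (U n)\<bar> / sqrt (\<kappa> n) + 2 * (real n * exp (- v n) / sqrt (\<kappa> n))"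
        by (simp add: add_divide_distrib)
      also have "\<alpha> * \<bar>expectation (U n)\<bar> / sqrt (\<kappa> n) \<le> \<alpha> * \<bar>expectation (U n)\<bar> / 1"
        using s \<alpha> by (intro divide_left_mono) auto
      finally show ?case using s by simp
    qed
    have "(\<lambda>n. \<alpha> * \<bar>expectation (U n)\<bar>) \<longlonglongrightarrow> 0"
      by (rule tendsto_mult_right_zero[OF tendsto_rabs_zero[OF U_expectation_lim]])
    from tendsto_add[OF this tendsto_mult_right_zero[OF truncated_fraction_lim, of 2]]
    show "(\<lambda>n. \<alpha> * \<bar>expectation (U n)\<bar> + 2 * (real n * exp (- v n) / sqrt (\<kappa> n))) \<longlonglongrightarrow> 0" by simp
  qed
qed

text \<open>The maximum lies between \<open>m n\<close> and \<open>m n exp (\<theta> / \<alpha>)\<close>, so the data-driven threshold \<open>\<gamma> X\<^bsub>(1)\<^esub>\<close> is caught between two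
deterministic levels below the truncation point.\<close>

lemma count_near_maximum:
  fixes n :: nat and \<omega> :: 'a
  defines "x \<equiv> truncated_sample (m n) H L \<omega>"
  assumes n: "n \<ge> 1" and L: "\<And>j. L j \<omega> > 0" and \<theta>: "0 \<le> \<theta>"
    and U: "U n \<omega> \<le> exp (\<theta> / \<alpha>) - 1" and hit: "exceed n (v n) \<omega> > 0"
    and w: "- ln c \<le> w n" "w n + \<theta> < v n"
  shows "exceed n (w n + \<theta>) \<omega> \<le> (\<Sum>j=1..n. of_bool (x j > \<gamma> * order_stat n x 1))"
    and "(\<Sum>j=1..n. of_bool (x j > \<gamma> * order_stat n x 1)) \<le> exceed n (w n) \<omega>"
proof -
  have wv: "- ln c \<le> v n" using w \<theta> by simp
  have "\<exists>j\<in>{1..n}. V j \<omega> > v n"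
  proof (rule ccontr)
    assume "\<not> ?thesis"
    then have "exceed n (v n) \<omega> = 0" unfolding exceed_def by (intro sum.neutral) auto
    then show False using hit by simp
  qed
  then obtain j where j: "j \<in> {1..n}" "V j \<omega> > v n" by blast
  have "H j \<omega> > m n" using V_greater_iff[OF wv, of j \<omega>] j level_v by simp
  then have "m n \<le> x j" unfolding x_def truncated_sample_def using L[of j] by simp
  then have os_ge: "m n \<le> order_stat n x 1" using order_stat_first_ge[OF j(1), of x] by simp
  have os_le: "order_stat n x 1 \<le> m n * exp (\<theta> / \<alpha>)"
  proof (rule order_stat_first_le[OF n])
    fix i assume i: "i \<in> {1..n}"
    have e1: "1 \<le> exp (\<theta> / \<alpha>)" using \<theta> \<alpha> by simp
    show "x i \<le> m n * exp (\<theta> / \<alpha>)"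
    proof (cases "H i \<omega> \<le> m n")
      case True
      then have "x i \<le> m n * 1" unfolding x_def truncated_sample_def by simp
      also have "\<dots> \<le> m n * exp (\<theta> / \<alpha>)" using e1 m_pos[of n] by (intro mult_left_mono) auto
      finally show ?thesis .
    next
      case False
      have "of_bool (H i \<omega> > m n) * (max 0 (L i \<omega>) / m n) \<le> U n \<omega>"
        unfolding U_def using m_pos[of n] i by (intro member_le_sum) auto
      then have "L i \<omega> / m n \<le> exp (\<theta> / \<alpha>) - 1" using U L[of i] False by (simp add: max_def)
      then have "L i \<omega> \<le> (exp (\<theta> / \<alpha>) - 1) * m n" using m_pos[of n] by (simp add: pos_divide_le_eq)
      then show ?thesis using False unfolding x_def truncated_sample_def by (simp add: algebra_simps)
    qed
  qed
  have lev: "level (w n) = \<gamma> * m n" "level (w n + \<theta>) = \<gamma> * (m n * exp (\<theta> / \<alpha>))"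
    using level_w[of n 0] level_w[of n \<theta>] by (simp_all add: mult_ac)
  have lo: "level (w n) \<le> \<gamma> * order_stat n x 1" and up: "\<gamma> * order_stat n x 1 \<le> level (w n + \<theta>)"
    unfolding lev using os_ge os_le \<gamma> by (auto intro!: mult_left_mono)
  have "exceed n (w n + \<theta>) \<omega> = (\<Sum>j=1..n. of_bool (x j > level (w n + \<theta>)))"
    unfolding x_def by (rule count_X[symmetric]) (use w \<theta> L in auto)
  also have "\<dots> \<le> (\<Sum>j=1..n. of_bool (x j > \<gamma> * order_stat n x 1))"
    using up by (intro sum_mono) (auto simp: of_bool_def)
  finally show "exceed n (w n + \<theta>) \<omega> \<le> (\<Sum>j=1..n. of_bool (x j > \<gamma> * order_stat n x 1))" .
  have "(\<Sum>j=1..n. of_bool (x j > \<gamma> * order_stat n x 1)) \<le> (\<Sum>j=1..n. of_bool (x j > level (w n)) :: real)"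
    using lo by (intro sum_mono) (auto simp: of_bool_def)
  also have "\<dots> = exceed n (w n) \<omega>"
    unfolding x_def by (rule count_X) (use w \<theta> L in auto)
  finally show "(\<Sum>j=1..n. of_bool (x j > \<gamma> * order_stat n x 1)) \<le> exceed n (w n) \<omega>" .
qed

lemma truncated_sample_measurable[measurable]: "(\<lambda>\<omega>. truncated_sample (m n) H L \<omega> j) \<in> borel_measurable P"
  unfolding truncated_sample_def by measurable

definition k :: "nat \<Rightarrow> 'a \<Rightarrow> nat" where "k n \<omega> = k_hat \<beta> \<gamma> n (truncated_sample (m n) H L \<omega>)"

lemma k_measurable[measurable]: "(\<lambda>\<omega>. real (k n \<omega>)) \<in> borel_measurable P"
  unfolding k_def by (rule measurable_compose[OF measurable_k_hat]) measurable

lemma k_lim: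
  assumes \<eta>0: "\<eta>0 > 0"
  shows "(\<lambda>n. \<P>(\<omega> in P. \<bar>real (k n \<omega>) - \<kappa> n\<bar> > \<eta>0 * \<kappa> n)) \<longlonglongrightarrow> 0"
proof -
  define \<eta> where "\<eta> = min (\<eta>0 / 2) (1/2)"
  have \<eta>: "0 < \<eta>" "\<eta> < 1" "2 * \<eta> \<le> \<eta>0" using \<eta>0 by (auto simp: \<eta>_def min_def)
  \<comment> \<open>The first bound makes the counts at \<open>w n\<close> and \<open>w n + \<theta>\<close> comparable up to a factor \<open>1 - \<eta> / 2\<close>, the second keeps \<open>w n + \<theta>\<close>
    below the truncation level.\<close>
  define \<theta> where "\<theta> = min (\<eta> / 2) (- (\<alpha> * ln \<gamma>) / 2)"
  have lg: "\<alpha> * ln \<gamma> < 0" using \<alpha> \<gamma> by (simp add: mult_pos_neg)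
  have \<theta>: "0 < \<theta>" "\<theta> \<le> \<eta> / 2" "\<theta> < - (\<alpha> * ln \<gamma>)" using lg \<eta> by (auto simp: \<theta>_def min_def)
  have wl: "filterlim (\<lambda>n. w n + \<theta>) at_top sequentially"
    using filterlim_tendsto_add_at_top[OF tendsto_const w_lim, of \<theta>] by (simp add: add.commute)
  have big: "filterlim (\<lambda>n. real n * exp (- (w n + x))) at_top sequentially" for x
  proof -
    have "real n * exp (- (w n + x)) = exp (- (\<alpha> * ln \<gamma>) - x) * (real n * exp (- v n))" for n
      unfolding w_def by (simp add: exp_add[symmetric] algebra_simps)
    then show ?thesis by (simp only:) (rule filterlim_tendsto_pos_mult_at_top[OF tendsto_const _ many], simp)
  qed
  let ?B1 = "\<lambda>n. {\<omega>\<in>space P. U n \<omega> > exp (\<theta> / \<alpha>) - 1}"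
  let ?B2 = "\<lambda>n. {\<omega>\<in>space P. \<bar>exceed n (v n) \<omega> - real n * exp (- v n)\<bar> > 1/2 * (real n * exp (- v n))}"
  let ?B3 = "\<lambda>n. {\<omega>\<in>space P. \<bar>exceed n (w n) \<omega> - real n * exp (- w n)\<bar> > \<eta> * (real n * exp (- w n))}"
  let ?B4 = "\<lambda>n. {\<omega>\<in>space P. \<bar>exceed n (w n + \<theta>) \<omega> - real n * exp (- (w n + \<theta>))\<bar> > \<eta> / 4 * (real n * exp (- (w n + \<theta>)))}"
  have lims: "(\<lambda>n. prob (?B1 n)) \<longlonglongrightarrow> 0" "(\<lambda>n. prob (?B2 n)) \<longlonglongrightarrow> 0" "(\<lambda>n. prob (?B3 n)) \<longlonglongrightarrow> 0" "(\<lambda>n. prob (?B4 n)) \<longlonglongrightarrow> 0"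
  proof -
    show "(\<lambda>n. prob (?B1 n)) \<longlonglongrightarrow> 0" using \<theta> \<alpha> by (intro U_lim) simp
    show "(\<lambda>n. prob (?B2 n)) \<longlonglongrightarrow> 0" by (rule exceed_relative_error[OF v_lim many]) simp
    show "(\<lambda>n. prob (?B3 n)) \<longlonglongrightarrow> 0" by (rule exceed_relative_error[OF w_lim]) (use big[of 0] \<eta> in auto)
    show "(\<lambda>n. prob (?B4 n)) \<longlonglongrightarrow> 0" by (rule exceed_relative_error[OF wl big]) (use \<eta> in auto)
  qed
  have "(\<lambda>n. prob (?B1 n) + prob (?B2 n) + prob (?B3 n) + prob (?B4 n)) \<longlonglongrightarrow> 0"
    using tendsto_add[OF tendsto_add[OF tendsto_add[OF lims(1,2)] lims(3)] lims(4)] by simp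
  then show ?thesis
  proof (rule tendsto_sandwich[OF _ _ tendsto_const, rotated 2])
    have "\<forall>\<^sub>F n in sequentially. n \<ge> 1" by (rule eventually_ge_at_top)
    moreover have "\<forall>\<^sub>F n in sequentially. - ln c \<le> w n" using filterlim_at_top[THEN iffD1, OF w_lim] by blast
    moreover have "\<forall>\<^sub>F n in sequentially. 1 / \<eta> \<le> \<kappa> n" using filterlim_at_top[THEN iffD1, OF \<kappa>_lim] by blast
    ultimately show "\<forall>\<^sub>F n in sequentially. \<P>(\<omega> in P. \<bar>real (k n \<omega>) - \<kappa> n\<bar> > \<eta>0 * \<kappa> n)
        \<le> prob (?B1 n) + prob (?B2 n) + prob (?B3 n) + prob (?B4 n)"
    proof eventually_elim
      case (elim n)
      define q where "q = exp (- w n)"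
      have q: "q > 0" unfolding q_def by simp
      have nq: "real n * q > 0" using elim(1) q by simp
      have \<kappa>q: "\<kappa> n = real n * q powr \<beta>" unfolding \<kappa>_def \<sigma>_def q_def by (simp add: powr_def)
      have \<kappa>1: "1 \<le> \<eta> * \<kappa> n" using elim(3) \<eta> by (simp add: field_simps)
      have \<kappa>0: "\<kappa> n > 0" using elim(3) \<eta> by (smt (verit) divide_pos_pos)
      have wv: "w n + \<theta> < v n" unfolding w_def using \<theta>(3) by simp
      have AEk: "AE \<omega> in P. \<omega> \<in> {\<omega>\<in>space P. \<bar>real (k n \<omega>) - \<kappa> n\<bar> > \<eta>0 * \<kappa> n} \<longrightarrow> \<omega> \<in> ((?B1 n \<union> ?B2 n) \<union> ?B3 n) \<union> ?B4 n"
        using AE_L_pos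
      proof eventually_elim
        case (elim \<omega>)
        show ?case
        proof (rule impI, rule ccontr)
          assume bad: "\<omega> \<in> {\<omega>\<in>space P. \<bar>real (k n \<omega>) - \<kappa> n\<bar> > \<eta>0 * \<kappa> n}" "\<omega> \<notin> ((?B1 n \<union> ?B2 n) \<union> ?B3 n) \<union> ?B4 n"
          have \<omega>: "\<omega> \<in> space P" using bad by auto
          have b1: "U n \<omega> \<le> exp (\<theta> / \<alpha>) - 1" using bad \<omega> by auto
          have b2: "\<bar>exceed n (v n) \<omega> - real n * exp (- v n)\<bar> \<le> 1/2 * (real n * exp (- v n))" using bad \<omega> by auto
          have b3: "\<bar>exceed n (w n) \<omega> - real n * q\<bar> \<le> \<eta> * (real n * q)" using bad \<omega> unfolding q_def by auto
          have b4: "\<bar>exceed n (w n + \<theta>) \<omega> - real n * exp (- (w n + \<theta>))\<bar> \<le> \<eta> / 4 * (real n * exp (- (w n + \<theta>)))" using bad \<omega> by auto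
          have "real n * exp (- v n) > 0" using \<open>n \<ge> 1\<close> by simp
          then have hit: "exceed n (v n) \<omega> > 0" using abs_le_D2[OF b2] by linarith
          note cnt = count_near_maximum[OF \<open>n \<ge> 1\<close> _ less_imp_le[OF \<theta>(1)] b1 hit \<open>- ln c \<le> w n\<close> wv]
          have up: "exceed n (w n) \<omega> \<le> (1 + \<eta>) * (real n * q)" using abs_le_D1[OF b3] by (simp add: algebra_simps)
          have low: "(1 - \<eta>) * (real n * q) \<le> exceed n (w n + \<theta>) \<omega>"
          proof -
            have "1 - \<eta> \<le> (1 - \<eta> / 4) * (1 - \<eta> / 2)"
            proof -
              have "(1 - \<eta> / 4) * (1 - \<eta> / 2) = 1 - \<eta> * (3/4) + \<eta> * \<eta> / 8" by (simp add: field_simps)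
              moreover have "0 \<le> \<eta> * \<eta> / 8" by simp
              ultimately show ?thesis using \<eta> by linarith
            qed
            also have "\<dots> \<le> (1 - \<eta> / 4) * exp (- \<theta>)"
              using exp_ge_add_one_self[of "- \<theta>"] \<theta> \<eta> by (intro mult_left_mono) auto
            finally have "(1 - \<eta>) * (real n * q) \<le> ((1 - \<eta> / 4) * exp (- \<theta>)) * (real n * q)"
              using nq by (intro mult_right_mono) auto
            also have "\<dots> = (1 - \<eta> / 4) * (real n * exp (- (w n + \<theta>)))"
              unfolding q_def by (simp add: exp_diff exp_minus field_simps exp_add)
            also have "\<dots> \<le> exceed n (w n + \<theta>) \<omega>" using abs_le_D2[OF b4] by (simp add: algebra_simps)
            finally show ?thesis .
          qed
          have "\<bar>real (k n \<omega>) - real n * q powr \<beta>\<bar> \<le> 2 * \<eta> * (real n * q powr \<beta>)"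
            unfolding k_def
          proof (rule k_hat_near[OF \<open>n \<ge> 1\<close> \<beta>(1) less_imp_le[OF \<beta>(2)] \<eta>(1,2) q])
            show "(1 - \<eta>) * (real n * q) \<le> (\<Sum>j=1..n. of_bool (truncated_sample (m n) H L \<omega> j > \<gamma> * order_stat n (truncated_sample (m n) H L \<omega>) 1))"
              using cnt(1) low elim by fastforce
            show "(\<Sum>j=1..n. of_bool (truncated_sample (m n) H L \<omega> j > \<gamma> * order_stat n (truncated_sample (m n) H L \<omega>) 1)) \<le> (1 + \<eta>) * (real n * q)"
              using cnt(2) up elim by fastforce
            show "1 \<le> \<eta> * (real n * q powr \<beta>)" using \<kappa>1 unfolding \<kappa>q .
          qed
          then have "\<bar>real (k n \<omega>) - \<kappa> n\<bar> \<le> 2 * \<eta> * \<kappa> n" unfolding \<kappa>q .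
          also have "\<dots> \<le> \<eta>0 * \<kappa> n" using \<eta>(3) \<kappa>0 by (intro mult_right_mono) auto
          finally show False using bad(1) by simp
        qed
      qed
      have "\<P>(\<omega> in P. \<bar>real (k n \<omega>) - \<kappa> n\<bar> > \<eta>0 * \<kappa> n) \<le> prob (((?B1 n \<union> ?B2 n) \<union> ?B3 n) \<union> ?B4 n)"
        by (rule finite_measure_mono_AE[OF AEk]) measurable
      also have "\<dots> \<le> prob ((?B1 n \<union> ?B2 n) \<union> ?B3 n) + prob (?B4 n)" by (rule measure_Un_le) measurable
      also have "prob ((?B1 n \<union> ?B2 n) \<union> ?B3 n) \<le> prob (?B1 n \<union> ?B2 n) + prob (?B3 n)" by (rule measure_Un_le) measurable
      also have "prob (?B1 n \<union> ?B2 n) \<le> prob (?B1 n) + prob (?B2 n)" by (rule measure_Un_le) measurable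
      finally show ?case by simp
    qed
  qed simp
qed

text \<open>Observations below the truncation point give the same contribution on both sides. For a truncated one the difference is
the logarithmic overshoot of \<open>m n + L j\<close> minus the excess of \<open>V j\<close> over \<open>v n\<close>.\<close>

lemma hill_excess_near:
  fixes n :: nat and \<omega> :: 'a
  defines "x \<equiv> truncated_sample (m n) H L \<omega>"
  assumes L: "\<And>j. L j \<omega> > 0" and k: "1 \<le> k'" "k' \<le> n"
    and S: "- ln c \<le> S" "S < v n" "order_stat n x k' = level S"
  shows "\<bar>\<alpha> * (real k' * hill n x k') - excess n S \<omega>\<bar> \<le> R n \<omega>"
proof -
  let ?os = "level S"
  have lnos: "\<alpha> * ln ?os = S + ln c" unfolding level_def using \<alpha> by simp
  have hill: "\<alpha> * (real k' * hill n x k') = (\<Sum>j=1..n. \<alpha> * (max 0 (ln (x j) - ln ?os) * of_bool (x j > ?os)))"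
    by (simp only: hill_eq_log_excess[OF k S(3) level_pos] sum_distrib_left)
  have os1: "1 \<le> ?os" unfolding level_def using S(1) \<alpha> by simp
  have osm: "?os < m n" using level_less_iff[of S "v n"] S(2) level_v by simp
  have vS: "- ln c \<le> v n" using S by simp
  have term_le: "\<bar>\<alpha> * (max 0 (ln (x j) - ln ?os) * of_bool (x j > ?os)) - max 0 (V j \<omega> - S)\<bar>
     \<le> \<alpha> * (of_bool (H j \<omega> > m n) * (max 0 (L j \<omega>) / m n)) + max 0 (V j \<omega> - v n)" for j
  proof (cases "H j \<omega> \<le> m n")
    case True
    then have xj: "x j = H j \<omega>" unfolding x_def truncated_sample_def by simp
    have eq: "\<alpha> * (max 0 (ln (x j) - ln ?os) * of_bool (x j > ?os)) = max 0 (V j \<omega> - S)"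
    proof (cases "H j \<omega> > ?os")
      case gt: True
      then have "V j \<omega> > S" using V_greater_iff[OF S(1)] by simp
      moreover have "ln ?os < ln (H j \<omega>)" using gt os1 by simp
      moreover have "V j \<omega> - S = \<alpha> * (ln (H j \<omega>) - ln ?os)"
        unfolding V_eq right_diff_distrib lnos using gt os1 by (simp add: max_def)
      ultimately show ?thesis using gt xj by simp
    next
      case False
      then have "V j \<omega> \<le> S" using V_greater_iff[OF S(1), of j \<omega>] by simp
      then show ?thesis using False xj by simp
    qed
    show ?thesis unfolding eq using True by simp
  next
    case False
    then have xj: "x j = m n + L j \<omega>" unfolding x_def truncated_sample_def by simp
    have xg: "x j > ?os" using xj osm L[of j] by simp
    have Vv: "V j \<omega> > v n" using V_greater_iff[OF vS, of j \<omega>] False level_v by simp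
    have ln1: "ln (x j) = ln (m n) + ln (1 + L j \<omega> / m n)"
    proof -
      have "x j = m n * (1 + L j \<omega> / m n)" using xj m_pos[of n] by (simp add: field_simps)
      moreover have "1 + L j \<omega> / m n \<noteq> 0" using m_pos[of n] L[of j] by (smt (verit) divide_pos_pos)
      ultimately show ?thesis using m_pos[of n] by (simp add: ln_mult)
    qed
    have pos: "0 < L j \<omega> / m n" using m_pos[of n] L[of j] by simp
    have lnb: "0 \<le> ln (1 + L j \<omega> / m n)" "ln (1 + L j \<omega> / m n) \<le> L j \<omega> / m n"
      using pos by (auto intro!: ln_add_one_self_le_self)
    have lnle: "ln ?os \<le> ln (x j)" using xg os1 by simp
    have "\<alpha> * (max 0 (ln (x j) - ln ?os) * of_bool (x j > ?os)) = \<alpha> * ln (x j) - \<alpha> * ln ?os"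
      using xg lnle by (simp add: right_diff_distrib)
    also have "\<dots> = v n + \<alpha> * ln (1 + L j \<omega> / m n) - S"
      unfolding lnos ln1 v_def by (simp add: distrib_left)
    finally have e: "\<alpha> * (max 0 (ln (x j) - ln ?os) * of_bool (x j > ?os)) = v n + \<alpha> * ln (1 + L j \<omega> / m n) - S" .
    have "0 \<le> \<alpha> * ln (1 + L j \<omega> / m n)" using lnb \<alpha> by simp
    moreover have "\<alpha> * ln (1 + L j \<omega> / m n) \<le> \<alpha> * (L j \<omega> / m n)"
      by (rule mult_left_mono[OF lnb(2)]) (use \<alpha> in simp)
    moreover have "max 0 (V j \<omega> - S) = V j \<omega> - S" "max 0 (V j \<omega> - v n) = V j \<omega> - v n" using Vv S(2) by auto
    moreover have "\<alpha> * (of_bool (H j \<omega> > m n) * (max 0 (L j \<omega>) / m n)) = \<alpha> * (L j \<omega> / m n)"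
      using False L[of j] by simp
    ultimately show ?thesis unfolding e using Vv by (intro abs_leI) linarith+
  qed
  have diff: "\<alpha> * (real k' * hill n x k') - excess n S \<omega>
      = (\<Sum>j=1..n. \<alpha> * (max 0 (ln (x j) - ln ?os) * of_bool (x j > ?os)) - max 0 (V j \<omega> - S))"
    unfolding hill excess_def by (simp only: sum_subtractf)
  have "\<bar>\<alpha> * (real k' * hill n x k') - excess n S \<omega>\<bar>
      \<le> (\<Sum>j=1..n. \<alpha> * (of_bool (H j \<omega> > m n) * (max 0 (L j \<omega>) / m n)) + max 0 (V j \<omega> - v n))"
    unfolding diff by (rule order_trans[OF sum_abs sum_mono]) (rule term_le)
  also have "\<dots> = R n \<omega>" unfolding R_def U_def excess_def by (simp only: sum.distrib sum_distrib_left)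
  finally show ?thesis .
qed

text \<open>The hypothesis \<open>link\<close> of \<open>random_level_clt\<close> comes from the duality between order statistics and counts. It applies because
\<open>\<sigma>\<close> grows like \<open>\<beta> v\<close>, so the whole window eventually lies below the truncation level \<open>v\<close>.\<close>

theorem hill_clt:
  "weak_conv_m (\<lambda>n. distr P borel (\<lambda>\<omega>. let x = truncated_sample (m n) H L \<omega>; k = k_hat \<beta> \<gamma> n x
        in sqrt (real k) * (hill n x k - 1 / \<alpha>)))
     (density lborel (normal_density 0 (1 / \<alpha>)))"
proof -
  define x where "x n \<omega> = truncated_sample (m n) H L \<omega>" for n \<omega>
  define Q where "Q n \<omega> = \<alpha> * (real (k n \<omega>) * hill n (x n \<omega>) (k n \<omega>))" for n \<omega>
  have Z_eq: "(let x = truncated_sample (m n) H L \<omega>; k = k_hat \<beta> \<gamma> n x in sqrt (real k) * (hill n x k - 1 / \<alpha>))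
      = 1 / \<alpha> * ((Q n \<omega> - real (k n \<omega>)) / sqrt (real (k n \<omega>)))" for n \<omega>
  proof -
    have "1 / \<alpha> * ((\<alpha> * (y * h) - y) / sqrt y) = sqrt y * (h - 1 / \<alpha>)" if "y \<ge> 0" for y h :: real
    proof (cases "y = 0")
      case False
      have "1 / \<alpha> * ((\<alpha> * (y * h) - y) / sqrt y) = (y / sqrt y) * (h - 1 / \<alpha>)"
        using \<alpha> by (simp add: field_simps)
      also have "y / sqrt y = sqrt y" using that by (rule real_div_sqrt)
      finally show ?thesis .
    qed simp
    from this[of "real (k n \<omega>)" "hill n (x n \<omega>) (k n \<omega>)"]
    show ?thesis unfolding Q_def k_def[symmetric] x_def[symmetric] by (simp add: Let_def k_def x_def)
  qed
  have meas: "(\<lambda>\<omega>. 1 / \<alpha> * ((Q n \<omega> - real (k n \<omega>)) / sqrt (real (k n \<omega>)))) \<in> borel_measurable P" for n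
    unfolding Z_eq[symmetric] using borel_measurable_hill_k_hat[of "truncated_sample (m n) H L" P \<beta> \<gamma> n "1 / \<alpha>"] \<beta>
    by (simp add: Let_def)
  have Zm: "(\<lambda>\<omega>. (Q n \<omega> - real (k n \<omega>)) / sqrt (real (k n \<omega>))) \<in> borel_measurable P" for n
  proof -
    have "(\<lambda>\<omega>. \<alpha> * (1 / \<alpha> * ((Q n \<omega> - real (k n \<omega>)) / sqrt (real (k n \<omega>))))) \<in> borel_measurable P"
      by (intro borel_measurable_times borel_measurable_const meas)
    moreover have "\<alpha> * (1 / \<alpha> * z) = z" for z using \<alpha> by simp
    ultimately show ?thesis by simp
  qed
  have conv: "weak_conv_m (\<lambda>n. distr P borel (\<lambda>\<omega>. (Q n \<omega> - real (k n \<omega>)) / sqrt (real (k n \<omega>)))) std_normal_distribution"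
  proof (rule random_level_clt[where \<sigma> = \<sigma> and R = R])
    show "filterlim \<sigma> at_top sequentially" by (rule \<sigma>_lim)
    show "filterlim (\<lambda>n. real n * exp (- \<sigma> n)) at_top sequentially" using \<kappa>_lim unfolding \<kappa>_def[abs_def] .
    show "(\<lambda>n. sqrt (real n * exp (- \<sigma> n)) * exp (- \<tau> * \<sigma> n)) \<longlonglongrightarrow> 0" using bias_lim unfolding \<kappa>_def .
    show "(\<lambda>n. \<P>(\<omega> in P. \<bar>real (k n \<omega>) - real n * exp (- \<sigma> n)\<bar> > \<eta> * (real n * exp (- \<sigma> n)))) \<longlonglongrightarrow> 0" if "\<eta> > 0" for \<eta>
      using k_lim[OF that] unfolding \<kappa>_def .
    show "(\<lambda>n. \<P>(\<omega> in P. R n \<omega> > \<epsilon> * sqrt (real n * exp (- \<sigma> n)))) \<longlonglongrightarrow> 0" if "\<epsilon> > 0" for \<epsilon>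
      using R_lim[OF that] unfolding \<kappa>_def .
    fix \<delta> :: real assume \<delta>: "0 < \<delta>"
    have gap: "filterlim (\<lambda>n. (1 - \<beta>) * v n) at_top sequentially"
      using \<beta> by (intro filterlim_tendsto_pos_mult_at_top[OF tendsto_const _ v_lim]) simp
    have "\<forall>\<^sub>F n in sequentially. \<delta> + \<bar>\<beta> * (\<alpha> * ln \<gamma>)\<bar> < (1 - \<beta>) * v n"
      using filterlim_at_top_dense[THEN iffD1, OF gap] by blast
    moreover have "\<forall>\<^sub>F n in sequentially. \<delta> - ln c \<le> \<sigma> n" using filterlim_at_top[THEN iffD1, OF \<sigma>_lim] by blast
    ultimately show "\<forall>\<^sub>F n in sequentially. AE \<omega> in P.
        real (k n \<omega>) \<le> exceed n (\<sigma> n - \<delta>) \<omega> \<longrightarrow> exceed n (\<sigma> n + \<delta>) \<omega> < real (k n \<omega>) \<longrightarrow>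
        (\<exists>S. \<sigma> n - \<delta> < S \<and> S \<le> \<sigma> n + \<delta> \<and> exceed n S \<omega> < real (k n \<omega>) \<and>
          (\<forall>s. \<sigma> n - \<delta> \<le> s \<longrightarrow> s < S \<longrightarrow> real (k n \<omega>) \<le> exceed n s \<omega>) \<and>
          \<bar>Q n \<omega> - excess n S \<omega>\<bar> \<le> R n \<omega>)"
    proof eventually_elim
      case (elim n)
      have top: "\<sigma> n + \<delta> < v n"
      proof -
        have "\<sigma> n = v n - (1 - \<beta>) * v n + \<beta> * (\<alpha> * ln \<gamma>)" unfolding \<sigma>_def w_def by (simp add: algebra_simps)
        then show ?thesis using elim(1) by linarith
      qed
      have bot: "- ln c \<le> \<sigma> n - \<delta>" using elim(2) by simp
      show ?case using AE_L_pos
      proof eventually_elim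
        case (elim \<omega>)
        show ?case
        proof (intro impI)
          assume above: "real (k n \<omega>) \<le> exceed n (\<sigma> n - \<delta>) \<omega>" and below: "exceed n (\<sigma> n + \<delta>) \<omega> < real (k n \<omega>)"
          have "0 \<le> exceed n (\<sigma> n + \<delta>) \<omega>" unfolding exceed_def by (intro sum_nonneg) auto
          then have k1: "1 \<le> k n \<omega>" using below by linarith
          have kn: "k n \<omega> \<le> n" unfolding k_def by (rule k_hat_le) (use \<beta> in simp)
          define os where "os = order_stat n (x n \<omega>) (k n \<omega>)"
          have cnt: "(\<Sum>j=1..n. of_bool (x n \<omega> j > level s)) = exceed n s \<omega>" if "- ln c \<le> s" "s < v n" for s
            unfolding x_def by (rule count_X[OF that]) (use elim in blast)
          have os_iff: "os > level s \<longleftrightarrow> real (k n \<omega>) \<le> exceed n s \<omega>" if "- ln c \<le> s" "s < v n" for s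
            unfolding os_def order_stat_greater_iff[OF k1 kn] cnt[OF that] ..
          have lo: "level (\<sigma> n - \<delta>) < os" using os_iff[of "\<sigma> n - \<delta>"] above bot top \<delta> by simp
          have up: "os \<le> level (\<sigma> n + \<delta>)" using os_iff[of "\<sigma> n + \<delta>"] below bot top \<delta> by simp
          have os_pos: "os > 0" using lo level_pos[of "\<sigma> n - \<delta>"] by linarith
          define S where "S = \<alpha> * ln os - ln c"
          have levS: "level S = os" unfolding S_def by (rule level_of_log[OF os_pos])
          have S: "\<sigma> n - \<delta> < S" "S \<le> \<sigma> n + \<delta>"
            using lo up level_less_iff[of "\<sigma> n - \<delta>" S] level_less_iff[of "\<sigma> n + \<delta>" S] unfolding levS by auto
          have SS: "- ln c \<le> S" "S < v n" using S bot top by auto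
          have eS: "exceed n S \<omega> < real (k n \<omega>)" using os_iff[OF SS] unfolding levS by simp
          have all: "\<forall>s. \<sigma> n - \<delta> \<le> s \<longrightarrow> s < S \<longrightarrow> real (k n \<omega>) \<le> exceed n s \<omega>"
          proof (intro allI impI)
            fix s assume s: "\<sigma> n - \<delta> \<le> s" "s < S"
            then show "real (k n \<omega>) \<le> exceed n s \<omega>"
              using os_iff[of s] level_less_iff[of s S] SS bot unfolding levS by auto
          qed
          have "\<bar>Q n \<omega> - excess n S \<omega>\<bar> \<le> R n \<omega>"
            unfolding Q_def x_def
            by (rule hill_excess_near[OF _ k1 kn SS]) (use elim levS in \<open>auto simp: os_def x_def\<close>)
          then show "\<exists>S. \<sigma> n - \<delta> < S \<and> S \<le> \<sigma> n + \<delta> \<and> exceed n S \<omega> < real (k n \<omega>) \<and>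
            (\<forall>s. \<sigma> n - \<delta> \<le> s \<longrightarrow> s < S \<longrightarrow> real (k n \<omega>) \<le> exceed n s \<omega>) \<and>
            \<bar>Q n \<omega> - excess n S \<omega>\<bar> \<le> R n \<omega>" using S eS all by blast
        qed
      qed
    qed
  qed (use Zm in auto)
  show ?thesis unfolding Z_eq
    by (rule weak_conv_m_scale_std_normal[OF Zm _ conv]) (use \<alpha> in simp)
qed

end

section \<open>The Hill statistic of a truncated sample\<close>

theorem theorem3p1:
  fixes P :: "'a measure"
    and H L :: "nat \<Rightarrow> 'a \<Rightarrow> real"
    and M :: "nat \<Rightarrow> real"
    and \<alpha> \<beta> \<gamma> \<rho> :: real
  assumes "prob_space P"
    and "prob_space.indep_vars P (\<lambda>_. borel) H UNIV"
    and "\<And>i. distr P borel (H i) = distr P borel (H 0)"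
    and "\<And>i. AE \<omega> in P. H i \<omega> > 0"
    and "prob_space.indep_vars P (\<lambda>_. borel) L UNIV"
    and "\<And>i. distr P borel (L i) = distr P borel (L 0)"
    and "\<And>i. AE \<omega> in P. L i \<omega> > 0"
    and "prob_space.indep_var P (PiM UNIV (\<lambda>_. borel)) (\<lambda>\<omega> i. H i \<omega>)
                                (PiM UNIV (\<lambda>_. borel)) (\<lambda>\<omega> i. L i \<omega>)"
    and "\<alpha> > 0"
    and "regularly_varying (\<lambda>x. \<P>(\<omega> in P. H 0 \<omega> > x)) (-\<alpha>)"
    and "\<And>n. M n > 0"
    and "filterlim M at_top sequentially"
    and "0 < \<beta>" and "\<beta> < 1" and "0 < \<gamma>" and "\<gamma> < 1"
    and "max (1 - 1 / \<alpha>) 0 < \<beta>"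
    and "\<And>p::nat. integrable P (\<lambda>\<omega>. L 0 \<omega> ^ p)"
    and "filterlim (\<lambda>n. real n * \<P>(\<omega> in P. H 0 \<omega> > M n)) at_top sequentially"
    and "(\<lambda>n. real n * \<P>(\<omega> in P. H 0 \<omega> > M n) powr (2 - \<beta>) * (ln (M n))\<^sup>2) \<longlonglongrightarrow> 0"
    and "second_order_regularly_varying (\<lambda>x. \<P>(\<omega> in P. H 0 \<omega> > x)) \<alpha> \<rho>"
    and "\<rho> < - ((1 - \<beta>) / \<beta>)"
  shows "weak_conv_m
     (\<lambda>n. distr P borel (\<lambda>\<omega>.
        let x = truncated_sample (M n) H L \<omega>; k = k_hat \<beta> \<gamma> n x
        in sqrt (real k) * (hill n x k - 1 / \<alpha>)))
     (density lborel (normal_density 0 (1 / \<alpha>)))"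
proof -
  interpret P: prob_space P by fact
  note indH = assms(2) and identH = assms(3) and indL = assms(5) and identL = assms(6) and Lpos = assms(7) and indHL = assms(8)
  have H_meas[measurable]: "H j \<in> borel_measurable P" for j using indH unfolding P.indep_vars_def by auto
  have L_meas[measurable]: "L j \<in> borel_measurable P" for j using indL unfolding P.indep_vars_def by auto
  define F where "F x = \<P>(\<omega> in P. H 0 \<omega> > x)" for x
  have F_anti: "antimono F"
    unfolding F_def by (intro antimonoI P.finite_measure_mono) auto
  \<comment> \<open>The midpoint of the interval between \<open>(1 - \<beta>) / \<beta>\<close> and \<open>- \<rho>\<close>.\<close>
  define \<tau> where "\<tau> = ((1 - \<beta>) / \<beta> - \<rho>) / 2"
  have \<tau>: "0 < \<tau>" "\<tau> < - \<rho>" "(1 - \<beta>) / \<beta> \<le> \<tau>"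
  proof -
    have "0 < d \<Longrightarrow> \<rho> < - d \<Longrightarrow> 0 < (d - \<rho>) / 2 \<and> (d - \<rho>) / 2 < - \<rho> \<and> d \<le> (d - \<rho>) / 2" for d by simp
    from this[of "(1 - \<beta>) / \<beta>"] show "0 < \<tau>" "\<tau> < - \<rho>" "(1 - \<beta>) / \<beta> \<le> \<tau>"
      using assms(13,14,22) unfolding \<tau>_def by simp_all
  qed
  obtain c K y0 where c: "c > 0"
    and expand: "\<And>y. y \<ge> y0 \<Longrightarrow> \<bar>F (exp y) * exp (\<alpha> * y) / c - 1\<bar> \<le> K * exp (- (\<tau> * \<alpha>) * y)"
    using second_order_tail_expansion[OF F_anti assms(10)[folded F_def] assms(9) assms(21)[folded F_def] \<tau>(1,2)] by metis
  define f where "f h = \<alpha> * ln (max h 1) - ln c" for h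
  have f_meas[measurable]: "f \<in> borel_measurable borel" unfolding f_def by measurable
  define V where "V j \<omega> = f (H j \<omega>)" for j \<omega>
  have V_meas[measurable]: "V j \<in> borel_measurable P" for j unfolding V_def by measurable
  define T where "T v = \<P>(\<omega> in P. V 0 \<omega> > v)" for v
  have identV: "distr P borel (V j) = distr P borel (V 0)" for j
  proof -
    have "distr P borel (V j) = distr (distr P borel (H j)) borel f" for j
      unfolding V_def[abs_def] by (subst distr_distr) (auto simp: comp_def)
    then show ?thesis using identH by metis
  qed
  have tail_prob: "\<P>(\<omega> in P. V j \<omega> > v) = T v" for j v
  proof -
    have "\<P>(\<omega> in P. V j \<omega> > v) = measure (distr P borel (V j)) {v<..}" for j
      by (subst measure_distr) (auto intro!: arg_cong[where f = "measure P"])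
    then show ?thesis unfolding T_def identV[of j] by (metis identV)
  qed
  define K' where "K' = K * exp (- \<tau> * ln c)"
  define v0 where "v0 = max (\<alpha> * y0 - ln c) (- ln c)"
  have T_F: "T v = F (exp ((v + ln c) / \<alpha>))" if "- ln c \<le> v" for v
  proof -
    have "V 0 \<omega> > v \<longleftrightarrow> H 0 \<omega> > exp ((v + ln c) / \<alpha>)" for \<omega>
      unfolding V_def f_def by (rule less_log_max_iff[OF assms(9) that])
    then show ?thesis unfolding T_def F_def by simp
  qed
  have T_expand: "\<bar>T v * exp v - 1\<bar> \<le> K' * exp (- \<tau> * v)" if v: "v0 \<le> v" for v
  proof -
    define y where "y = (v + ln c) / \<alpha>"
    have y: "y \<ge> y0" "\<alpha> * y = v + ln c" using v assms(9) unfolding y_def v0_def by (simp_all add: field_simps)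
    have "T v * exp v = F (exp y) * exp (\<alpha> * y) / c"
      using T_F[of v] v c unfolding y(2) by (simp add: y_def v0_def exp_add)
    moreover have "K * exp (- (\<tau> * \<alpha>) * y) = K' * exp (- \<tau> * v)"
    proof -
      have "- (\<tau> * \<alpha>) * y = - \<tau> * (\<alpha> * y)" by simp
      then show ?thesis unfolding y(2) K'_def by (simp add: exp_add[symmetric] algebra_simps)
    qed
    ultimately show ?thesis using expand[OF y(1)] by simp
  qed
  have indV: "P.indep_vars (\<lambda>_. borel) V UNIV"
    unfolding V_def[abs_def] by (rule P.indep_vars_compose2[OF indH]) auto
  interpret S: exponential_tail_sample P V T K' \<tau> v0
    by unfold_locales (use indV identV tail_prob \<tau>(1) T_expand in auto)
  have intL: "integrable P (L j)" and meanL: "P.expectation (L j) = P.expectation (L 0)" for j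
  proof -
    have "integrable P (L 0)" using assms(18)[of 1] by simp
    then have "integrable (distr P borel (L 0)) (\<lambda>x. x)" by (subst integrable_distr_eq) auto
    then have "integrable (distr P borel (L j)) (\<lambda>x. x)" using identL by metis
    then show "integrable P (L j)" by (subst (asm) integrable_distr_eq) auto
    have "P.expectation (L j) = (\<integral>x. x \<partial>distr P borel (L j))" for j by (subst integral_distr) auto
    then show "P.expectation (L j) = P.expectation (L 0)" using identL by metis
  qed
  have HL: "P.indep_var borel (H j) borel (L j)" for j
  proof -
    have "P.indep_var borel ((\<lambda>f. f j) \<circ> (\<lambda>\<omega> i. H i \<omega>)) borel ((\<lambda>f. f j) \<circ> (\<lambda>\<omega> i. L i \<omega>))"
      by (rule P.indep_var_compose[OF indHL]) auto
    then show ?thesis by (simp add: comp_def)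
  qed
  define v where "v n = \<alpha> * ln (M n) - ln c" for n
  define p where "p n = F (M n)" for n
  have ln_lim: "filterlim (\<lambda>n. ln (M n)) at_top sequentially" by (rule filterlim_compose[OF ln_at_top assms(12)])
  have v_lim: "filterlim v at_top sequentially"
  proof -
    have "filterlim (\<lambda>n. \<alpha> * ln (M n)) at_top sequentially"
      by (rule filterlim_tendsto_pos_mult_at_top[OF tendsto_const assms(9) ln_lim])
    from filterlim_tendsto_add_at_top[OF tendsto_const this, of "- ln c"]
    show ?thesis unfolding v_def[abs_def] by (simp add: algebra_simps)
  qed
  have p_T: "- ln c \<le> v n \<Longrightarrow> p n = T (v n)" for n
    unfolding p_def using T_F[of "v n"] assms(9) assms(11)[of n] by (simp add: v_def)
  have p_bounds: "\<forall>\<^sub>F n in sequentially. exp (- v n) \<le> 2 * p n \<and> p n \<le> 2 * exp (- v n)"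
  proof -
    have "\<forall>\<^sub>F n in sequentially. K' * exp (- \<tau> * v n) < 1/2"
      by (rule order_tendstoD(2)[OF tendsto_exp_decay[OF \<tau>(1) v_lim]]) simp
    with filterlim_at_top[THEN iffD1, OF v_lim, rule_format, of v0]
    show ?thesis
    proof eventually_elim
      case (elim n)
      have "p n = T (v n)" by (rule p_T) (use elim in \<open>simp add: v0_def\<close>)
      with S.tail_bounds[of "v n" "v n" "1/2"] elim show ?case by simp
    qed
  qed
  interpret Q: truncated_tail_sample P V T K' \<tau> v0 H L M \<alpha> \<beta> \<gamma> c "P.expectation (L 0)"
  proof unfold_locales
    show "V j \<omega> = \<alpha> * ln (max (H j \<omega>) 1) - ln c" for j \<omega> by (simp add: V_def f_def)
    show "\<alpha> * (1 - \<beta>) \<le> 1"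
    proof -
      have "1 - \<beta> \<le> 1 / \<alpha>" using assms(17) by simp
      then have "\<alpha> * (1 - \<beta>) \<le> \<alpha> * (1 / \<alpha>)" using assms(9) by (intro mult_left_mono) auto
      then show ?thesis using assms(9) by simp
    qed
    have "filterlim (\<lambda>n. 1/2 * (real n * p n)) at_top sequentially"
      by (rule filterlim_tendsto_pos_mult_at_top[OF tendsto_const _ assms(19)[folded F_def, folded p_def]]) simp
    then have "filterlim (\<lambda>n. real n * exp (- v n)) at_top sequentially"
    proof (rule filterlim_at_top_mono)
      show "\<forall>\<^sub>F n in sequentially. 1/2 * (real n * p n) \<le> real n * exp (- v n)"
        using p_bounds
      proof eventually_elim
        case (elim n)
        then have "real n * p n \<le> real n * (2 * exp (- v n))" by (intro mult_left_mono) auto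
        then show ?case by simp
      qed
    qed
    then show "filterlim (\<lambda>n. real n * exp (- (\<alpha> * ln (M n) - ln c))) at_top sequentially" unfolding v_def .
    have small: "(\<lambda>n. 2 powr (2 - \<beta>) * (real n * p n powr (2 - \<beta>) * (ln (M n))\<^sup>2)) \<longlonglongrightarrow> 0"
      by (rule tendsto_mult_right_zero[OF assms(20)[folded F_def, folded p_def]])
    have "(\<lambda>n. real n * exp (- (2 - \<beta>) * v n)) \<longlonglongrightarrow> 0"
    proof (rule tendsto_sandwich[OF _ _ tendsto_const small])
      show "\<forall>\<^sub>F n in sequentially. real n * exp (- (2 - \<beta>) * v n) \<le> 2 powr (2 - \<beta>) * (real n * p n powr (2 - \<beta>) * (ln (M n))\<^sup>2)"
        using p_bounds filterlim_at_top[THEN iffD1, OF ln_lim, rule_format, of 1]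
      proof eventually_elim
        case (elim n)
        have "exp (- (2 - \<beta>) * v n) = exp (- v n) powr (2 - \<beta>)" by (simp add: powr_def algebra_simps)
        also have "\<dots> \<le> (2 * p n) powr (2 - \<beta>)" using elim assms(14) by (intro powr_mono2) auto
        also have "\<dots> = 2 powr (2 - \<beta>) * p n powr (2 - \<beta>)" by (rule powr_mult)
        finally have a: "exp (- (2 - \<beta>) * v n) \<le> 2 powr (2 - \<beta>) * p n powr (2 - \<beta>)" .
        have "1 \<le> (ln (M n))\<^sup>2" using elim(2) by (simp add: one_le_power)
        then have "2 powr (2 - \<beta>) * p n powr (2 - \<beta>) * 1 \<le> 2 powr (2 - \<beta>) * p n powr (2 - \<beta>) * (ln (M n))\<^sup>2"
          by (intro mult_left_mono) auto
        with a have "exp (- (2 - \<beta>) * v n) \<le> 2 powr (2 - \<beta>) * p n powr (2 - \<beta>) * (ln (M n))\<^sup>2" by linarith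
        then have "real n * exp (- (2 - \<beta>) * v n) \<le> real n * (2 powr (2 - \<beta>) * p n powr (2 - \<beta>) * (ln (M n))\<^sup>2)"
          by (intro mult_left_mono) auto
        then show ?case by (simp add: mult_ac)
      qed
    qed simp
    then show "(\<lambda>n. real n * exp (- (2 - \<beta>) * (\<alpha> * ln (M n) - ln c))) \<longlonglongrightarrow> 0" unfolding v_def .
  qed (use intL meanL Lpos HL assms(9,11-16) c \<tau>(3) in auto)
  show ?thesis by (rule Q.hill_clt)
qed

end
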